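(* Let $G$ be a connected almost abelian Lie group of dimension $n\geq 3$ with Lie algebra $\mathfrak g$, let $\mathfrak h\subset\mathfrak g$ be a codimension $1$ abelian ideal, and let $g$ be an inner product on $\mathfrak g$, identified with the corresponding left-invariant metric on $G$. Let $b$ be a $g$-unit vector orthogonal to $\mathfrak h$, so that $\mathfrak g=\mathbb R b\oplus\mathfrak h$, and let $A$ and $S$ be the skew-symmetric and symmetric parts (with respect to $g$) of $\mathrm{ad}_b|_{\mathfrak h}:\mathfrak h\to\mathfrak h$. Let $c:=[g]$ be the conformal structure induced by $g$ on $G$, let $\nabla$ be a left-invariant Weyl structure on $(G,c)$, and let $\theta\in\mathfrak g^*$ be the (left-invariant) Lee form of $\nabla$ with respect to $g$, identified with a vector of $\mathfrak g$ via $g$. Then $\nabla$ is a Weyl-Einstein structure if and only if one of the following (mutually exclusive) conditions holds: \begin{enumerate} \item $S=k\,\mathrm{Id}_{\mathfrak h}$ for some $k\in\mathbb R$, and $\theta=0$ or $\theta=kb$; or \item $S\neq 0$, $(\mathrm{Tr}\, S)^2=(n-2)\,\mathrm{Tr}(S^2)$, $[A,S]=0$ and $\theta=\frac{\mathrm{Tr}(S)}{n-2}\,b$. \end{enumerate}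
   Context: A Lie algebra is almost abelian if it has an abelian ideal of codimension 1; a Lie group is almost abelian if its Lie algebra is. A Weyl structure on a conformal manifold $(M,c)$ is a torsion-free linear connection $\nabla$ on $M$ preserving $c$; equivalently, for each metric $g\in c$ there is a 1-form $\theta$ on $M$ (the Lee form of $\nabla$ with respect to $g$) with $\nabla g=-2\theta\otimes g$. One then has $\nabla_XY=\nabla^g_XY+\theta(X)Y+\theta(Y)X-g(X,Y)T$, where $\nabla^g$ is the Levi-Civita connection of $g$ and $T$ is the $g$-dual vector field of $\theta$; conversely any 1-form $\theta$ defines a Weyl structure by this formula. A Weyl structure on a Lie group with a conformal class $c$ containing a left-invariant metric is left-invariant if its Lee form with respect to any left-invariant metric in $c$ is left-invariant. The curvature of $\nabla$ is $R^\nabla(X,Y)Z=\nabla_{[X,Y]}Z-\nabla_X\nabla_YZ+\nabla_Y\nabla_XZ$ and its Ricci tensor is $\mathrm{Ric}^\nabla(X,Y)=\mathrm{Tr}(Z\mapsto R^\nabla(X,Z)Y)$ (in general not symmetric). $\nabla$ is Weyl-Einstein if the trace-free symmetric part of $\mathrm{Ric}^\nabla$ (with respect to some, equivalently any, metric in $c$) vanishes. *)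

theory Defs
  imports "HOL-Analysis.Analysis" "HOL-Algebra.Group"
begin

section \<open>Smooth maps between open subsets of Euclidean spaces\<close>

text \<open>Both notions are only meant for open sets \<open>U\<close>.\<close>

fun Ck_on :: "nat \<Rightarrow> 'e::euclidean_space set \<Rightarrow> ('e \<Rightarrow> 'f::euclidean_space) \<Rightarrow> bool" where
  "Ck_on 0 U f \<longleftrightarrow> continuous_on U f"
| "Ck_on (Suc k) U f \<longleftrightarrow>
     (\<forall>x\<in>U. f differentiable (at x)) \<and> (\<forall>v. Ck_on k U (\<lambda>x. frechet_derivative f (at x) v))"

definition smooth_on :: "'e::euclidean_space set \<Rightarrow> ('e \<Rightarrow> 'f::euclidean_space) \<Rightarrow> bool" where
  "smooth_on U f \<longleftrightarrow> (\<forall>k. Ck_on k U f)"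


section \<open>Smooth manifolds\<close>

text \<open>The points of a manifold form a whole (Hausdorff, second countable) type \<open>'a\<close>, the model
  space is \<open>'e\<close>, so the dimension is \<open>DIM('e)\<close>. A chart is a pair of an open set and a map whose
  values outside that set are irrelevant.\<close>

type_synonym ('a, 'e) chart = "'a set \<times> ('a \<Rightarrow> 'e)"

definition chart_inv :: "('a, 'e) chart \<Rightarrow> 'e \<Rightarrow> 'a" where
  "chart_inv c = inv_into (fst c) (snd c)"

definition smooth_atlas ::
  "('a::{t2_space, second_countable_topology}, 'e::euclidean_space) chart set \<Rightarrow> bool" where
  "smooth_atlas \<A> \<longleftrightarrow>
     (\<forall>c\<in>\<A>. open (fst c) \<and> open (snd c ` fst c) \<and>
            homeomorphism (fst c) (snd c ` fst c) (snd c) (chart_inv c)) \<and>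
     (\<Union>c\<in>\<A>. fst c) = UNIV \<and>
     (\<forall>c\<in>\<A>. \<forall>d\<in>\<A>. smooth_on (snd c ` (fst c \<inter> fst d)) (snd d \<circ> chart_inv c))"

definition prod_atlas ::
  "('a, 'e) chart set \<Rightarrow> ('b, 'f) chart set \<Rightarrow> ('a \<times> 'b, 'e \<times> 'f) chart set" where
  "prod_atlas \<A> \<B> = (\<lambda>(c, d). (fst c \<times> fst d, map_prod (snd c) (snd d))) ` (\<A> \<times> \<B>)"

definition smooth_map ::
  "('a::topological_space, 'e::euclidean_space) chart set \<Rightarrow>
   ('b::topological_space, 'f::euclidean_space) chart set \<Rightarrow> ('a \<Rightarrow> 'b) \<Rightarrow> bool" where
  "smooth_map \<A> \<B> F \<longleftrightarrow> continuous_on UNIV F \<and>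
     (\<forall>c\<in>\<A>. \<forall>d\<in>\<B>. smooth_on (snd c ` (fst c \<inter> F -` fst d)) (snd d \<circ> F \<circ> chart_inv c))"

definition smooth_fun :: "('a, 'e::euclidean_space) chart set \<Rightarrow> ('a \<Rightarrow> real) \<Rightarrow> bool" where
  "smooth_fun \<A> f \<longleftrightarrow> (\<forall>c\<in>\<A>. smooth_on (snd c ` fst c) (f \<circ> chart_inv c))"


section \<open>Tangent vectors, vector fields and one-forms\<close>

text \<open>Every point \<open>p\<close> gets one preferred chart \<open>chart_at \<A> p\<close> of the atlas, and the tangent space
  at \<open>p\<close> is the model space \<open>'e\<close>: the vector \<open>v\<close> stands for the tangent vector at \<open>p\<close> whose
  coordinates in the preferred chart at \<open>p\<close> are \<open>v\<close>. Coordinates in any other chart are obtained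
  with the derivative of the transition map (\<open>field_in_chart\<close>). A vector field is thus a function
  \<open>'a \<Rightarrow> 'e\<close>; as such it need not be continuous, even if the field is smooth, because the
  preferred chart jumps.\<close>

definition chart_at :: "('a, 'e) chart set \<Rightarrow> 'a \<Rightarrow> ('a, 'e) chart" where
  "chart_at \<A> p = (SOME c. c \<in> \<A> \<and> p \<in> fst c)"

definition coord_at :: "('a, 'e) chart set \<Rightarrow> 'a \<Rightarrow> 'e" where
  "coord_at \<A> p = snd (chart_at \<A> p) p"

definition tangent_map ::
  "('a, 'e::euclidean_space) chart set \<Rightarrow> ('b, 'f::euclidean_space) chart set \<Rightarrow>
   ('a \<Rightarrow> 'b) \<Rightarrow> 'a \<Rightarrow> 'e \<Rightarrow> 'f" where
  "tangent_map \<A> \<B> F p =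
     frechet_derivative (snd (chart_at \<B> (F p)) \<circ> F \<circ> chart_inv (chart_at \<A> p)) (at (coord_at \<A> p))"

definition field_in_chart ::
  "('a, 'e::euclidean_space) chart set \<Rightarrow> ('a, 'e) chart \<Rightarrow> ('a \<Rightarrow> 'e) \<Rightarrow> 'e \<Rightarrow> 'e" where
  "field_in_chart \<A> c X x =
     (let p = chart_inv c x in
      frechet_derivative (snd c \<circ> chart_inv (chart_at \<A> p)) (at (coord_at \<A> p)) (X p))"

definition smooth_field :: "('a, 'e::euclidean_space) chart set \<Rightarrow> ('a \<Rightarrow> 'e) \<Rightarrow> bool" where
  "smooth_field \<A> X \<longleftrightarrow> (\<forall>c\<in>\<A>. smooth_on (snd c ` fst c) (field_in_chart \<A> c X))"

definition deriv_along ::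
  "('a, 'e::euclidean_space) chart set \<Rightarrow> ('a \<Rightarrow> 'e) \<Rightarrow> ('a \<Rightarrow> real) \<Rightarrow> 'a \<Rightarrow> real" where
  "deriv_along \<A> X f p =
     frechet_derivative (f \<circ> chart_inv (chart_at \<A> p)) (at (coord_at \<A> p)) (X p)"

text \<open>In coordinates, $[X,Y] = DY(X) - DX(Y)$, that is, $[X,Y]f = X(Yf) - Y(Xf)$.\<close>

definition lie_bracket ::
  "('a, 'e::euclidean_space) chart set \<Rightarrow> ('a \<Rightarrow> 'e) \<Rightarrow> ('a \<Rightarrow> 'e) \<Rightarrow> 'a \<Rightarrow> 'e" where
  "lie_bracket \<A> X Y p =
     (let c = chart_at \<A> p; x = coord_at \<A> p;
          X' = field_in_chart \<A> c X; Y' = field_in_chart \<A> c Y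
      in frechet_derivative Y' (at x) (X' x) - frechet_derivative X' (at x) (Y' x))"

definition one_form :: "('a, 'e::euclidean_space) chart set \<Rightarrow> ('a \<Rightarrow> 'e \<Rightarrow> real) \<Rightarrow> bool" where
  "one_form \<A> \<theta> \<longleftrightarrow>
     (\<forall>p. linear (\<theta> p)) \<and> (\<forall>X. smooth_field \<A> X \<longrightarrow> smooth_fun \<A> (\<lambda>p. \<theta> p (X p)))"


section \<open>Linear algebra\<close>

definition inner_product :: "('e::euclidean_space \<Rightarrow> 'e \<Rightarrow> real) \<Rightarrow> bool" where
  "inner_product h \<longleftrightarrow>
     bilinear h \<and> (\<forall>u v. h u v = h v u) \<and> (\<forall>v. v \<noteq> 0 \<longrightarrow> 0 < h v v)"

text \<open>Trace of an endomorphism \<open>L\<close> of a subspace \<open>W\<close>; \<open>L\<close> may be arbitrary outside \<open>W\<close>.\<close>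

definition trace_on :: "'e::euclidean_space set \<Rightarrow> ('e \<Rightarrow> 'e) \<Rightarrow> real" where
  "trace_on W L =
     (let B = (SOME B. B \<subseteq> W \<and> independent B \<and> span B = W)
      in \<Sum>b\<in>B. representation B (L b) b)"

text \<open>Trace of a bilinear form \<open>\<beta>\<close> with respect to an inner product \<open>h\<close>.\<close>

definition metric_trace ::
  "('e::euclidean_space \<Rightarrow> 'e \<Rightarrow> real) \<Rightarrow> ('e \<Rightarrow> 'e \<Rightarrow> real) \<Rightarrow> real" where
  "metric_trace h \<beta> =
     (let E = (SOME E. span E = UNIV \<and> (\<forall>u\<in>E. \<forall>v\<in>E. h u v = (if u = v then 1 else 0)))
      in \<Sum>e\<in>E. \<beta> e e)"

definition sym_part :: "('e \<Rightarrow> 'e \<Rightarrow> real) \<Rightarrow> 'e \<Rightarrow> 'e \<Rightarrow> real" where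
  "sym_part \<beta> u v = (\<beta> u v + \<beta> v u) / 2"

definition trace_free_part ::
  "('e::euclidean_space \<Rightarrow> 'e \<Rightarrow> real) \<Rightarrow> ('e \<Rightarrow> 'e \<Rightarrow> real) \<Rightarrow> 'e \<Rightarrow> 'e \<Rightarrow> real" where
  "trace_free_part h \<beta> u v = \<beta> u v - metric_trace h \<beta> / real DIM('e) * h u v"


section \<open>Connections, Weyl structures and curvature\<close>

text \<open>Connections act on globally defined smooth vector fields; their values on other functions
  \<open>'a \<Rightarrow> 'e\<close> are irrelevant.\<close>

type_synonym ('a, 'e) connection = "('a \<Rightarrow> 'e) \<Rightarrow> ('a \<Rightarrow> 'e) \<Rightarrow> ('a \<Rightarrow> 'e)"

definition linear_connection ::
  "('a, 'e::euclidean_space) chart set \<Rightarrow> ('a, 'e) connection \<Rightarrow> bool" where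
  "linear_connection \<A> D \<longleftrightarrow>
     (\<forall>X Y. smooth_field \<A> X \<longrightarrow> smooth_field \<A> Y \<longrightarrow> smooth_field \<A> (D X Y)) \<and>
     (\<forall>X X' Y. smooth_field \<A> X \<longrightarrow> smooth_field \<A> X' \<longrightarrow> smooth_field \<A> Y \<longrightarrow>
        D (\<lambda>p. X p + X' p) Y = (\<lambda>p. D X Y p + D X' Y p)) \<and>
     (\<forall>f X Y. smooth_fun \<A> f \<longrightarrow> smooth_field \<A> X \<longrightarrow> smooth_field \<A> Y \<longrightarrow>
        D (\<lambda>p. f p *\<^sub>R X p) Y = (\<lambda>p. f p *\<^sub>R D X Y p)) \<and>
     (\<forall>X Y Y'. smooth_field \<A> X \<longrightarrow> smooth_field \<A> Y \<longrightarrow> smooth_field \<A> Y' \<longrightarrow>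
        D X (\<lambda>p. Y p + Y' p) = (\<lambda>p. D X Y p + D X Y' p)) \<and>
     (\<forall>f X Y. smooth_fun \<A> f \<longrightarrow> smooth_field \<A> X \<longrightarrow> smooth_field \<A> Y \<longrightarrow>
        D X (\<lambda>p. f p *\<^sub>R Y p) = (\<lambda>p. deriv_along \<A> X f p *\<^sub>R Y p + f p *\<^sub>R D X Y p))"

definition torsion_free ::
  "('a, 'e::euclidean_space) chart set \<Rightarrow> ('a, 'e) connection \<Rightarrow> bool" where
  "torsion_free \<A> D \<longleftrightarrow>
     (\<forall>X Y. smooth_field \<A> X \<longrightarrow> smooth_field \<A> Y \<longrightarrow>
        (\<forall>p. D X Y p - D Y X p = lie_bracket \<A> X Y p))"

text \<open>\<open>\<theta>\<close> is the Lee form of \<open>D\<close> with respect to \<open>g\<close>: $D g = -2\theta\otimes g$.\<close>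

definition lee_form ::
  "('a, 'e::euclidean_space) chart set \<Rightarrow> ('a, 'e) connection \<Rightarrow> ('a \<Rightarrow> 'e \<Rightarrow> 'e \<Rightarrow> real) \<Rightarrow>
   ('a \<Rightarrow> 'e \<Rightarrow> real) \<Rightarrow> bool" where
  "lee_form \<A> D g \<theta> \<longleftrightarrow> one_form \<A> \<theta> \<and>
     (\<forall>X Y Z. smooth_field \<A> X \<longrightarrow> smooth_field \<A> Y \<longrightarrow> smooth_field \<A> Z \<longrightarrow>
        (\<forall>p. deriv_along \<A> X (\<lambda>q. g q (Y q) (Z q)) p - g p (D X Y p) (Z p) - g p (Y p) (D X Z p)
             = - 2 * \<theta> p (X p) * g p (Y p) (Z p)))"

definition conformal_class ::
  "('a, 'e::euclidean_space) chart set \<Rightarrow> ('a \<Rightarrow> 'e \<Rightarrow> 'e \<Rightarrow> real) \<Rightarrow>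
   ('a \<Rightarrow> 'e \<Rightarrow> 'e \<Rightarrow> real) set" where
  "conformal_class \<A> g = {\<lambda>p u v. f p * g p u v | f. smooth_fun \<A> f \<and> (\<forall>p. 0 < f p)}"

definition weyl_structure ::
  "('a, 'e::euclidean_space) chart set \<Rightarrow> ('a \<Rightarrow> 'e \<Rightarrow> 'e \<Rightarrow> real) set \<Rightarrow>
   ('a, 'e) connection \<Rightarrow> bool" where
  "weyl_structure \<A> c D \<longleftrightarrow>
     linear_connection \<A> D \<and> torsion_free \<A> D \<and> (\<forall>g\<in>c. \<exists>\<theta>. lee_form \<A> D g \<theta>)"

definition curvature ::
  "('a, 'e::euclidean_space) chart set \<Rightarrow> ('a, 'e) connection \<Rightarrow>
   ('a \<Rightarrow> 'e) \<Rightarrow> ('a \<Rightarrow> 'e) \<Rightarrow> ('a \<Rightarrow> 'e) \<Rightarrow> ('a \<Rightarrow> 'e)" where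
  "curvature \<A> D X Y Z = (\<lambda>p. D (lie_bracket \<A> X Y) Z p - D X (D Y Z) p + D Y (D X Z) p)"

text \<open>Curvature is tensorial, so its value at \<open>p\<close> can be computed with arbitrary smooth fields
  having the prescribed values at \<open>p\<close>.\<close>

definition extend_vector :: "('a, 'e::euclidean_space) chart set \<Rightarrow> 'a \<Rightarrow> 'e \<Rightarrow> ('a \<Rightarrow> 'e)" where
  "extend_vector \<A> p v = (SOME X. smooth_field \<A> X \<and> X p = v)"

definition ricci ::
  "('a, 'e::euclidean_space) chart set \<Rightarrow> ('a, 'e) connection \<Rightarrow> 'a \<Rightarrow> 'e \<Rightarrow> 'e \<Rightarrow> real" where
  "ricci \<A> D p u v =
     trace_on UNIV (\<lambda>z. curvature \<A> D (extend_vector \<A> p u) (extend_vector \<A> p z)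
                          (extend_vector \<A> p v) p)"

definition weyl_einstein ::
  "('a, 'e::euclidean_space) chart set \<Rightarrow> ('a \<Rightarrow> 'e \<Rightarrow> 'e \<Rightarrow> real) set \<Rightarrow>
   ('a, 'e) connection \<Rightarrow> bool" where
  "weyl_einstein \<A> c D \<longleftrightarrow> weyl_structure \<A> c D \<and>
     (\<exists>g\<in>c. \<forall>p u v. trace_free_part (g p) (sym_part (ricci \<A> D p)) u v = 0)"


section \<open>Lie groups and left-invariant objects\<close>

locale lie_group = group G
  for G :: "('a::{t2_space, second_countable_topology}, 'm) monoid_scheme" (structure) +
  fixes \<A> :: "('a, 'e::euclidean_space) chart set"
  assumes carrier_UNIV: "carrier G = UNIV"
    and atlas: "smooth_atlas \<A>"
    and smooth_mult: "smooth_map (prod_atlas \<A> \<A>) \<A> (\<lambda>(x, y). x \<otimes> y)"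
    and smooth_inv: "smooth_map \<A> \<A> (\<lambda>x. inv x)"

definition left_transl ::
  "('a, 'm) monoid_scheme \<Rightarrow> ('a, 'e::euclidean_space) chart set \<Rightarrow> 'a \<Rightarrow> 'a \<Rightarrow> 'e \<Rightarrow> 'e" where
  "left_transl G \<A> a p = tangent_map \<A> \<A> (\<lambda>x. a \<otimes>\<^bsub>G\<^esub> x) p"

text \<open>The Lie algebra is the tangent space \<open>'e\<close> at the identity; the bracket is that of the
  left-invariant extensions.\<close>

definition left_inv_field ::
  "('a, 'm) monoid_scheme \<Rightarrow> ('a, 'e::euclidean_space) chart set \<Rightarrow> 'e \<Rightarrow> ('a \<Rightarrow> 'e)" where
  "left_inv_field G \<A> v = (\<lambda>p. left_transl G \<A> p \<one>\<^bsub>G\<^esub> v)"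

definition lie_alg_bracket ::
  "('a, 'm) monoid_scheme \<Rightarrow> ('a, 'e::euclidean_space) chart set \<Rightarrow> 'e \<Rightarrow> 'e \<Rightarrow> 'e" where
  "lie_alg_bracket G \<A> u v =
     lie_bracket \<A> (left_inv_field G \<A> u) (left_inv_field G \<A> v) \<one>\<^bsub>G\<^esub>"

definition codim_one_abelian_ideal ::
  "('a, 'm) monoid_scheme \<Rightarrow> ('a, 'e::euclidean_space) chart set \<Rightarrow> 'e set \<Rightarrow> bool" where
  "codim_one_abelian_ideal G \<A> H \<longleftrightarrow>
     subspace H \<and> dim H + 1 = DIM('e) \<and>
     (\<forall>u. \<forall>x\<in>H. lie_alg_bracket G \<A> u x \<in> H) \<and>
     (\<forall>x\<in>H. \<forall>y\<in>H. lie_alg_bracket G \<A> x y = 0)"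

definition almost_abelian ::
  "('a, 'm) monoid_scheme \<Rightarrow> ('a, 'e::euclidean_space) chart set \<Rightarrow> bool" where
  "almost_abelian G \<A> \<longleftrightarrow> (\<exists>H. codim_one_abelian_ideal G \<A> H)"

definition left_inv_form ::
  "('a, 'm) monoid_scheme \<Rightarrow> ('a, 'e::euclidean_space) chart set \<Rightarrow> ('a \<Rightarrow> 'e \<Rightarrow> real) \<Rightarrow> bool" where
  "left_inv_form G \<A> \<theta> \<longleftrightarrow> (\<forall>a p v. \<theta> (a \<otimes>\<^bsub>G\<^esub> p) (left_transl G \<A> a p v) = \<theta> p v)"

definition left_inv_metric ::
  "('a, 'm) monoid_scheme \<Rightarrow> ('a, 'e::euclidean_space) chart set \<Rightarrow>
   ('a \<Rightarrow> 'e \<Rightarrow> 'e \<Rightarrow> real) \<Rightarrow> bool" where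
  "left_inv_metric G \<A> g \<longleftrightarrow>
     (\<forall>a p u v. g (a \<otimes>\<^bsub>G\<^esub> p) (left_transl G \<A> a p u) (left_transl G \<A> a p v) = g p u v)"

text \<open>The left-invariant metric that extends an inner product on the Lie algebra.\<close>

definition metric_of ::
  "('a, 'm) monoid_scheme \<Rightarrow> ('a, 'e::euclidean_space) chart set \<Rightarrow> ('e \<Rightarrow> 'e \<Rightarrow> real) \<Rightarrow>
   ('a \<Rightarrow> 'e \<Rightarrow> 'e \<Rightarrow> real)" where
  "metric_of G \<A> h = (\<lambda>p u v. h (left_transl G \<A> (inv\<^bsub>G\<^esub> p) p u) (left_transl G \<A> (inv\<^bsub>G\<^esub> p) p v))"

definition left_inv_weyl_structure ::
  "('a, 'm) monoid_scheme \<Rightarrow> ('a, 'e::euclidean_space) chart set \<Rightarrow>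
   ('a \<Rightarrow> 'e \<Rightarrow> 'e \<Rightarrow> real) set \<Rightarrow> ('a, 'e) connection \<Rightarrow> bool" where
  "left_inv_weyl_structure G \<A> c D \<longleftrightarrow> weyl_structure \<A> c D \<and>
     (\<forall>g\<in>c. left_inv_metric G \<A> g \<longrightarrow> (\<forall>\<theta>. lee_form \<A> D g \<theta> \<longrightarrow> left_inv_form G \<A> \<theta>))"

end

theory Submission
  imports Defs
begin

text \<open>The theorem is a classification of the solutions of an algebraic equation on the Lie algebra,
preceded by the reduction of the differential geometric condition to that equation.

For the reduction, left-invariant fields form a global smooth frame \<open>\<E> e\<close> of the group, and every smooth
field is a combination of frame fields with smooth coefficients
(\<open>smooth_to_lie_algebra_component\<close>). Curvature is linear over functions in each argument, hence
it can be evaluated on left-invariant fields (\<open>curvature_left_inv\<close>). Brackets of such fields are left-invariant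
(\<open>lie_bracket_left_inv_field\<close>), the metric and the Lee form are constant on them, and a Weyl connection is
determined by its torsion and its Lee form, so \<open>D (\<E> u) (\<E> v)\<close> is the left-invariant field of an
explicit product \<open>W u v\<close> (\<open>connection_left_inv\<close>). The Weyl-Einstein condition becomes the condition
that the symmetrised Ricci form of \<open>W\<close> is a multiple of the inner product
(\<open>weyl_einstein_iff\<close>).

For the algebra, let \<open>s\<close> and \<open>T\<close> be the traces of \<open>S\<close> and its square, \<open>m = n - 2\<close>, and let the Lee vector be
\<open>t = \<tau> b + \<xi>\<close> with \<open>\<xi>\<close> in the ideal. The conformal change formula (\<open>ricci_form_weyl_op\<close>) and the Ricci form
of the Levi-Civita product (\<open>ricci_form_almost_abelian\<close>) turn the condition into
\<open>A \<xi> + S \<xi> = 2 \<tau> \<xi>\<close> together with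
\<open>[A, S] + (m \<tau> - s) S + m \<xi> \<otimes> \<xi> = (m \<tau>\<^sup>2 - T) Id\<close> on the ideal. The trace of this equation
and of its product with \<open>S\<close> are incompatible with the Cauchy-Schwarz inequality for the eigenvalues of \<open>S\<close>
(in a form that knows the diagonal entry \<open>2 \<tau>\<close> at \<open>\<xi>\<close>) unless \<open>\<xi> = 0\<close>. The trace of its product
with \<open>[A, S]\<close> then shows that \<open>A\<close> and \<open>S\<close> commute, and \<open>(m \<tau> - s) S = (m \<tau>\<^sup>2 - T) Id\<close> has
exactly the two families of solutions of the theorem; for \<open>S \<noteq> 0\<close> they are distinguished by whether
\<open>m \<tau> - s\<close> vanishes (\<open>weyl_ricci_conformal_only_if\<close>).\<close>

section \<open>Calculus of smooth maps\<close>

text \<open>The derivative that occurs in \<open>Ck_on\<close> is taken in the whole space, so it only depends on the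
germ of the map; this is why openness of \<open>U\<close> is needed for congruence.\<close>

lemma Ck_on_cong:
  assumes "open U" "\<And>x. x \<in> U \<Longrightarrow> f x = g x" "Ck_on k U f"
  shows "Ck_on k U g"
  using assms(2,3)
proof (induction k arbitrary: f g)
  case 0
  then show ?case by (simp cong: continuous_on_cong)
next
  case (Suc k)
  have fd: "g differentiable (at x)" "frechet_derivative f (at x) = frechet_derivative g (at x)"
    if "x \<in> U" for x
  proof -
    have "f differentiable (at x)" using Suc.prems(2) that by simp
    then show "frechet_derivative f (at x) = frechet_derivative g (at x)"
      by (rule frechet_derivative_transform_within_open[OF _ \<open>open U\<close> that Suc.prems(1)])
    show "g differentiable (at x)"
      using \<open>f differentiable (at x)\<close> has_derivative_transform_within_open[OF _ \<open>open U\<close> that, of f _ _ g] Suc.prems(1)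
      unfolding differentiable_def by metis
  qed
  show ?case
    using Suc.prems(2) fd Suc.IH[of "\<lambda>x. frechet_derivative f (at x) v" "\<lambda>x. frechet_derivative g (at x) v" for v]
    by auto
qed

lemma Ck_on_subset: "Ck_on k U f \<Longrightarrow> V \<subseteq> U \<Longrightarrow> Ck_on k V f"
proof (induction k arbitrary: f)
  case 0
  then show ?case using continuous_on_subset by auto
next
  case (Suc k)
  then show ?case by (simp add: subset_iff)
qed

lemma Ck_on_local:
  assumes "\<And>x. x \<in> U \<Longrightarrow> \<exists>V. open V \<and> x \<in> V \<and> Ck_on k V f"
  shows "Ck_on k U f"
  using assms
proof (induction k arbitrary: f)
  case 0
  have "isCont f x" if "x \<in> U" for x
    using 0[OF that] continuous_on_eq_continuous_at by auto
  then show ?case by (simp add: continuous_at_imp_continuous_on)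
next
  case (Suc k)
  have "Ck_on k U (\<lambda>x. frechet_derivative f (at x) v)" for v
    using Suc.prems by (intro Suc.IH) fastforce
  moreover have "f differentiable (at x)" if "x \<in> U" for x
    using Suc.prems[OF that] by auto
  ultimately show ?case by simp
qed

lemma Ck_on_Suc_imp_Ck_on: "Ck_on (Suc k) U f \<Longrightarrow> Ck_on k U f"
proof (induction k arbitrary: f)
  case 0
  then show ?case
    by (auto intro!: continuous_at_imp_continuous_on differentiable_imp_continuous_within)
next
  case (Suc k)
  then show ?case by simp
qed

lemma Ck_on_SucI:
  assumes "open U" "\<And>x. x \<in> U \<Longrightarrow> (f has_derivative f' x) (at x)"
    and "\<And>v. Ck_on k U (\<lambda>x. f' x v)"
  shows "Ck_on (Suc k) U f"
proof -
  have "frechet_derivative f (at x) = f' x" if "x \<in> U" for x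
    using frechet_derivative_at[OF assms(2)[OF that]] by simp
  then have "Ck_on k U (\<lambda>x. frechet_derivative f (at x) v)" for v
    using Ck_on_cong[OF assms(1) _ assms(3)] by simp
  moreover have "f differentiable (at x)" if "x \<in> U" for x
    using assms(2)[OF that] differentiableI by blast
  ultimately show ?thesis by simp
qed

lemma Ck_on_SucD:
  assumes "Ck_on (Suc k) U f" "x \<in> U"
  shows "(f has_derivative frechet_derivative f (at x)) (at x)"
  using assms by (simp add: frechet_derivative_works[symmetric])

lemma Ck_on_const: "open U \<Longrightarrow> Ck_on k U (\<lambda>x. c)"
proof (induction k arbitrary: c)
  case (Suc k)
  then show ?case by (intro Ck_on_SucI[where f' = "\<lambda>_ _. 0"]) auto
qed auto

lemma Ck_on_bounded_linear:
  assumes "bounded_linear f" "open U"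
  shows "Ck_on k U f"
proof (cases k)
  case 0
  then show ?thesis using assms linear_continuous_on by auto
next
  case (Suc j)
  then show ?thesis
    using assms by (auto intro!: Ck_on_SucI[where f' = "\<lambda>_. f"] Ck_on_const bounded_linear_imp_has_derivative
        simp del: Ck_on.simps)
qed

lemma Ck_on_add:
  assumes "open U" "Ck_on k U f" "Ck_on k U g"
  shows "Ck_on k U (\<lambda>x. f x + g x)"
  using assms(2,3)
proof (induction k arbitrary: f g)
  case 0
  then show ?case by (simp add: continuous_on_add)
next
  case (Suc k)
  show ?case
  proof (rule Ck_on_SucI[OF assms(1)])
    show "((\<lambda>x. f x + g x) has_derivative
        (\<lambda>v. frechet_derivative f (at x) v + frechet_derivative g (at x) v)) (at x)" if "x \<in> U" for x
      using Suc.prems that by (intro has_derivative_add Ck_on_SucD)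
    show "Ck_on k U (\<lambda>x. frechet_derivative f (at x) v + frechet_derivative g (at x) v)" for v
      using Suc.prems by (intro Suc.IH) auto
  qed
qed

lemma Ck_on_sum:
  assumes "open U" "\<And>i. i \<in> I \<Longrightarrow> Ck_on k U (f i)"
  shows "Ck_on k U (\<lambda>x. \<Sum>i\<in>I. f i x)"
  using assms(2) by (induction I rule: infinite_finite_induct)
    (auto intro: Ck_on_const Ck_on_add assms(1))

text \<open>By the Leibniz rule the derivative of a product is a sum of products of a factor and a derivative,
to which the induction hypothesis applies. Scalar multiples and inner products are the instances
in use.\<close>

lemma Ck_on_bilinear:
  assumes "bounded_bilinear pr" "open U" "Ck_on k U f" "Ck_on k U g"
  shows "Ck_on k U (\<lambda>x. pr (f x) (g x))"
  using assms(3,4)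
proof (induction k arbitrary: f g)
  case 0
  then show ?case using bounded_bilinear.continuous_on[OF assms(1)] by auto
next
  case (Suc k)
  show ?case
  proof (rule Ck_on_SucI[OF assms(2)])
    show "((\<lambda>x. pr (f x) (g x)) has_derivative
        (\<lambda>v. pr (f x) (frechet_derivative g (at x) v) + pr (frechet_derivative f (at x) v) (g x))) (at x)"
      if "x \<in> U" for x
      using Suc.prems that by (intro bounded_bilinear.FDERIV[OF assms(1)] Ck_on_SucD)
    show "Ck_on k U (\<lambda>x. pr (f x) (frechet_derivative g (at x) v) +
        pr (frechet_derivative f (at x) v) (g x))" for v
      using Suc.prems by (intro Ck_on_add assms(2) Suc.IH) (auto intro: Ck_on_Suc_imp_Ck_on)
  qed
qed

lemma linear_eq_sum_Basis:
  fixes f :: "'e::euclidean_space \<Rightarrow> 'f::real_vector"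
  assumes "linear f"
  shows "f v = (\<Sum>i\<in>Basis. (v \<bullet> i) *\<^sub>R f i)"
proof -
  have "f v = f (\<Sum>i\<in>Basis. (v \<bullet> i) *\<^sub>R i)" by (simp add: euclidean_representation)
  also have "\<dots> = (\<Sum>i\<in>Basis. (v \<bullet> i) *\<^sub>R f i)" by (simp add: linear_sum[OF assms] linear_cmul[OF assms])
  finally show ?thesis .
qed

text \<open>The chain rule writes the derivative of the composition as \<open>Dg\<close> at \<open>f x\<close>, applied to a vector
that itself depends on \<open>x\<close>. Expanding that vector in the standard basis turns the expression into
a sum of products of \<open>C\<^sup>k\<close> functions, each of which is covered by the induction hypothesis or by
the bilinear rule.\<close>

lemma Ck_on_compose:
  assumes "open U" "Ck_on k V g" "Ck_on k U f" "f ` U \<subseteq> V"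
  shows "Ck_on k U (\<lambda>x. g (f x))"
  using assms(2-4)
proof (induction k arbitrary: f g)
  case 0
  then show ?case by (auto intro: continuous_on_compose2)
next
  case (Suc k)
  note fD = Ck_on_SucD[OF Suc.prems(2)]
  note gD = Ck_on_SucD[OF Suc.prems(1)]
  have *: "frechet_derivative g (at (f x)) w
      = (\<Sum>i\<in>Basis. (w \<bullet> i) *\<^sub>R frechet_derivative g (at (f x)) i)" if "x \<in> U" for x w
    using gD[of "f x"] that Suc.prems(3) has_derivative_linear linear_eq_sum_Basis by blast
  have Ckf: "Ck_on k U f" using Suc.prems(2) by (rule Ck_on_Suc_imp_Ck_on)
  show ?case
  proof (rule Ck_on_SucI[OF assms(1)])
    show "((\<lambda>x. g (f x)) has_derivative
        (\<lambda>v. frechet_derivative g (at (f x)) (frechet_derivative f (at x) v))) (at x)"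
      if "x \<in> U" for x
      using diff_chain_at[OF fD gD] that Suc.prems(3) by (auto simp: o_def)
    fix v
    have "Ck_on k U (\<lambda>x. frechet_derivative g (at (f x)) i)" for i
      using Suc.prems Ckf
        by (intro Suc.IH[where g="\<lambda>y. frechet_derivative g (at y) i" and f=f]) auto
    then have "Ck_on k U (\<lambda>x. \<Sum>i\<in>Basis. (frechet_derivative f (at x) v \<bullet> i)
                 *\<^sub>R frechet_derivative g (at (f x)) i)"
      using Suc.prems assms(1)
      by (intro Ck_on_sum Ck_on_bilinear[OF bounded_bilinear_scaleR]
           Ck_on_bilinear[OF bounded_bilinear_inner] Ck_on_const) auto
    then show "Ck_on k U (\<lambda>x. frechet_derivative g (at (f x)) (frechet_derivative f (at x) v))"
      by (rule Ck_on_cong[OF assms(1), rotated]) (simp add: *[symmetric])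
  qed
qed

lemma smooth_on_cong:
  "open U \<Longrightarrow> (\<And>x. x \<in> U \<Longrightarrow> f x = g x) \<Longrightarrow> smooth_on U f \<Longrightarrow> smooth_on U g"
  unfolding smooth_on_def using Ck_on_cong[of U f g] by blast

lemma smooth_on_subset: "smooth_on U f \<Longrightarrow> V \<subseteq> U \<Longrightarrow> smooth_on V f"
  unfolding smooth_on_def using Ck_on_subset by blast

lemma smooth_on_local:
  "(\<And>x. x \<in> U \<Longrightarrow> \<exists>V. open V \<and> x \<in> V \<and> smooth_on V f) \<Longrightarrow> smooth_on U f"
  unfolding smooth_on_def by (intro allI Ck_on_local) blast

lemma smooth_on_const: "open U \<Longrightarrow> smooth_on U (\<lambda>x. c)"
  unfolding smooth_on_def using Ck_on_const by blast

lemma smooth_on_bounded_linear: "bounded_linear f \<Longrightarrow> open U \<Longrightarrow> smooth_on U f"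
  unfolding smooth_on_def using Ck_on_bounded_linear by blast

lemma smooth_on_ident: "open U \<Longrightarrow> smooth_on U (\<lambda>x. x)"
  by (simp add: smooth_on_bounded_linear bounded_linear_ident)

lemma smooth_on_add: "open U \<Longrightarrow> smooth_on U f \<Longrightarrow> smooth_on U g \<Longrightarrow> smooth_on U (\<lambda>x. f x + g x)"
  unfolding smooth_on_def using Ck_on_add[of U _ f g] by simp

lemma smooth_on_sum:
  "open U \<Longrightarrow> (\<And>i. i \<in> I \<Longrightarrow> smooth_on U (f i)) \<Longrightarrow> smooth_on U (\<lambda>x. \<Sum>i\<in>I. f i x)"
  unfolding smooth_on_def by (simp add: Ck_on_sum)

lemma smooth_on_scaleR:
  "open U \<Longrightarrow> smooth_on U f \<Longrightarrow> smooth_on U g \<Longrightarrow> smooth_on U (\<lambda>x. f x *\<^sub>R g x)"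
  unfolding smooth_on_def using Ck_on_bilinear[OF bounded_bilinear_scaleR, of U _ f g] by simp

lemma smooth_on_inner:
  "open U \<Longrightarrow> smooth_on U f \<Longrightarrow> smooth_on U g \<Longrightarrow> smooth_on U (\<lambda>x. f x \<bullet> g x)"
  unfolding smooth_on_def using Ck_on_bilinear[OF bounded_bilinear_inner, of U _ f g] by simp

lemma smooth_on_compose:
  "open U \<Longrightarrow> smooth_on V g \<Longrightarrow> smooth_on U f \<Longrightarrow> f ` U \<subseteq> V \<Longrightarrow> smooth_on U (\<lambda>x. g (f x))"
  unfolding smooth_on_def using Ck_on_compose[of U _ V g f] by simp

lemma smooth_on_linear_image:
  assumes "bounded_linear L" "open U" "smooth_on U f"
  shows "smooth_on U (\<lambda>x. L (f x))"
  using smooth_on_compose[OF assms(2) smooth_on_bounded_linear[OF assms(1) open_UNIV] assms(3)] by simp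

lemma smooth_on_Pair:
  assumes "open U" "smooth_on U f" "smooth_on U g"
  shows "smooth_on U (\<lambda>x. (f x, g x))"
proof -
  have "bounded_linear (\<lambda>y. (y, 0))" "bounded_linear (\<lambda>y. (0, y))"
    by (intro bounded_linear_Pair bounded_linear_ident bounded_linear_zero)+
  then have "smooth_on U (\<lambda>x. (f x, 0) + (0, g x))"
    using assms by (intro smooth_on_add smooth_on_linear_image[where L="\<lambda>y. (y, 0)"]
        smooth_on_linear_image[where L="\<lambda>y. (0, y)"])
  then show ?thesis by simp
qed

lemma smooth_on_has_derivative:
  assumes "smooth_on U f" "x \<in> U"
  shows "(f has_derivative frechet_derivative f (at x)) (at x)"
  using assms Ck_on_SucD[of 0 U f x] unfolding smooth_on_def by blast

lemma smooth_on_differentiable: "smooth_on U f \<Longrightarrow> x \<in> U \<Longrightarrow> f differentiable (at x)"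
  using smooth_on_has_derivative differentiableI by blast

lemma smooth_on_linear_derivative:
  "smooth_on U f \<Longrightarrow> x \<in> U \<Longrightarrow> linear (frechet_derivative f (at x))"
  using smooth_on_has_derivative has_derivative_linear by blast

lemma smooth_on_continuous: "smooth_on U f \<Longrightarrow> continuous_on U f"
  unfolding smooth_on_def by (drule spec[of _ 0]) simp

lemma smooth_on_directional_derivative:
  assumes "smooth_on U f"
  shows "smooth_on U (\<lambda>x. frechet_derivative f (at x) v)"
  unfolding smooth_on_def
proof
  fix k
  have "Ck_on (Suc k) U f" using assms unfolding smooth_on_def by blast
  then show "Ck_on k U (\<lambda>x. frechet_derivative f (at x) v)" by simp
qed

text \<open>A derivative whose base point and direction both vary smoothly; every smoothness statement about
vector fields on a manifold is reduced to this one.\<close>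

lemma smooth_on_derivative_along:
  assumes "open U" "smooth_on V f" "smooth_on U y" "y ` U \<subseteq> V" "smooth_on U X"
  shows "smooth_on U (\<lambda>x. frechet_derivative f (at (y x)) (X x))"
proof -
  have "smooth_on U (\<lambda>x. frechet_derivative f (at (y x)) i)" for i
    by (rule smooth_on_compose[where g="\<lambda>z. frechet_derivative f (at z) i",
          OF assms(1) smooth_on_directional_derivative[OF assms(2)] assms(3,4)])
  then have "smooth_on U (\<lambda>x. \<Sum>i\<in>Basis. (X x \<bullet> i) *\<^sub>R frechet_derivative f (at (y x)) i)"
    using assms by (intro smooth_on_sum smooth_on_scaleR smooth_on_inner smooth_on_const)
  then show ?thesis
    by (rule smooth_on_cong[OF assms(1), rotated])
       (use smooth_on_linear_derivative[OF assms(2)] assms(4) linear_eq_sum_Basis in \<open>metis image_subset_iff\<close>)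
qed

section \<open>Symmetry of second derivatives\<close>

lemma DERIV_along_line:
  fixes \<phi> :: "'e::euclidean_space \<Rightarrow> real"
  assumes "(\<phi> has_derivative \<phi>') (at (p + s *\<^sub>R v))"
  shows "DERIV (\<lambda>s. \<phi> (p + s *\<^sub>R v)) s :> \<phi>' v"
proof -
  have "((\<lambda>s. p + s *\<^sub>R v) has_derivative (\<lambda>h. h *\<^sub>R v)) (at s)"
    by (auto intro!: derivative_eq_intros)
  from diff_chain_at[OF this assms]
  have "((\<lambda>s. \<phi> (p + s *\<^sub>R v)) has_derivative (\<lambda>h. \<phi>' (h *\<^sub>R v))) (at s)" by (simp add: o_def)
  moreover have "(\<lambda>h. \<phi>' (h *\<^sub>R v)) = (*) (\<phi>' v)"
    using linear_cmul[OF has_derivative_linear[OF assms]] by (auto simp: mult.commute)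
  ultimately show ?thesis unfolding has_field_derivative_def by simp
qed

text \<open>The second difference of \<open>\<phi>\<close> over the parallelogram spanned by \<open>s v\<close> and \<open>s w\<close> is symmetric in \<open>v\<close>
and \<open>w\<close>. Two applications of the mean value theorem express it by the mixed derivative at an
interior point.\<close>

lemma second_difference_mean_value:
  fixes \<phi> :: "'e::euclidean_space \<Rightarrow> real"
  assumes \<phi>: "smooth_on U \<phi>" and "0 < s"
    and U: "\<And>a b. 0 \<le> a \<Longrightarrow> a \<le> s \<Longrightarrow> 0 \<le> b \<Longrightarrow> b \<le> s \<Longrightarrow> x + a *\<^sub>R v + b *\<^sub>R w \<in> U"
  obtains a b where "0 < a" "a < s" "0 < b" "b < s"
    "\<phi> (x + s *\<^sub>R v + s *\<^sub>R w) - \<phi> (x + s *\<^sub>R v) - \<phi> (x + s *\<^sub>R w) + \<phi> x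
      = s\<^sup>2 * frechet_derivative (\<lambda>y. frechet_derivative \<phi> (at y) v) (at (x + a *\<^sub>R v + b *\<^sub>R w)) w"
proof -
  let ?D = "\<lambda>y. frechet_derivative \<phi> (at y) v"
  have D1: "DERIV (\<lambda>\<tau>. \<phi> ((x + s *\<^sub>R w) + \<tau> *\<^sub>R v) - \<phi> (x + \<tau> *\<^sub>R v)) \<tau>
      :> ?D ((x + s *\<^sub>R w) + \<tau> *\<^sub>R v) - ?D (x + \<tau> *\<^sub>R v)"
    if "0 \<le> \<tau>" "\<tau> \<le> s" for \<tau>
    using U[of \<tau> s] U[of \<tau> 0] that \<open>0 < s\<close>
    by (intro DERIV_diff DERIV_along_line smooth_on_has_derivative[OF \<phi>]) (auto simp: algebra_simps)
  obtain a where a: "0 < a" "a < s" and 1: "(\<phi> ((x + s *\<^sub>R w) + s *\<^sub>R v) - \<phi> (x + s *\<^sub>R v))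
      - (\<phi> ((x + s *\<^sub>R w) + 0 *\<^sub>R v) - \<phi> (x + 0 *\<^sub>R v))
      = (s - 0) * (?D ((x + s *\<^sub>R w) + a *\<^sub>R v) - ?D (x + a *\<^sub>R v))"
    using MVT2[OF \<open>0 < s\<close> D1] by blast
  have D2: "DERIV (\<lambda>\<tau>. ?D ((x + a *\<^sub>R v) + \<tau> *\<^sub>R w)) \<tau>
      :> frechet_derivative ?D (at ((x + a *\<^sub>R v) + \<tau> *\<^sub>R w)) w"
    if "0 \<le> \<tau>" "\<tau> \<le> s" for \<tau>
    using U[of a \<tau>] that a
    by (intro DERIV_along_line smooth_on_has_derivative[OF smooth_on_directional_derivative[OF \<phi>]]) auto
  obtain b where b: "0 < b" "b < s" and 2: "?D ((x + a *\<^sub>R v) + s *\<^sub>R w) - ?D ((x + a *\<^sub>R v) + 0 *\<^sub>R w)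
      = (s - 0) * frechet_derivative ?D (at ((x + a *\<^sub>R v) + b *\<^sub>R w)) w"
    using MVT2[OF \<open>0 < s\<close> D2] by blast
  have "?D ((x + s *\<^sub>R w) + a *\<^sub>R v) - ?D (x + a *\<^sub>R v) =
      s * frechet_derivative ?D (at ((x + a *\<^sub>R v) + b *\<^sub>R w)) w"
    using 2 by (simp add: algebra_simps)
  then show ?thesis
    using that[of a b] a b 1 by (simp add: algebra_simps power2_eq_square)
qed

text \<open>If the two mixed derivatives differed at \<open>x\<close>, a constant \<open>m\<close> would separate them on a whole ball;
but both attain the same second difference of a small parallelogram in that ball. By exchanging
\<open>v\<close> and \<open>w\<close> it is enough to prove one inequality.\<close>

lemma symmetric_second_derivative_real:
  fixes \<phi> :: "'e::euclidean_space \<Rightarrow> real"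
  assumes "open U" "x \<in> U" and \<phi>: "smooth_on U \<phi>"
  shows "frechet_derivative (\<lambda>y. frechet_derivative \<phi> (at y) w) (at x) v
    \<le> frechet_derivative (\<lambda>y. frechet_derivative \<phi> (at y) v) (at x) w"
proof (rule ccontr)
  let ?P = "\<lambda>y. frechet_derivative (\<lambda>y. frechet_derivative \<phi> (at y) v) (at y) w"
  let ?Q = "\<lambda>y. frechet_derivative (\<lambda>y. frechet_derivative \<phi> (at y) w) (at y) v"
  assume "\<not> ?Q x \<le> ?P x"
  then obtain m where m: "?P x < m" "m < ?Q x" using dense not_le by meson
  have cont: "continuous_on U ?P" "continuous_on U ?Q"
    by (intro smooth_on_continuous smooth_on_directional_derivative \<phi>)+
  have "{y \<in> U. ?P y < m} = U \<inter> ?P -` {..<m}" "{y \<in> U. m < ?Q y} = U \<inter> ?Q -` {m<..}" by auto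
  then have "open {y \<in> U. ?P y < m}" "open {y \<in> U. m < ?Q y}"
    using continuous_on_open_vimage[OF \<open>open U\<close>] cont by (metis Int_commute open_greaterThan open_lessThan)+
  then have "open ({y \<in> U. ?P y < m} \<inter> {y \<in> U. m < ?Q y})" by blast
  then obtain r where "0 < r" and r: "ball x r \<subseteq> {y \<in> U. ?P y < m} \<inter> {y \<in> U. m < ?Q y}"
    using m \<open>x \<in> U\<close> unfolding open_contains_ball by blast
  \<comment> \<open>The side length is chosen so that the closed parallelogram stays inside the ball.\<close>
  define s where "s = r / (norm v + norm w + 1)"
  have N: "0 < norm v + norm w + 1" by (smt (verit) norm_ge_zero)
  then have "0 < s" unfolding s_def using \<open>0 < r\<close> by simp
  have B: "x + a *\<^sub>R v + b *\<^sub>R w \<in> ball x r" if "0 \<le> a" "a \<le> s" "0 \<le> b" "b \<le> s" for a b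
  proof -
    have "norm (a *\<^sub>R v + b *\<^sub>R w) \<le> a * norm v + b * norm w"
      using norm_triangle_ineq[of "a *\<^sub>R v" "b *\<^sub>R w"] that by simp
    also have "\<dots> \<le> s * norm v + s * norm w"
      using that by (intro add_mono mult_right_mono) auto
    also have "\<dots> < s * (norm v + norm w + 1)" using \<open>0 < s\<close> by (simp add: algebra_simps)
    also have "\<dots> = r" unfolding s_def using N by simp
    finally show ?thesis by (simp add: dist_norm norm_minus_commute add.assoc add.commute[of "b *\<^sub>R w"])
  qed
  have BU: "x + a *\<^sub>R v + b *\<^sub>R w \<in> U" if "0 \<le> a" "a \<le> s" "0 \<le> b" "b \<le> s" for a b
    using B[OF that] r by blast
  have BU': "x + a *\<^sub>R w + b *\<^sub>R v \<in> U" if "0 \<le> a" "a \<le> s" "0 \<le> b" "b \<le> s" for a b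
    using BU[OF that(3,4,1,2)] by (simp add: algebra_simps)
  let ?\<Delta> = "\<phi> (x + s *\<^sub>R v + s *\<^sub>R w) - \<phi> (x + s *\<^sub>R v) - \<phi> (x + s *\<^sub>R w) + \<phi> x"
  obtain a b where ab: "0 < a" "a < s" "0 < b" "b < s" and 1: "?\<Delta> = s\<^sup>2 * ?P (x + a *\<^sub>R v + b *\<^sub>R w)"
    using second_difference_mean_value[OF \<phi> \<open>0 < s\<close> BU] by blast
  obtain c d where cd: "0 < c" "c < s" "0 < d" "d < s" and 2:
    "\<phi> (x + s *\<^sub>R w + s *\<^sub>R v) - \<phi> (x + s *\<^sub>R w) - \<phi> (x + s *\<^sub>R v) + \<phi> x = s\<^sup>2 * ?Q (x + c *\<^sub>R w + d *\<^sub>R v)"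
    using second_difference_mean_value[OF \<phi> \<open>0 < s\<close> BU'] by blast
  have 3: "?\<Delta> = s\<^sup>2 * ?Q (x + d *\<^sub>R v + c *\<^sub>R w)"
    using 2 by (simp add: algebra_simps)
  have "?P (x + a *\<^sub>R v + b *\<^sub>R w) < m" "m < ?Q (x + d *\<^sub>R v + c *\<^sub>R w)"
    using B[of a b] B[of d c] ab cd r by auto
  moreover have "?P (x + a *\<^sub>R v + b *\<^sub>R w) = ?Q (x + d *\<^sub>R v + c *\<^sub>R w)"
    using 1 3 \<open>0 < s\<close> by simp
  ultimately show False by simp
qed

lemma symmetric_second_derivative:
  assumes "open U" "x \<in> U" and f: "smooth_on U f"
  shows "frechet_derivative (\<lambda>y. frechet_derivative f (at y) v) (at x) w
    = frechet_derivative (\<lambda>y. frechet_derivative f (at y) w) (at x) v"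
proof (rule euclidean_eqI)
  fix i :: 'b assume "i \<in> Basis"
  let ?\<phi> = "\<lambda>y. f y \<bullet> i"
  have \<phi>: "smooth_on U ?\<phi>" using assms by (intro smooth_on_inner smooth_on_const)
  have D: "frechet_derivative (\<lambda>y. h y \<bullet> i) (at y) v = frechet_derivative h (at y) v \<bullet> i"
    if "smooth_on U h" "y \<in> U" for h :: "'a \<Rightarrow> 'b" and y v
    using frechet_derivative_at[OF has_derivative_inner_left[OF smooth_on_has_derivative[OF that]]]
    by metis
  have DD: "frechet_derivative (\<lambda>y. frechet_derivative f (at y) v) (at x) w \<bullet> i
      = frechet_derivative (\<lambda>y. frechet_derivative ?\<phi> (at y) v) (at x) w" for v w
  proof -
    have "frechet_derivative (\<lambda>y. frechet_derivative f (at y) v) (at x) w \<bullet> i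
        = frechet_derivative (\<lambda>y. frechet_derivative f (at y) v \<bullet> i) (at x) w"
      using D[OF smooth_on_directional_derivative[OF f] \<open>x \<in> U\<close>] by simp
    also have "\<dots> = frechet_derivative (\<lambda>y. frechet_derivative ?\<phi> (at y) v) (at x) w"
    proof -
      have "(\<lambda>y. frechet_derivative f (at y) v \<bullet> i) differentiable (at x)"
        by (rule smooth_on_differentiable[of U, OF smooth_on_inner[OF \<open>open U\<close>
            smooth_on_directional_derivative[OF f] smooth_on_const[OF \<open>open U\<close>]] \<open>x \<in> U\<close>])
      then show ?thesis
        using frechet_derivative_transform_within_open[OF _ \<open>open U\<close> \<open>x \<in> U\<close>,
            of "\<lambda>y. frechet_derivative f (at y) v \<bullet> i" "\<lambda>y. frechet_derivative ?\<phi> (at y) v"] D[OF f]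
        by simp
    qed
    finally show ?thesis .
  qed
  show "frechet_derivative (\<lambda>y. frechet_derivative f (at y) v) (at x) w \<bullet> i
      = frechet_derivative (\<lambda>y. frechet_derivative f (at y) w) (at x) v \<bullet> i"
    unfolding DD using symmetric_second_derivative_real[OF assms(1,2) \<phi>] by (intro antisym)
qed

lemma frechet_derivative_apply:
  "(f has_derivative f') (at x) \<Longrightarrow> frechet_derivative f (at x) v = f' v"
  using frechet_derivative_at by metis

lemma second_derivative_along:
  assumes "open U" "x \<in> U" and f: "smooth_on U f" and X: "smooth_on U X"
  shows "((\<lambda>y. frechet_derivative f (at y) (X y)) has_derivative
     (\<lambda>w. frechet_derivative (\<lambda>y. frechet_derivative f (at y) (X x)) (at x) w
        + frechet_derivative f (at x) (frechet_derivative X (at x) w))) (at x)"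
proof -
  let ?F = "\<lambda>i y. frechet_derivative f (at y) i"
  have F: "smooth_on U (?F i)" for i by (rule smooth_on_directional_derivative[OF f])
  have expand: "(\<Sum>i\<in>Basis. (v \<bullet> i) *\<^sub>R ?F i y) = frechet_derivative f (at y) v" if "y \<in> U" for y v
    using linear_eq_sum_Basis[OF smooth_on_linear_derivative[OF f that]] by metis
  have 1: "((\<lambda>y. \<Sum>i\<in>Basis. (X y \<bullet> i) *\<^sub>R ?F i y) has_derivative
      (\<lambda>w. \<Sum>i\<in>Basis. (X x \<bullet> i) *\<^sub>R frechet_derivative (?F i) (at x) w
           + (frechet_derivative X (at x) w \<bullet> i) *\<^sub>R ?F i x)) (at x)"
    by (intro has_derivative_sum has_derivative_scaleR has_derivative_inner_left
        smooth_on_has_derivative[OF X assms(2)] smooth_on_has_derivative[OF F assms(2)])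
  have 2: "((\<lambda>y. \<Sum>i\<in>Basis. (v \<bullet> i) *\<^sub>R ?F i y) has_derivative
      (\<lambda>w. \<Sum>i\<in>Basis. (v \<bullet> i) *\<^sub>R frechet_derivative (?F i) (at x) w)) (at x)" for v
    by (intro has_derivative_sum has_derivative_scaleR_right smooth_on_has_derivative[OF F assms(2)])
  have "((\<lambda>y. frechet_derivative f (at y) v) has_derivative
      (\<lambda>w. \<Sum>i\<in>Basis. (v \<bullet> i) *\<^sub>R frechet_derivative (?F i) (at x) w)) (at x)" for v
    by (rule has_derivative_transform_within_open[OF 2 assms(1,2)]) (rule expand)
  note 3 = frechet_derivative_apply[OF this]
  have "((\<lambda>y. frechet_derivative f (at y) (X y)) has_derivative
      (\<lambda>w. \<Sum>i\<in>Basis. (X x \<bullet> i) *\<^sub>R frechet_derivative (?F i) (at x) w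
           + (frechet_derivative X (at x) w \<bullet> i) *\<^sub>R ?F i x)) (at x)"
    by (rule has_derivative_transform_within_open[OF 1 assms(1,2)]) (rule expand)
  then show ?thesis
    unfolding 3[of "X x"] sum.distrib expand[OF assms(2)] .
qed

text \<open>Differentiating \<open>X2 (L y) = DL(y) (X1 y)\<close> produces a second derivative of \<open>L\<close>, which is symmetric
and therefore cancels in the commutator: the coordinate bracket is natural.\<close>

lemma bracket_of_related_fields:
  fixes L :: "'e::euclidean_space \<Rightarrow> 'f::euclidean_space"
  assumes "open U" "x \<in> U" and L: "smooth_on U L"
    and X1: "smooth_on U X1" and Y1: "smooth_on U Y1"
    and X2: "smooth_on V X2" and Y2: "smooth_on V Y2" and "L ` U \<subseteq> V"
    and X: "\<And>y. y \<in> U \<Longrightarrow> X2 (L y) = frechet_derivative L (at y) (X1 y)"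
    and Y: "\<And>y. y \<in> U \<Longrightarrow> Y2 (L y) = frechet_derivative L (at y) (Y1 y)"
  shows "frechet_derivative Y2 (at (L x)) (X2 (L x)) - frechet_derivative X2 (at (L x)) (Y2 (L x))
    = frechet_derivative L (at x) (frechet_derivative Y1 (at x) (X1 x) - frechet_derivative X1 (at x) (Y1 x))"
proof -
  have *: "frechet_derivative Z2 (at (L x)) (frechet_derivative L (at x) w)
      = frechet_derivative (\<lambda>y. frechet_derivative L (at y) (Z1 x)) (at x) w
        + frechet_derivative L (at x) (frechet_derivative Z1 (at x) w)"
    if Z1: "smooth_on U Z1" and Z2: "smooth_on V Z2"
      and Z: "\<And>y. y \<in> U \<Longrightarrow> Z2 (L y) = frechet_derivative L (at y) (Z1 y)" for Z1 Z2 w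
  proof -
    have "L x \<in> V" using assms by auto
    have "((\<lambda>y. Z2 (L y)) has_derivative
        (\<lambda>w. frechet_derivative Z2 (at (L x)) (frechet_derivative L (at x) w))) (at x)"
      using diff_chain_at[OF smooth_on_has_derivative[OF L \<open>x \<in> U\<close>] smooth_on_has_derivative[OF Z2 \<open>L x \<in> V\<close>]]
      by (simp add: o_def)
    then have "((\<lambda>y. frechet_derivative L (at y) (Z1 y)) has_derivative
        (\<lambda>w. frechet_derivative Z2 (at (L x)) (frechet_derivative L (at x) w))) (at x)"
      by (rule has_derivative_transform_within_open[OF _ assms(1,2)]) (rule Z)
    from fun_cong[OF has_derivative_unique[OF this second_derivative_along[OF assms(1,2) L Z1]]]
    show ?thesis .
  qed
  have sym: "frechet_derivative (\<lambda>y. frechet_derivative L (at y) (Y1 x)) (at x) (X1 x)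
      = frechet_derivative (\<lambda>y. frechet_derivative L (at y) (X1 x)) (at x) (Y1 x)"
    by (rule symmetric_second_derivative[OF assms(1,2) L])
  have "frechet_derivative Y2 (at (L x)) (X2 (L x)) =
      frechet_derivative (\<lambda>y. frechet_derivative L (at y) (Y1 x)) (at x) (X1 x)
      + frechet_derivative L (at x) (frechet_derivative Y1 (at x) (X1 x))"
    unfolding X[OF assms(2)] by (rule *[OF Y1 Y2 Y])
  moreover have "frechet_derivative X2 (at (L x)) (Y2 (L x)) =
      frechet_derivative (\<lambda>y. frechet_derivative L (at y) (X1 x)) (at x) (Y1 x)
      + frechet_derivative L (at x) (frechet_derivative X1 (at x) (Y1 x))"
    unfolding Y[OF assms(2)] by (rule *[OF X1 X2 X])
  ultimately show ?thesis
    by (simp add: sym linear_diff[OF smooth_on_linear_derivative[OF L assms(2)]])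
qed

section \<open>Manifolds in charts\<close>

definition chart_rep :: "('a, 'e) chart \<Rightarrow> ('b, 'f) chart \<Rightarrow> ('a \<Rightarrow> 'b) \<Rightarrow> 'e \<Rightarrow> 'f" where
  "chart_rep c d F = snd d \<circ> F \<circ> chart_inv c"

locale smooth_manifold =
  fixes \<A> :: "('a::{t2_space, second_countable_topology}, 'e::euclidean_space) chart set"
  assumes atlas: "smooth_atlas \<A>"
begin

lemma chart_open: "c \<in> \<A> \<Longrightarrow> open (fst c)"
  and chart_image_open: "c \<in> \<A> \<Longrightarrow> open (snd c ` fst c)"
  and chart_homeomorphism: "c \<in> \<A> \<Longrightarrow> homeomorphism (fst c) (snd c ` fst c) (snd c) (chart_inv c)"
  using atlas unfolding smooth_atlas_def by blast+

lemma chart_inv_chart: "c \<in> \<A> \<Longrightarrow> p \<in> fst c \<Longrightarrow> chart_inv c (snd c p) = p"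
  using homeomorphism_apply1[OF chart_homeomorphism] .

lemma chart_inv_in: "c \<in> \<A> \<Longrightarrow> x \<in> snd c ` fst c \<Longrightarrow> chart_inv c x \<in> fst c"
  using chart_inv_chart[of c] by force

lemma chart_image_Int:
  "c \<in> \<A> \<Longrightarrow> snd c ` (fst c \<inter> V) = {x \<in> snd c ` fst c. chart_inv c x \<in> V}"
  using chart_inv_chart[of c] by force

lemma open_chart_image_Int:
  assumes "c \<in> \<A>" "open V"
  shows "open (snd c ` (fst c \<inter> V))"
proof -
  have "continuous_on (snd c ` fst c) (chart_inv c)"
    using homeomorphism_cont2[OF chart_homeomorphism[OF assms(1)]] .
  then have "open (chart_inv c -` V \<inter> snd c ` fst c)"
    using assms continuous_on_open_vimage[OF chart_image_open[OF assms(1)]] by blast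
  also have "chart_inv c -` V \<inter> snd c ` fst c = snd c ` (fst c \<inter> V)"
    unfolding chart_image_Int[OF assms(1)] by auto
  finally show ?thesis .
qed

lemma chart_at: "chart_at \<A> p \<in> \<A>" "p \<in> fst (chart_at \<A> p)"
proof -
  have "\<exists>c. c \<in> \<A> \<and> p \<in> fst c" using atlas unfolding smooth_atlas_def by blast
  then have "chart_at \<A> p \<in> \<A> \<and> p \<in> fst (chart_at \<A> p)" unfolding chart_at_def by (rule someI_ex)
  then show "chart_at \<A> p \<in> \<A>" "p \<in> fst (chart_at \<A> p)" by auto
qed

lemma coord_at_in: "coord_at \<A> p \<in> snd (chart_at \<A> p) ` fst (chart_at \<A> p)"
  unfolding coord_at_def using chart_at by blast

lemma chart_inv_coord_at: "chart_inv (chart_at \<A> p) (coord_at \<A> p) = p"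
  unfolding coord_at_def using chart_at chart_inv_chart by blast

lemma smooth_map_ident: "smooth_map \<A> \<A> (\<lambda>x. x)"
  using atlas unfolding smooth_map_def smooth_atlas_def by (simp add: comp_def)

lemma open_rep_domain:
  "smooth_map \<A> \<A> F \<Longrightarrow> c \<in> \<A> \<Longrightarrow> d \<in> \<A> \<Longrightarrow> open (snd c ` (fst c \<inter> F -` fst d))"
  unfolding smooth_map_def by (intro open_chart_image_Int open_vimage chart_open) auto

lemma smooth_chart_rep:
  "smooth_map \<A> \<A> F \<Longrightarrow> c \<in> \<A> \<Longrightarrow> d \<in> \<A> \<Longrightarrow> smooth_on (snd c ` (fst c \<inter> F -` fst d)) (chart_rep c d F)"
  unfolding smooth_map_def chart_rep_def by blast

lemma chart_rep_has_derivative: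
  assumes "smooth_map \<A> \<A> F" "c \<in> \<A>" "d \<in> \<A>" "p \<in> fst c" "F p \<in> fst d"
  shows "(chart_rep c d F has_derivative frechet_derivative (chart_rep c d F) (at (snd c p))) (at (snd c p))"
  using assms by (intro smooth_on_has_derivative[OF smooth_chart_rep]) auto

lemma chart_rep_apply: "c \<in> \<A> \<Longrightarrow> p \<in> fst c \<Longrightarrow> chart_rep c d F (snd c p) = snd d (F p)"
  unfolding chart_rep_def by (simp add: chart_inv_chart)

text \<open>The chain rule with arbitrary charts in all three places. With \<open>F\<close> or \<open>G\<close> the identity it also
describes the change of coordinates of a tangent vector.\<close>

lemma derivative_chart_rep_comp:
  assumes F: "smooth_map \<A> \<A> F" and G: "smooth_map \<A> \<A> G"
    and "c \<in> \<A>" "d \<in> \<A>" "e \<in> \<A>" "p \<in> fst c" "F p \<in> fst d" "G (F p) \<in> fst e"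
  shows "frechet_derivative (chart_rep c e (\<lambda>x. G (F x))) (at (snd c p)) v
    = frechet_derivative (chart_rep d e G) (at (snd d (F p)))
        (frechet_derivative (chart_rep c d F) (at (snd c p)) v)"
proof -
  let ?U = "snd c ` (fst c \<inter> F -` fst d)"
  have FD: "(chart_rep c d F has_derivative frechet_derivative (chart_rep c d F) (at (snd c p))) (at (snd c p))"
    using assms by (intro chart_rep_has_derivative)
  have GD: "(chart_rep d e G has_derivative frechet_derivative (chart_rep d e G) (at (snd d (F p))))
      (at (chart_rep c d F (snd c p)))"
    using chart_rep_has_derivative[OF G \<open>d \<in> \<A>\<close> \<open>e \<in> \<A>\<close> assms(7,8)] assms by (simp add: chart_rep_apply)
  have "(chart_rep c e (\<lambda>x. G (F x)) has_derivative
      (\<lambda>v. frechet_derivative (chart_rep d e G) (at (snd d (F p)))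
        (frechet_derivative (chart_rep c d F) (at (snd c p)) v))) (at (snd c p))"
  proof (rule has_derivative_transform_within_open)
    show "((\<lambda>y. chart_rep d e G (chart_rep c d F y)) has_derivative
      (\<lambda>v. frechet_derivative (chart_rep d e G) (at (snd d (F p)))
        (frechet_derivative (chart_rep c d F) (at (snd c p)) v))) (at (snd c p))"
      using diff_chain_at[OF FD GD] by (simp add: o_def)
    show "open ?U" using assms by (intro open_rep_domain)
    show "snd c p \<in> ?U" using assms by auto
    fix y assume "y \<in> ?U"
    then show "chart_rep d e G (chart_rep c d F y) = chart_rep c e (\<lambda>x. G (F x)) y"
      using assms by (auto simp: chart_rep_def chart_inv_chart)
  qed
  from frechet_derivative_apply[OF this] show ?thesis .
qed

lemma derivative_chart_rep_ident:
  assumes "c \<in> \<A>" "p \<in> fst c"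
  shows "frechet_derivative (chart_rep c c (\<lambda>x. x)) (at (snd c p)) v = v"
proof -
  have "(chart_rep c c (\<lambda>x. x) has_derivative (\<lambda>v. v)) (at (snd c p))"
    by (rule has_derivative_transform_within_open[OF has_derivative_ident chart_image_open[OF assms(1)]])
      (use assms in \<open>auto simp: chart_rep_def chart_inv_chart\<close>)
  from frechet_derivative_apply[OF this] show ?thesis .
qed

lemma tangent_map_eq:
  "tangent_map \<A> \<A> F p v
   = frechet_derivative (chart_rep (chart_at \<A> p) (chart_at \<A> (F p)) F) (at (coord_at \<A> p)) v"
  unfolding tangent_map_def chart_rep_def ..

lemma linear_tangent_map:
  assumes "smooth_map \<A> \<A> F" shows "linear (tangent_map \<A> \<A> F p)"
  unfolding tangent_map_def coord_at_def
  using has_derivative_linear[OF chart_rep_has_derivative[OF assms chart_at(1) chart_at(1) chart_at(2) chart_at(2)]]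
  unfolding chart_rep_def .

lemma tangent_map_comp:
  assumes "smooth_map \<A> \<A> F" "smooth_map \<A> \<A> G"
  shows "tangent_map \<A> \<A> (\<lambda>x. G (F x)) p v = tangent_map \<A> \<A> G (F p) (tangent_map \<A> \<A> F p v)"
  unfolding tangent_map_eq coord_at_def
  by (rule derivative_chart_rep_comp[OF assms chart_at(1) chart_at(1) chart_at(1) chart_at(2) chart_at(2) chart_at(2)])

lemma tangent_map_ident: "tangent_map \<A> \<A> (\<lambda>x. x) p v = v"
  unfolding tangent_map_eq coord_at_def by (rule derivative_chart_rep_ident[OF chart_at])

lemma field_in_chart_apply:
  assumes "c \<in> \<A>" "p \<in> fst c"
  shows "field_in_chart \<A> c X (snd c p)
    = frechet_derivative (chart_rep (chart_at \<A> p) c (\<lambda>x. x)) (at (snd (chart_at \<A> p) p)) (X p)"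
  unfolding field_in_chart_def chart_rep_def Let_def
  using assms by (simp add: chart_inv_chart coord_at_def comp_def)

lemma field_in_chart_at: "field_in_chart \<A> (chart_at \<A> p) X (coord_at \<A> p) = X p"
  unfolding coord_at_def field_in_chart_apply[OF chart_at] by (rule derivative_chart_rep_ident[OF chart_at])

lemma linear_transition:
  assumes "c \<in> \<A>" "d \<in> \<A>" "p \<in> fst c" "p \<in> fst d"
  shows "linear (frechet_derivative (chart_rep c d (\<lambda>x. x)) (at (snd c p)))"
  using has_derivative_linear[OF chart_rep_has_derivative[OF smooth_map_ident assms]] .

text \<open>It suffices to know a field in each chart at the points of the form \<open>snd c p\<close>, where its
coordinates can be computed from the preferred chart at \<open>p\<close>.\<close>

lemma smooth_fieldI:
  assumes "\<And>c. c \<in> \<A> \<Longrightarrow> smooth_on (snd c ` fst c) (F c)"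
    and "\<And>c p. c \<in> \<A> \<Longrightarrow> p \<in> fst c \<Longrightarrow> field_in_chart \<A> c X (snd c p) = F c (snd c p)"
  shows "smooth_field \<A> X"
  unfolding smooth_field_def
proof
  fix c assume c: "c \<in> \<A>"
  show "smooth_on (snd c ` fst c) (field_in_chart \<A> c X)"
    by (rule smooth_on_cong[OF chart_image_open[OF c] _ assms(1)[OF c]])
       (use c in \<open>force simp: assms(2)[OF c]\<close>)
qed

lemma smooth_funI:
  assumes "\<And>c. c \<in> \<A> \<Longrightarrow> smooth_on (snd c ` fst c) (F c)"
    and "\<And>c p. c \<in> \<A> \<Longrightarrow> p \<in> fst c \<Longrightarrow> f p = F c (snd c p)"
  shows "smooth_fun \<A> f"
  unfolding smooth_fun_def
proof
  fix c assume c: "c \<in> \<A>"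
  show "smooth_on (snd c ` fst c) (f \<circ> chart_inv c)"
    by (rule smooth_on_cong[OF chart_image_open[OF c] _ assms(1)[OF c]])
       (use c in \<open>force simp: chart_inv_chart assms(2)[OF c]\<close>)
qed

lemma smooth_fun_const: "smooth_fun \<A> (\<lambda>p. k)"
  by (rule smooth_funI[where F="\<lambda>_ _. k"]) (auto intro: smooth_on_const chart_image_open)

lemma smooth_field_add:
  assumes "smooth_field \<A> X" "smooth_field \<A> Y"
  shows "smooth_field \<A> (\<lambda>p. X p + Y p)"
proof (rule smooth_fieldI[where F="\<lambda>c x. field_in_chart \<A> c X x + field_in_chart \<A> c Y x"])
  show "smooth_on (snd c ` fst c) (\<lambda>x. field_in_chart \<A> c X x + field_in_chart \<A> c Y x)"
    if "c \<in> \<A>" for c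
    using assms that unfolding smooth_field_def by (intro smooth_on_add chart_image_open) auto
qed (simp add: field_in_chart_apply linear_add[OF linear_transition[OF chart_at(1) _ chart_at(2)]])

lemma smooth_field_scale:
  assumes "smooth_fun \<A> f" "smooth_field \<A> X"
  shows "smooth_field \<A> (\<lambda>p. f p *\<^sub>R X p)"
proof (rule smooth_fieldI[where F="\<lambda>c x. (f \<circ> chart_inv c) x *\<^sub>R field_in_chart \<A> c X x"])
  show "smooth_on (snd c ` fst c) (\<lambda>x. (f \<circ> chart_inv c) x *\<^sub>R field_in_chart \<A> c X x)"
    if "c \<in> \<A>" for c
    using assms that unfolding smooth_field_def smooth_fun_def
    by (intro smooth_on_scaleR chart_image_open) blast+
qed (simp add: field_in_chart_apply chart_inv_chart linear_cmul[OF linear_transition[OF chart_at(1) _ chart_at(2)]])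

text \<open>The change of coordinates replaces the preferred chart, which jumps from point to point, by a fixed
one, in which the smooth dependence on the point is visible.\<close>

lemma deriv_along_in_chart:
  assumes "smooth_fun \<A> f" "c \<in> \<A>" "p \<in> fst c"
  shows "deriv_along \<A> X f p
    = frechet_derivative (f \<circ> chart_inv c) (at (snd c p)) (field_in_chart \<A> c X (snd c p))"
proof -
  let ?d = "chart_at \<A> p"
  let ?T = "chart_rep ?d c (\<lambda>x. x)"
  let ?U = "snd ?d ` (fst ?d \<inter> (\<lambda>x. x) -` fst c)"
  have Tp: "?T (snd ?d p) = snd c p" using chart_at by (simp add: chart_rep_apply)
  have TD: "(?T has_derivative frechet_derivative ?T (at (snd ?d p))) (at (snd ?d p))"
    using assms chart_at by (intro chart_rep_has_derivative smooth_map_ident)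
  have "smooth_on (snd c ` fst c) (f \<circ> chart_inv c)" using assms unfolding smooth_fun_def by blast
  then have fD: "(f \<circ> chart_inv c has_derivative frechet_derivative (f \<circ> chart_inv c) (at (snd c p)))
      (at (?T (snd ?d p)))"
    unfolding Tp using assms by (intro smooth_on_has_derivative) auto
  have "(f \<circ> chart_inv ?d has_derivative
     (\<lambda>v. frechet_derivative (f \<circ> chart_inv c) (at (snd c p)) (frechet_derivative ?T (at (snd ?d p)) v)))
     (at (snd ?d p))"
  proof (rule has_derivative_transform_within_open)
    show "((\<lambda>y. (f \<circ> chart_inv c) (?T y)) has_derivative
      (\<lambda>v. frechet_derivative (f \<circ> chart_inv c) (at (snd c p)) (frechet_derivative ?T (at (snd ?d p)) v)))
      (at (snd ?d p))"
      using diff_chain_at[OF TD fD] by (simp add: o_def)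
    show "open ?U" using assms chart_at by (intro open_rep_domain smooth_map_ident)
    show "snd ?d p \<in> ?U" using assms chart_at by auto
    fix y assume "y \<in> ?U"
    then show "(f \<circ> chart_inv c) (?T y) = (f \<circ> chart_inv ?d) y"
      using assms chart_at by (auto simp: chart_rep_def chart_inv_chart)
  qed
  from frechet_derivative_apply[OF this] show ?thesis
    unfolding deriv_along_def coord_at_def field_in_chart_apply[OF assms(2,3)] .
qed

lemma smooth_fun_deriv_along:
  assumes "smooth_fun \<A> f" "smooth_field \<A> X"
  shows "smooth_fun \<A> (deriv_along \<A> X f)"
proof (rule smooth_funI)
  show "smooth_on (snd c ` fst c) (\<lambda>x. frechet_derivative (f \<circ> chart_inv c) (at x) (field_in_chart \<A> c X x))"
    if "c \<in> \<A>" for c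
    using assms that unfolding smooth_field_def smooth_fun_def
    by (intro smooth_on_derivative_along[where V="snd c ` fst c"] chart_image_open smooth_on_ident) auto
qed (use assms deriv_along_in_chart in auto)

text \<open>In the preferred chart at \<open>p\<close> both iterated derivatives contain the Hessian of \<open>f\<close> evaluated on
\<open>X p\<close> and \<open>Y p\<close>; by symmetry it cancels and what is left is the derivative of \<open>f\<close> in the direction
of the coordinate bracket.\<close>

lemma deriv_along_lie_bracket:
  assumes f: "smooth_fun \<A> f" and "smooth_field \<A> X" "smooth_field \<A> Y"
  shows "deriv_along \<A> (lie_bracket \<A> X Y) f p
    = deriv_along \<A> X (deriv_along \<A> Y f) p - deriv_along \<A> Y (deriv_along \<A> X f) p"
proof -
  let ?c = "chart_at \<A> p" and ?x = "coord_at \<A> p"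
  let ?U = "snd ?c ` fst ?c"
  let ?f = "f \<circ> chart_inv ?c"
  let ?X = "field_in_chart \<A> ?c X" and ?Y = "field_in_chart \<A> ?c Y"
  have U: "open ?U" "?x \<in> ?U" using chart_image_open chart_at coord_at_in by auto
  have sf: "smooth_on ?U ?f" using f chart_at unfolding smooth_fun_def by blast
  have sm: "smooth_on ?U (field_in_chart \<A> ?c Z)" if "smooth_field \<A> Z" for Z
    using that chart_at unfolding smooth_field_def by blast
  have *: "deriv_along \<A> W (deriv_along \<A> Z f) p
      = frechet_derivative (\<lambda>y. frechet_derivative ?f (at y) (Z p)) (at ?x) (W p)
        + frechet_derivative ?f (at ?x) (frechet_derivative (field_in_chart \<A> ?c Z) (at ?x) (W p))"
    if "smooth_field \<A> Z" for W Z
  proof -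
    note D = second_derivative_along[OF U sf sm[OF that]]
    have "(deriv_along \<A> Z f \<circ> chart_inv ?c has_derivative
       (\<lambda>w. frechet_derivative (\<lambda>y. frechet_derivative ?f (at y) (field_in_chart \<A> ?c Z ?x)) (at ?x) w
        + frechet_derivative ?f (at ?x) (frechet_derivative (field_in_chart \<A> ?c Z) (at ?x) w))) (at ?x)"
    proof (rule has_derivative_transform_within_open[OF D U])
      fix y assume "y \<in> ?U"
      then show "frechet_derivative ?f (at y) (field_in_chart \<A> ?c Z y) = (deriv_along \<A> Z f \<circ> chart_inv ?c) y"
        using deriv_along_in_chart[OF f chart_at(1), of "chart_inv ?c y" p Z] chart_at
        by (auto simp: chart_inv_chart)
    qed
    from frechet_derivative_apply[OF this] show ?thesis
      unfolding deriv_along_def[of \<A> W] field_in_chart_at .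
  qed
  have "lie_bracket \<A> X Y p = frechet_derivative ?Y (at ?x) (X p) - frechet_derivative ?X (at ?x) (Y p)"
    unfolding lie_bracket_def Let_def field_in_chart_at ..
  then have "deriv_along \<A> (lie_bracket \<A> X Y) f p =
     frechet_derivative ?f (at ?x) (frechet_derivative ?Y (at ?x) (X p))
      - frechet_derivative ?f (at ?x) (frechet_derivative ?X (at ?x) (Y p))"
    unfolding deriv_along_def[of \<A> "lie_bracket \<A> X Y"]
    by (simp add: linear_diff[OF smooth_on_linear_derivative[OF sf U(2)]])
  moreover have "frechet_derivative (\<lambda>y. frechet_derivative ?f (at y) (X p)) (at ?x) (Y p)
      = frechet_derivative (\<lambda>y. frechet_derivative ?f (at y) (Y p)) (at ?x) (X p)"
    by (rule symmetric_second_derivative[OF U sf])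
  ultimately show ?thesis unfolding *[OF assms(2)] *[OF assms(3)] by simp
qed

end

section \<open>Left-invariant frames on Lie groups\<close>

lemma partial_derivative_snd:
  assumes "smooth_on W \<mu>" "(x, y) \<in> W"
  shows "frechet_derivative (\<lambda>y. \<mu> (x, y)) (at y) v = frechet_derivative \<mu> (at (x, y)) (0, v)"
proof -
  have "((\<lambda>y. (x, y)) has_derivative (\<lambda>v. (0, v))) (at y)"
    by (auto intro!: derivative_eq_intros)
  from diff_chain_at[OF this smooth_on_has_derivative[OF assms]]
  show ?thesis by (intro frechet_derivative_apply) (simp add: o_def)
qed

sublocale lie_group \<subseteq> smooth_manifold \<A>
  using atlas by unfold_locales

context lie_group
begin

lemma mult_assoc: "(x \<otimes> y) \<otimes> z = x \<otimes> (y \<otimes> z)"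
  and one_mult [simp]: "\<one> \<otimes> x = x"
  and mult_one [simp]: "x \<otimes> \<one> = x"
  and inv_mult [simp]: "inv x \<otimes> x = \<one>"
  and mult_inv [simp]: "x \<otimes> inv x = \<one>"
  using m_assoc l_one r_one l_inv r_inv unfolding carrier_UNIV by auto

lemma chart_inj: "c \<in> \<A> \<Longrightarrow> snd c p = snd c q \<Longrightarrow> p \<in> fst c \<Longrightarrow> q \<in> fst c \<Longrightarrow> p = q"
  using chart_inv_chart by metis

text \<open>The second argument of the multiplication is differentiated while the first one moves as a parameter,
so both arguments and the value get charts of their own.\<close>

definition mult_domain :: "('a, 'e) chart \<Rightarrow> ('a, 'e) chart \<Rightarrow> ('a, 'e) chart \<Rightarrow> ('e \<times> 'e) set" where
  "mult_domain c d e = {z \<in> snd c ` fst c \<times> snd d ` fst d. chart_inv c (fst z) \<otimes> chart_inv d (snd z) \<in> fst e}"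

definition mult_rep :: "('a, 'e) chart \<Rightarrow> ('a, 'e) chart \<Rightarrow> ('a, 'e) chart \<Rightarrow> 'e \<times> 'e \<Rightarrow> 'e" where
  "mult_rep c d e z = snd e (chart_inv c (fst z) \<otimes> chart_inv d (snd z))"

lemma continuous_mult: "continuous_on UNIV (\<lambda>z. fst z \<otimes> snd z)"
  using smooth_mult unfolding smooth_map_def by (simp add: case_prod_beta')

lemma open_mult_domain:
  assumes "c \<in> \<A>" "d \<in> \<A>" "e \<in> \<A>"
  shows "open (mult_domain c d e)"
proof -
  let ?S = "snd c ` fst c \<times> snd d ` fst d"
  have c: "continuous_on (snd c ` fst c) (chart_inv c)" and d: "continuous_on (snd d ` fst d) (chart_inv d)"
    using assms by (auto intro: homeomorphism_cont2[OF chart_homeomorphism])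
  have "continuous_on ?S (\<lambda>z. (chart_inv c (fst z), chart_inv d (snd z)))"
    by (intro continuous_on_Pair continuous_on_compose2[OF c] continuous_on_compose2[OF d] continuous_intros) auto
  from continuous_on_compose2[OF continuous_mult this]
  have "continuous_on ?S (\<lambda>z. chart_inv c (fst z) \<otimes> chart_inv d (snd z))" by simp
  then have "open ((\<lambda>z. chart_inv c (fst z) \<otimes> chart_inv d (snd z)) -` fst e \<inter> ?S)"
    using assms by (intro iffD1[OF continuous_on_open_vimage, rule_format] open_Times chart_image_open chart_open)
  also have "(\<lambda>z. chart_inv c (fst z) \<otimes> chart_inv d (snd z)) -` fst e \<inter> ?S = mult_domain c d e"
    unfolding mult_domain_def by auto
  finally show ?thesis .
qed

lemma smooth_mult_rep:
  assumes "c \<in> \<A>" "d \<in> \<A>" "e \<in> \<A>"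
  shows "smooth_on (mult_domain c d e) (mult_rep c d e)"
proof -
  let ?cd = "(fst c \<times> fst d, map_prod (snd c) (snd d))"
  have inv: "chart_inv ?cd (snd c p, snd d q) = (p, q)" if "p \<in> fst c" "q \<in> fst d" for p q
    unfolding chart_inv_def
  proof (rule inv_into_f_eq)
    show "inj_on (snd ?cd) (fst ?cd)"
      unfolding inj_on_def by (auto dest: chart_inj[OF assms(1)] chart_inj[OF assms(2)])
  qed (use that in auto)
  have "?cd \<in> prod_atlas \<A> \<A>" unfolding prod_atlas_def using assms by force
  then have *: "smooth_on (snd ?cd ` (fst ?cd \<inter> (\<lambda>(x, y). x \<otimes> y) -` fst e))
      (snd e \<circ> (\<lambda>(x, y). x \<otimes> y) \<circ> chart_inv ?cd)"
    using smooth_mult assms unfolding smooth_map_def by blast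
  have "mult_domain c d e = snd ?cd ` (fst ?cd \<inter> (\<lambda>(x, y). x \<otimes> y) -` fst e)"
  proof (intro equalityI subsetI)
    fix z assume "z \<in> mult_domain c d e"
    then obtain p q where "p \<in> fst c" "q \<in> fst d" "z = (snd c p, snd d q)" "p \<otimes> q \<in> fst e"
      unfolding mult_domain_def using assms by (auto simp: chart_inv_chart)
    then show "z \<in> snd ?cd ` (fst ?cd \<inter> (\<lambda>(x, y). x \<otimes> y) -` fst e)" by force
  next
    fix z assume "z \<in> snd ?cd ` (fst ?cd \<inter> (\<lambda>(x, y). x \<otimes> y) -` fst e)"
    then obtain p q where "p \<in> fst c" "q \<in> fst d" "z = (snd c p, snd d q)" "p \<otimes> q \<in> fst e" by auto
    then show "z \<in> mult_domain c d e" unfolding mult_domain_def using assms by (auto simp: chart_inv_chart)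
  qed
  with * have "smooth_on (mult_domain c d e) (snd e \<circ> (\<lambda>(x, y). x \<otimes> y) \<circ> chart_inv ?cd)" by simp
  then show ?thesis
  proof (rule smooth_on_cong[OF open_mult_domain[OF assms], rotated])
    fix z assume "z \<in> mult_domain c d e"
    then obtain p q where "p \<in> fst c" "q \<in> fst d" "z = (snd c p, snd d q)"
      unfolding mult_domain_def by auto
    then show "(snd e \<circ> (\<lambda>(x, y). x \<otimes> y) \<circ> chart_inv ?cd) z = mult_rep c d e z"
      unfolding mult_rep_def using inv assms by (simp add: chart_inv_chart)
  qed
qed

text \<open>Left translation by \<open>a\<close> is the multiplication with its first argument frozen.\<close>

lemma smooth_left_mult: "smooth_map \<A> \<A> (\<lambda>x. a \<otimes> x)"
  unfolding smooth_map_def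
proof (intro conjI ballI)
  have "continuous_on UNIV (\<lambda>x. (a, x))" by (intro continuous_intros)
  from continuous_on_compose2[OF continuous_mult this] show cont: "continuous_on UNIV (\<lambda>x. a \<otimes> x)" by simp
  fix c d assume cd: "c \<in> \<A>" "d \<in> \<A>"
  let ?a = "chart_at \<A> a"
  let ?U = "snd c ` (fst c \<inter> (\<lambda>x. a \<otimes> x) -` fst d)"
  have "open ?U" using cont cd by (intro open_chart_image_Int open_vimage chart_open) auto
  have "smooth_on ?U (\<lambda>y. mult_rep ?a c d (coord_at \<A> a, y))"
  proof (rule smooth_on_compose[OF \<open>open ?U\<close> smooth_mult_rep[OF chart_at(1) cd]])
    show "smooth_on ?U (\<lambda>y. (coord_at \<A> a, y))"
      by (intro smooth_on_Pair smooth_on_const smooth_on_ident \<open>open ?U\<close>)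
    show "(\<lambda>y. (coord_at \<A> a, y)) ` ?U \<subseteq> mult_domain ?a c d"
      unfolding mult_domain_def using coord_at_in cd by (auto simp: chart_inv_coord_at chart_inv_chart)
  qed
  then show "smooth_on ?U (snd d \<circ> (\<lambda>x. a \<otimes> x) \<circ> chart_inv c)"
    by (rule smooth_on_cong[OF \<open>open ?U\<close>, rotated]) (simp add: mult_rep_def chart_inv_coord_at)
qed

lemma linear_left_transl: "linear (left_transl G \<A> a p)"
  unfolding left_transl_def by (rule linear_tangent_map[OF smooth_left_mult])

lemma left_transl_comp: "left_transl G \<A> a (b \<otimes> p) (left_transl G \<A> b p v) = left_transl G \<A> (a \<otimes> b) p v"
  unfolding left_transl_def tangent_map_comp[OF smooth_left_mult smooth_left_mult, symmetric] mult_assoc ..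

lemma left_transl_one: "left_transl G \<A> \<one> p v = v"
proof -
  have "(\<lambda>x. \<one> \<otimes> x) = (\<lambda>x. x)" by simp
  then show ?thesis unfolding left_transl_def by (simp only: tangent_map_ident)
qed

text \<open>The left Maurer-Cartan form: a tangent vector at \<open>p\<close> is transported to the identity.\<close>

definition to_lie_algebra :: "'a \<Rightarrow> 'e \<Rightarrow> 'e" where
  "to_lie_algebra p = left_transl G \<A> (inv p) p"

lemma linear_to_lie_algebra: "linear (to_lie_algebra p)"
  unfolding to_lie_algebra_def by (rule linear_left_transl)

lemma to_lie_algebra_left_inv_field [simp]: "to_lie_algebra p (left_inv_field G \<A> v p) = v"
  using left_transl_comp[of "inv p" p \<one> v]
  unfolding to_lie_algebra_def left_inv_field_def by (simp add: left_transl_one)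

lemma left_inv_field_to_lie_algebra [simp]: "left_inv_field G \<A> (to_lie_algebra p v) p = v"
  using left_transl_comp[of p "inv p" p v]
  unfolding to_lie_algebra_def left_inv_field_def by (simp add: left_transl_one)

lemma left_inv_field_one [simp]: "left_inv_field G \<A> v \<one> = v"
  unfolding left_inv_field_def by (rule left_transl_one)

lemma linear_left_inv_field: "linear (\<lambda>v. left_inv_field G \<A> v p)"
  unfolding left_inv_field_def by (rule linear_left_transl)

text \<open>The preferred chart at \<open>p\<close> drops out, so the coordinates of a left-invariant field are a partial
derivative of the multiplication, which depends smoothly on \<open>p\<close>.\<close>

lemma field_in_chart_left_inv_field:
  assumes "c \<in> \<A>" "p \<in> fst c"
  shows "field_in_chart \<A> c (left_inv_field G \<A> v) (snd c p)
    = frechet_derivative (chart_rep (chart_at \<A> \<one>) c (\<lambda>x. p \<otimes> x)) (at (coord_at \<A> \<one>)) v"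
  using derivative_chart_rep_comp[OF smooth_left_mult smooth_map_ident chart_at(1) chart_at(1) assms(1)
      chart_at(2), of p \<one> p v] assms(2) chart_at(2)
  unfolding field_in_chart_apply[OF assms] left_inv_field_def left_transl_def tangent_map_eq coord_at_def
  by simp

lemma chart_rep_left_mult:
  "chart_inv c x = a \<Longrightarrow> chart_rep d e (\<lambda>y. a \<otimes> y) = (\<lambda>y. mult_rep c d e (x, y))"
  unfolding chart_rep_def mult_rep_def by auto

lemma smooth_left_inv_field: "smooth_field \<A> (left_inv_field G \<A> v)"
proof (rule smooth_fieldI)
  let ?c1 = "chart_at \<A> \<one>" and ?x1 = "coord_at \<A> \<one>"
  fix c assume c: "c \<in> \<A>"
  have sub: "(x, ?x1) \<in> mult_domain c ?c1 c" if "x \<in> snd c ` fst c" for x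
    unfolding mult_domain_def using that coord_at_in[of \<one>] chart_inv_in[OF c]
    by (auto simp: chart_inv_coord_at)
  show "smooth_on (snd c ` fst c) (\<lambda>x. frechet_derivative (mult_rep c ?c1 c) (at (x, ?x1)) (0, v))"
    by (rule smooth_on_derivative_along[OF chart_image_open[OF c] smooth_mult_rep[OF c chart_at(1) c]])
       (use sub c in \<open>auto intro!: smooth_on_Pair smooth_on_const smooth_on_ident chart_image_open\<close>)
  fix p assume p: "p \<in> fst c"
  show "field_in_chart \<A> c (left_inv_field G \<A> v) (snd c p)
      = frechet_derivative (mult_rep c ?c1 c) (at (snd c p, ?x1)) (0, v)"
    unfolding field_in_chart_left_inv_field[OF c p] chart_rep_left_mult[OF chart_inv_chart[OF c p]]
    using sub p by (intro partial_derivative_snd[OF smooth_mult_rep[OF c chart_at(1) c]]) auto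
qed

lemma to_lie_algebra_in_chart:
  assumes "c \<in> \<A>" "p \<in> fst c"
  shows "to_lie_algebra p (X p) = frechet_derivative (chart_rep c (chart_at \<A> \<one>) (\<lambda>x. inv p \<otimes> x))
    (at (snd c p)) (field_in_chart \<A> c X (snd c p))"
  using derivative_chart_rep_comp[OF smooth_map_ident smooth_left_mult chart_at(1) assms(1) chart_at(1)
      chart_at(2) assms(2), of "inv p" \<one> "X p"] chart_at(2)
  unfolding field_in_chart_apply[OF assms] to_lie_algebra_def left_transl_def tangent_map_eq coord_at_def
  by simp

text \<open>Near a given point, \<open>to_lie_algebra p (X p)\<close> is a partial derivative of the smooth map sending
\<open>(p, q)\<close> to \<open>inv p \<otimes> q\<close>, with base point and direction depending smoothly on \<open>p\<close>. These are the
coefficients of \<open>X\<close> in a global left-invariant frame, so no bump functions are needed for tensoriality.\<close>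

lemma smooth_to_lie_algebra_component:
  assumes X: "smooth_field \<A> X"
  shows "smooth_fun \<A> (\<lambda>p. to_lie_algebra p (X p) \<bullet> i)"
proof (rule smooth_funI)
  let ?c1 = "chart_at \<A> \<one>"
  fix c assume c: "c \<in> \<A>"
  let ?F = "\<lambda>x. frechet_derivative (chart_rep c ?c1 (\<lambda>y. inv (chart_inv c x) \<otimes> y)) (at x) (field_in_chart \<A> c X x)"
  have "smooth_on (snd c ` fst c) ?F"
  proof (rule smooth_on_local)
    fix x0 assume x0: "x0 \<in> snd c ` fst c"
    \<comment> \<open>No single chart contains all inverses, so smoothness is checked near each point \<open>x0\<close>.\<close>
    define d where "d = chart_at \<A> (inv (chart_inv c x0))"
    have d: "d \<in> \<A>" "inv (chart_inv c x0) \<in> fst d" unfolding d_def by (rule chart_at)+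
    let ?V = "snd c ` (fst c \<inter> (\<lambda>x. inv x) -` fst d)"
    let ?\<nu> = "chart_rep c d (\<lambda>x. inv x)"
    have V: "open ?V" by (rule open_rep_domain[OF smooth_inv c d(1)])
    have sub: "(?\<nu> x, x) \<in> mult_domain d c ?c1" and inv: "chart_inv d (?\<nu> x) = inv (chart_inv c x)"
      if "x \<in> ?V" for x
      using that c d chart_at(2)[of \<one>]
      by (auto simp: mult_domain_def chart_rep_def chart_inv_chart)
    have "smooth_on ?V (\<lambda>x. frechet_derivative (mult_rep d c ?c1) (at (?\<nu> x, x)) (0, field_in_chart \<A> c X x))"
    proof (rule smooth_on_derivative_along[OF V smooth_mult_rep[OF d(1) c chart_at(1)]])
      show "smooth_on ?V (\<lambda>x. (?\<nu> x, x))"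
        by (intro smooth_on_Pair V smooth_chart_rep[OF smooth_inv c d(1)] smooth_on_ident)
      show "(\<lambda>x. (?\<nu> x, x)) ` ?V \<subseteq> mult_domain d c ?c1" using sub by blast
      have "smooth_on ?V (field_in_chart \<A> c X)"
        using X c unfolding smooth_field_def by (auto intro: smooth_on_subset)
      then show "smooth_on ?V (\<lambda>x. (0, field_in_chart \<A> c X x))"
        by (intro smooth_on_Pair V smooth_on_const)
    qed
    then have "smooth_on ?V ?F"
    proof (rule smooth_on_cong[OF V, rotated])
      fix x assume x: "x \<in> ?V"
      show "frechet_derivative (mult_rep d c ?c1) (at (?\<nu> x, x)) (0, field_in_chart \<A> c X x) = ?F x"
        unfolding chart_rep_left_mult[OF inv[OF x]]
        by (rule partial_derivative_snd[OF smooth_mult_rep[OF d(1) c chart_at(1)] sub[OF x], symmetric])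
    qed
    moreover have "x0 \<in> ?V" using x0 d c by (auto simp: chart_inv_chart)
    ultimately show "\<exists>V. open V \<and> x0 \<in> V \<and> smooth_on V ?F" using V by blast
  qed
  then show "smooth_on (snd c ` fst c) (\<lambda>x. ?F x \<bullet> i)"
    by (intro smooth_on_inner smooth_on_const chart_image_open c)
  fix p assume p: "p \<in> fst c"
  show "to_lie_algebra p (X p) \<bullet> i = ?F (snd c p) \<bullet> i"
    unfolding to_lie_algebra_in_chart[OF c p] chart_inv_chart[OF c p] ..
qed

text \<open>Left translation by \<open>a\<close> relates every left-invariant field near the identity to itself near \<open>a\<close>,
hence so are the brackets of two of them.\<close>

lemma lie_bracket_left_inv_field:
  "lie_bracket \<A> (left_inv_field G \<A> u) (left_inv_field G \<A> v) a = left_inv_field G \<A> (lie_alg_bracket G \<A> u v) a"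
proof -
  let ?c = "chart_at \<A> \<one>" and ?d = "chart_at \<A> a" and ?x = "coord_at \<A> \<one>"
  let ?L = "chart_rep ?c ?d (\<lambda>x. a \<otimes> x)"
  let ?U = "snd ?c ` (fst ?c \<inter> (\<lambda>x. a \<otimes> x) -` fst ?d)"
  let ?V = "snd ?d ` fst ?d"
  have U: "open ?U" by (rule open_rep_domain[OF smooth_left_mult chart_at(1) chart_at(1)])
  have x: "?x \<in> ?U" unfolding coord_at_def using chart_at by auto
  have Lx: "?L ?x = coord_at \<A> a"
    unfolding coord_at_def using chart_rep_apply[OF chart_at, of "\<one>" ?d "\<lambda>x. a \<otimes> x"] by simp
  have smU: "smooth_on ?U (field_in_chart \<A> ?c (left_inv_field G \<A> w))"
    and smV: "smooth_on ?V (field_in_chart \<A> ?d (left_inv_field G \<A> w))" for w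
    using smooth_left_inv_field[of w] chart_at(1) unfolding smooth_field_def
    by (auto intro: smooth_on_subset)
  have LU: "?L ` ?U \<subseteq> ?V" by (auto simp: chart_rep_apply chart_at)
  have rel: "field_in_chart \<A> ?d (left_inv_field G \<A> w) (?L y)
      = frechet_derivative ?L (at y) (field_in_chart \<A> ?c (left_inv_field G \<A> w) y)"
    if y: "y \<in> ?U" for y w
  proof -
    obtain p where p: "p \<in> fst ?c" "a \<otimes> p \<in> fst ?d" "y = snd ?c p"
      using y by auto
    have L: "?L (snd ?c p) = snd ?d (a \<otimes> p)" using p by (simp add: chart_rep_apply chart_at)
    have comp: "(\<lambda>x. a \<otimes> (p \<otimes> x)) = (\<lambda>x. (a \<otimes> p) \<otimes> x)" by (simp add: mult_assoc)
    show ?thesis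
      unfolding p(3) L field_in_chart_left_inv_field[OF chart_at(1) p(2)]
        field_in_chart_left_inv_field[OF chart_at(1) p(1)]
      using derivative_chart_rep_comp[OF smooth_left_mult smooth_left_mult chart_at(1) chart_at(1) chart_at(1)
          chart_at(2), of p \<one> \<one> a a w] p
      by (simp add: comp coord_at_def)
  qed
  have tm: "left_inv_field G \<A> w a = frechet_derivative ?L (at ?x) w" for w
    unfolding left_inv_field_def left_transl_def tangent_map_eq by simp
  show ?thesis
    unfolding lie_alg_bracket_def lie_bracket_def Let_def tm Lx[symmetric]
    by (rule bracket_of_related_fields[OF U x smooth_chart_rep[OF smooth_left_mult chart_at(1) chart_at(1)]
        smU smU smV smV LU]) (simp_all only: rel)
qed

end

section \<open>Orthonormal bases and traces\<close>

locale inner_product_space =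
  fixes g :: "'e::euclidean_space \<Rightarrow> 'e \<Rightarrow> real"
  assumes inner_product: "inner_product g"
begin

lemma linear_left: "linear (\<lambda>x. g x y)" and linear_right: "linear (g x)"
  using inner_product unfolding inner_product_def bilinear_def by auto

lemma g_sym: "g x y = g y x"
  using inner_product unfolding inner_product_def by blast

lemma g_pos: "x \<noteq> 0 \<Longrightarrow> 0 < g x x"
  using inner_product unfolding inner_product_def by blast

lemmas g_simps [simp] =
  linear_add[OF linear_left] linear_add[OF linear_right]
  linear_diff[OF linear_left] linear_diff[OF linear_right]
  linear_neg[OF linear_left] linear_neg[OF linear_right]
  linear_cmul[OF linear_left, simplified] linear_cmul[OF linear_right, simplified]
  linear_0[OF linear_left] linear_0[OF linear_right]

lemmas g_sum = linear_sum[OF linear_left] linear_sum[OF linear_right]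

lemma g_nonneg: "0 \<le> g x x"
  using g_pos[of x] by (cases "x = 0") auto

lemma g_eq_0_iff [simp]: "g x x = 0 \<longleftrightarrow> x = 0"
  using g_pos[of x] by (cases "x = 0") auto

text \<open>The difference of the two vectors lies in \<open>W\<close>, so it may be tested against itself.\<close>

lemma g_extensionality: "subspace W \<Longrightarrow> x \<in> W \<Longrightarrow> y \<in> W \<Longrightarrow> (\<And>z. z \<in> W \<Longrightarrow> g x z = g y z) \<Longrightarrow> x = y"
proof -
  assume W: "subspace W" "x \<in> W" "y \<in> W" and eq: "\<And>z. z \<in> W \<Longrightarrow> g x z = g y z"
  have "g (x - y) (x - y) = g x (x - y) - g y (x - y)" by (simp only: linear_diff[OF linear_left])
  also have "\<dots> = 0" unfolding eq[OF subspace_diff[OF W]] by (rule diff_self)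
  finally have "x - y = 0" by (simp only: g_eq_0_iff)
  then show "x = y" by simp
qed

definition orthonormal_basis :: "'e set \<Rightarrow> 'e set \<Rightarrow> bool" where
  "orthonormal_basis W E \<longleftrightarrow> finite E \<and> span E = W \<and> (\<forall>u\<in>E. \<forall>v\<in>E. g u v = (if u = v then 1 else 0))"

lemma orthonormal_coeff:
  assumes "finite E" "\<forall>u\<in>E. \<forall>v\<in>E. g u v = (if u = v then 1 else 0)" "e \<in> E"
  shows "g (\<Sum>f\<in>E. c f *\<^sub>R f) e = c e"
proof -
  have "g (\<Sum>f\<in>E. c f *\<^sub>R f) e = (\<Sum>f\<in>E. if f = e then c f else 0)"
    unfolding g_sum using assms by (intro sum.cong) auto
  then show ?thesis using assms by simp
qed

lemma orthonormal_independent: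
  assumes "\<forall>u\<in>E. \<forall>v\<in>E. g u v = (if u = v then 1 else 0)"
  shows "independent E"
  unfolding independent_explicit_finite_subsets
proof (intro allI impI ballI)
  fix F c v assume F: "F \<subseteq> E" "finite F" "(\<Sum>v\<in>F. c v *\<^sub>R v) = 0" "v \<in> F"
  then show "c v = 0" using orthonormal_coeff[of F v c] assms by (simp add: subset_iff)
qed

lemma orthonormal_basis_expansion:
  assumes "orthonormal_basis W E" "x \<in> W"
  shows "x = (\<Sum>e\<in>E. g x e *\<^sub>R e)"
proof -
  have fin: "finite E" and on: "\<forall>u\<in>E. \<forall>v\<in>E. g u v = (if u = v then 1 else 0)" and "x \<in> span E"
    using assms unfolding orthonormal_basis_def by auto
  then obtain c where "x = (\<Sum>f\<in>E. c f *\<^sub>R f)" unfolding span_finite[OF fin] by auto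
  then show ?thesis using orthonormal_coeff[OF fin on] by simp
qed

lemma orthonormal_basis_functional:
  assumes "orthonormal_basis W E" "x \<in> W" "linear \<phi>"
  shows "(\<Sum>e\<in>E. g x e *\<^sub>R \<phi> e) = \<phi> x"
proof -
  have "\<phi> x = \<phi> (\<Sum>e\<in>E. g x e *\<^sub>R e)" using orthonormal_basis_expansion[OF assms(1,2)] by simp
  then show ?thesis by (simp add: linear_sum[OF assms(3)] linear_cmul[OF assms(3)])
qed

lemma orthonormal_basis_card: "orthonormal_basis W E \<Longrightarrow> card E = dim W"
  unfolding orthonormal_basis_def using orthonormal_independent dim_span dim_eq_card_independent by metis

lemma orthonormal_basis_exists:
  assumes "subspace W" obtains E where "orthonormal_basis W E"
proof -
  obtain B where B: "B \<subseteq> W" "independent B" "span B = W"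
    using basis_exists[of W] span_minimal[OF _ assms] by (metis subset_antisym)
  have "finite B" using B(2) finiteI_independent by blast
  then have "\<exists>E. orthonormal_basis (span B) E"
  proof (induction B)
    case empty
    have "orthonormal_basis (span {}) {}" unfolding orthonormal_basis_def by simp
    then show ?case by blast
  next
    case (insert b B)
    then obtain E where E: "orthonormal_basis (span B) E" by blast
    then have fin: "finite E" and sp: "span E = span B"
      and on: "\<forall>u\<in>E. \<forall>v\<in>E. g u v = (if u = v then 1 else 0)"
      unfolding orthonormal_basis_def by auto
    define p where "p = (\<Sum>e\<in>E. g b e *\<^sub>R e)"
    have p: "p \<in> span E" unfolding p_def by (intro span_sum span_mul span_base)
    define r where "r = b - p"
    have r: "g r e = 0" if "e \<in> E" for e
      unfolding r_def p_def using orthonormal_coeff[OF fin on that] by simp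
    show ?case
    proof (cases "r = 0")
      case True
      then have "b \<in> span B" using p sp unfolding r_def by simp
      then have "span (insert b B) = span B" by (rule span_redundant)
      then show ?thesis using E by auto
    next
      case False
      define e where "e = (1 / sqrt (g r r)) *\<^sub>R r"
      have pos: "0 < g r r" by (rule g_pos[OF False])
      have ee: "g e e = 1" unfolding e_def using pos False by (simp add: field_simps)
      have eE: "g e f = 0" "g f e = 0" if "f \<in> E" for f
        using r[OF that] g_sym[of f e] unfolding e_def by auto
      \<comment> \<open>The Gram-Schmidt step: subtract the projection to the span so far and normalise.\<close>
      have be: "b = sqrt (g r r) *\<^sub>R e + p" unfolding e_def r_def[symmetric] using pos by (simp add: r_def)
      have "span (insert e E) = span (insert b B)"
        unfolding span_eq
      proof (intro conjI subsetI)
        fix x assume "x \<in> insert e E"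
        then consider "x = e" | "x \<in> E" by auto
        then show "x \<in> span (insert b B)"
        proof cases
          case 1
          have "p \<in> span (insert b B)" using p sp span_mono[of B "insert b B"] by auto
          moreover have "b \<in> span (insert b B)" by (intro span_base) simp
          ultimately show ?thesis unfolding 1 e_def r_def by (intro span_mul span_diff)
        next
          case 2
          then have "x \<in> span B" using sp span_base by blast
          then show ?thesis using span_mono[of B "insert b B"] by auto
        qed
      next
        fix x assume "x \<in> insert b B"
        then consider "x = b" | "x \<in> B" by auto
        then show "x \<in> span (insert e E)"
        proof cases
          case 1
          have "p \<in> span (insert e E)" using p span_mono[of E "insert e E"] by auto
          moreover have "e \<in> span (insert e E)" by (intro span_base) simp
          ultimately show ?thesis unfolding 1 by (subst be) (intro span_add span_mul)
        next
          case 2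
          then have "x \<in> span E" using sp span_base by blast
          then show ?thesis using span_mono[of E "insert e E"] by auto
        qed
      qed
      then have "orthonormal_basis (span (insert b B)) (insert e E)"
        unfolding orthonormal_basis_def using fin on ee eE by auto
      then show ?thesis by blast
    qed
  qed
  then show ?thesis using that B(3) by auto
qed

text \<open>The trace is defined with an arbitrary basis. Inserting the expansion of that basis in the
orthonormal one and exchanging the sums gives the metric formula. Linearity is only assumed on
\<open>W\<close>, since nothing is known about the map elsewhere.\<close>

lemma trace_on_orthonormal_basis:
  assumes E: "orthonormal_basis W E" and W: "subspace W"
    and mem: "\<And>x. x \<in> W \<Longrightarrow> L x \<in> W"
    and add: "\<And>x y. x \<in> W \<Longrightarrow> y \<in> W \<Longrightarrow> L (x + y) = L x + L y"
    and scale: "\<And>c x. x \<in> W \<Longrightarrow> L (c *\<^sub>R x) = c *\<^sub>R L x"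
  shows "trace_on W L = (\<Sum>e\<in>E. g (L e) e)"
proof -
  have fin: "finite E" and EW: "E \<subseteq> W" and on: "\<forall>u\<in>E. \<forall>v\<in>E. g u v = (if u = v then 1 else 0)"
    using E span_superset unfolding orthonormal_basis_def by auto
  define B where "B = (SOME B. B \<subseteq> W \<and> independent B \<and> span B = W)"
  have "\<exists>B. B \<subseteq> W \<and> independent B \<and> span B = W"
    using basis_exists[of W] span_minimal[OF _ W] by (metis subset_antisym)
  then have "B \<subseteq> W \<and> independent B \<and> span B = W"
    unfolding B_def by (rule someI_ex)
  then have B: "B \<subseteq> W" "independent B" "span B = W" by auto
  then have "finite B" using finiteI_independent by blast
  have L_sum: "L (\<Sum>b\<in>I. c b *\<^sub>R b) = (\<Sum>b\<in>I. c b *\<^sub>R L b)" if "finite I" "I \<subseteq> W" for I c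
    using that
  proof (induction I)
    case empty
    then show ?case using scale[OF subspace_0[OF W], of 0] by simp
  next
    case (insert b I)
    then have "(\<Sum>b\<in>I. c b *\<^sub>R b) \<in> W" "c b *\<^sub>R b \<in> W"
      using W by (auto intro!: subspace_sum subspace_scale)
    then show ?case using insert by (simp add: add scale)
  qed
  let ?r = "representation B"
  have rep_L: "?r (L b) b = (\<Sum>e\<in>E. g (L b) e * ?r e b)" if "b \<in> B" for b
  proof -
    have "L b \<in> W" using mem that B by blast
    then have "?r (L b) = ?r (\<Sum>e\<in>E. g (L b) e *\<^sub>R e)"
      using orthonormal_basis_expansion[OF E] by simp
    also have "\<dots> = (\<lambda>b'. \<Sum>e\<in>E. ?r (g (L b) e *\<^sub>R e) b')"
      using EW B(3) W by (intro representation_sum[OF B(2)]) (auto intro: subspace_scale)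
    finally have "?r (L b) b = (\<Sum>e\<in>E. ?r (g (L b) e *\<^sub>R e) b)" by metis
    also have "\<dots> = (\<Sum>e\<in>E. g (L b) e * ?r e b)"
      using EW B(3) by (intro sum.cong refl) (simp add: representation_scale[OF B(2)] subset_iff)
    finally show ?thesis .
  qed
  have expand: "(\<Sum>b\<in>B. ?r e b *\<^sub>R b) = e" if "e \<in> E" for e
    using sum_representation_eq[OF B(2) _ \<open>finite B\<close> subset_refl] EW B(3) that by auto
  have "trace_on W L = (\<Sum>b\<in>B. ?r (L b) b)"
    unfolding trace_on_def Let_def B_def[symmetric] ..
  also have "\<dots> = (\<Sum>b\<in>B. \<Sum>e\<in>E. g (L b) e * ?r e b)" by (intro sum.cong refl rep_L)
  also have "\<dots> = (\<Sum>e\<in>E. \<Sum>b\<in>B. g (L b) e * ?r e b)" by (rule sum.swap)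
  also have "\<dots> = (\<Sum>e\<in>E. g (L (\<Sum>b\<in>B. ?r e b *\<^sub>R b)) e)"
    unfolding L_sum[OF \<open>finite B\<close> B(1)] g_sum by (simp add: mult.commute)
  also have "\<dots> = (\<Sum>e\<in>E. g (L e) e)" by (simp add: expand)
  finally show ?thesis .
qed

text \<open>A multiple of the metric has the multiple of the dimension as its trace; conversely a bilinear form
without trace-free part is its normalised trace times the metric.\<close>

lemma trace_free_part_eq_0_iff:
  "(\<forall>u v. trace_free_part g \<beta> u v = 0) \<longleftrightarrow> (\<exists>l. \<forall>u v. \<beta> u v = l * g u v)"
proof
  assume "\<forall>u v. trace_free_part g \<beta> u v = 0"
  then show "\<exists>l. \<forall>u v. \<beta> u v = l * g u v"
    unfolding trace_free_part_def by (intro exI[of _ "metric_trace g \<beta> / real DIM('e)"]) auto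
next
  assume "\<exists>l. \<forall>u v. \<beta> u v = l * g u v"
  then obtain l where l: "\<And>u v. \<beta> u v = l * g u v" by blast
  let ?P = "\<lambda>E. span E = UNIV \<and> (\<forall>u\<in>E. \<forall>v\<in>E. g u v = (if u = v then 1 else 0))"
  define E where "E = (SOME E. ?P E)"
  obtain E0 where "orthonormal_basis UNIV E0" using orthonormal_basis_exists[OF subspace_UNIV] by blast
  then have "?P E0" unfolding orthonormal_basis_def by blast
  then have PE: "?P E" unfolding E_def by (rule someI)
  then have "independent E" by (intro orthonormal_independent) blast
  then have "finite E" using finiteI_independent by blast
  then have "orthonormal_basis UNIV E" using PE unfolding orthonormal_basis_def by blast
  then have "card E = DIM('e)" using orthonormal_basis_card by auto
  moreover have "metric_trace g \<beta> = (\<Sum>e\<in>E. l)"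
    unfolding metric_trace_def Let_def E_def[symmetric] l using PE by (intro sum.cong) auto
  ultimately have "metric_trace g \<beta> = real DIM('e) * l" by simp
  then show "\<forall>u v. trace_free_part g \<beta> u v = 0" unfolding trace_free_part_def l by simp
qed

end

section \<open>Ricci forms of products on an inner product space\<close>

text \<open>The curvature of a connection for which the covariant derivatives of left-invariant fields are the
left-invariant fields given by the product \<open>L\<close>; the bracket is \<open>L u z - L z u\<close> because the
connection is torsion-free.\<close>

definition curvature_op :: "('e \<Rightarrow> 'e \<Rightarrow> 'e) \<Rightarrow> 'e \<Rightarrow> 'e \<Rightarrow> 'e \<Rightarrow> 'e::real_vector" where
  "curvature_op L u z v = L (L u z - L z u) v - L u (L z v) + L z (L u v)"

context inner_product_space
begin

definition ricci_form :: "'e set \<Rightarrow> ('e \<Rightarrow> 'e \<Rightarrow> 'e) \<Rightarrow> 'e \<Rightarrow> 'e \<Rightarrow> real" where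
  "ricci_form E L u v = (\<Sum>e\<in>E. g (curvature_op L u e v) e)"

text \<open>The product of the Weyl connection with Lee vector \<open>t\<close>, when \<open>L\<close> is that of the Levi-Civita
connection.\<close>

definition weyl_op :: "('e \<Rightarrow> 'e \<Rightarrow> 'e) \<Rightarrow> 'e \<Rightarrow> 'e \<Rightarrow> 'e \<Rightarrow> 'e" where
  "weyl_op L t u v = L u v + g t u *\<^sub>R v + g t v *\<^sub>R u - g u v *\<^sub>R t"

lemma orthonormal_basis_sum_mult:
  assumes "orthonormal_basis UNIV E" "linear \<phi>"
  shows "(\<Sum>e\<in>E. g x e * \<phi> e) = \<phi> x" "(\<Sum>e\<in>E. \<phi> e * g x e) = \<phi> x"
proof -
  show "(\<Sum>e\<in>E. g x e * \<phi> e) = \<phi> x"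
    using orthonormal_basis_functional[OF assms(1) UNIV_I assms(2)] by simp
  then show "(\<Sum>e\<in>E. \<phi> e * g x e) = \<phi> x" by (simp add: mult.commute)
qed

lemma orthonormal_basis_sum_norm:
  assumes "orthonormal_basis W E"
  shows "(\<Sum>e\<in>E. g e e) = real (dim W)"
proof -
  have "(\<Sum>e\<in>E. g e e) = (\<Sum>e\<in>E. 1)"
    using assms unfolding orthonormal_basis_def by (intro sum.cong) auto
  then show ?thesis using orthonormal_basis_card[OF assms] by simp
qed

text \<open>The conformal change of the Ricci tensor. Here \<open>g t (L u v)\<close> is minus the covariant derivative of
the Lee form. After expansion every summand is a multiple of some \<open>g x e * \<phi> e\<close> with \<open>\<phi>\<close> linear,
which sums to \<open>\<phi> x\<close>, or of \<open>g e e\<close>, which sums to the dimension, except for \<open>g (L e t) e\<close>, which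
only contributes to \<open>\<mu>\<close>. The terms in \<open>L u t\<close> and \<open>L t u\<close>
cancel by skewness.\<close>

lemma ricci_form_weyl_op:
  assumes E: "orthonormal_basis UNIV E" and L: "bilinear L"
    and skew: "\<And>u v w. g (L u v) w = - g v (L u w)"
  shows "\<exists>\<mu>. \<forall>u v. ricci_form E (weyl_op L t) u v = ricci_form E L u v
    + (real DIM('e) - 2) * (g t (L u v) + g t u * g t v) + g t (L u v - L v u) + \<mu> * g u v"
proof (intro exI allI)
  fix u v
  have lin1: "linear (\<lambda>x. L x y)" and lin2: "linear (L y)" for y
    using L unfolding bilinear_def by auto
  note L_simps = linear_add[OF lin1] linear_add[OF lin2] linear_diff[OF lin1] linear_diff[OF lin2]
    linear_cmul[OF lin1] linear_cmul[OF lin2]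
  have lg: "linear (\<lambda>e. g w (L u' e))" "linear (\<lambda>e. g w (L e v'))" "linear (\<lambda>e. g (L u' e) w)"
    "linear (\<lambda>e. g (L e v') w)" for w u' v'
    using linear_compose[OF lin2 linear_right] linear_compose[OF lin1 linear_right]
      linear_compose[OF lin2 linear_left] linear_compose[OF lin1 linear_left]
    by (simp_all add: o_def)
  have pt: "g (curvature_op (weyl_op L t) u e v) e = g (curvature_op L u e v) e
     + (g v e * g t (L u e) - g v e * g t (L e u) - g t e * g (L u e) v + g t e * g (L e u) v
     - g u e * g t (L e v) + g t e * g u (L e v) - g t e * g (L u v) e
     - g t u * (g t e * g v e) - g t v * (g t e * g u e) + g u v * (g t e * g t e)
     + g v e * g (L u t) e + g t t * (g u e * g v e) + (g t (L u v) + g t u * g t v - g u v * g t t) * g e e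
     - g u v * g (L e t) e)" for e
  proof -
    have z: "g (L u e) e = 0" using skew[of u e e] g_sym[of "L u e" e] by simp
    have s: "g e v = g v e" "g e u = g u e" "g e t = g t e" "g u t = g t u" "g v t = g t v"
      "g e (L u v) = g (L u v) e" "g e (L e v) = g (L e v) e" "g e (L e u) = g (L e u) e"
      using g_sym by auto
    show ?thesis
      unfolding curvature_op_def weyl_op_def L_simps
      by (simp add: s z) (simp add: algebra_simps z s)
  qed
  have sw: "(\<Sum>e\<in>E. g v e * g t (L u e)) = g t (L u v)" "(\<Sum>e\<in>E. g v e * g t (L e u)) = g t (L v u)"
     "(\<Sum>e\<in>E. g t e * g (L u e) v) = g (L u t) v" "(\<Sum>e\<in>E. g t e * g (L e u) v) = g (L t u) v"
     "(\<Sum>e\<in>E. g u e * g t (L e v)) = g t (L u v)" "(\<Sum>e\<in>E. g t e * g u (L e v)) = g u (L t v)"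
     "(\<Sum>e\<in>E. g t e * g (L u v) e) = g (L u v) t" "(\<Sum>e\<in>E. g t e * g v e) = g v t"
     "(\<Sum>e\<in>E. g t e * g u e) = g u t" "(\<Sum>e\<in>E. g t e * g t e) = g t t"
     "(\<Sum>e\<in>E. g v e * g (L u t) e) = g (L u t) v" "(\<Sum>e\<in>E. g u e * g v e) = g v u"
    by (intro orthonormal_basis_sum_mult[OF E] lg linear_right)+
  show "ricci_form E (weyl_op L t) u v = ricci_form E L u v
    + (real DIM('e) - 2) * (g t (L u v) + g t u * g t v) + g t (L u v - L v u)
    + ((2 - real DIM('e)) * g t t - (\<Sum>e\<in>E. g (L e t) e)) * g u v"
    unfolding ricci_form_def pt sum.distrib sum_subtractf sum_distrib_left[symmetric] sw
      orthonormal_basis_sum_norm[OF E]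
    using g_sym[of u v] g_sym[of t u] g_sym[of t v] g_sym[of "L u v" t] skew[of t u v]
    by (simp add: algebra_simps)
qed

definition trace_in :: "'e set \<Rightarrow> ('e \<Rightarrow> 'e) \<Rightarrow> real" where
  "trace_in E M = (\<Sum>e\<in>E. g (M e) e)"

lemma trace_in_comm:
  assumes E: "orthonormal_basis UNIV E" and "linear M" "linear N"
  shows "trace_in E (\<lambda>x. M (N x)) = trace_in E (\<lambda>x. N (M x))"
proof -
  have expand: "g (M (N x)) x = (\<Sum>f\<in>E. g (N x) f * g (M f) x)" if "linear M" for M N :: "'e \<Rightarrow> 'e" and x
    using orthonormal_basis_sum_mult(1)[OF E, of "\<lambda>f. g (M f) x" "N x"]
      linear_compose[OF that linear_left] by (simp add: o_def)
  show ?thesis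
    unfolding trace_in_def expand[OF assms(2), of N] expand[OF assms(3), of M]
    by (subst sum.swap) (simp add: mult.commute)
qed

text \<open>Transposition changes \<open>A S\<close> into \<open>- S A\<close> and preserves the trace, while cyclicity identifies the
traces of \<open>A S\<close> and \<open>S A\<close>.\<close>

lemma trace_in_skew_sym:
  assumes E: "orthonormal_basis UNIV E" and "linear A" "linear S"
    and A: "\<And>x y. g (A x) y = - g x (A y)" and S: "\<And>x y. g (S x) y = g x (S y)"
  shows "trace_in E (\<lambda>x. A (S x)) = 0" "trace_in E (\<lambda>x. S (A x)) = 0"
proof -
  have pt: "g (A (S x)) x = - g (S (A x)) x" for x
    using A[of "S x" x] S[of "A x" x] g_sym[of "S x" "A x"] by simp
  have "trace_in E (\<lambda>x. A (S x)) = - trace_in E (\<lambda>x. S (A x))"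
    unfolding trace_in_def by (simp add: pt sum_negf)
  then show "trace_in E (\<lambda>x. A (S x)) = 0" "trace_in E (\<lambda>x. S (A x)) = 0"
    using trace_in_comm[OF assms(1-3)] by simp_all
qed

text \<open>The product is the Levi-Civita product of an almost abelian Lie algebra. The maps \<open>A\<close> and \<open>S\<close> act on
the whole algebra and vanish on \<open>b\<close>, so that no case distinction between \<open>b\<close> and the ideal is
needed.\<close>

lemma ricci_form_almost_abelian:
  assumes E: "orthonormal_basis UNIV E" and lin: "linear A" "linear S"
    and A: "\<And>x y. g (A x) y = - g x (A y)" and S: "\<And>x y. g (S x) y = g x (S y)"
    and b: "g b b = 1" "A b = 0" "S b = 0"
  shows "ricci_form E (\<lambda>u v. g b u *\<^sub>R A v - g b v *\<^sub>R S u + g (S u) v *\<^sub>R b) u v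
    = g (A (S u) - S (A u)) v - trace_in E S * g (S u) v - trace_in E (\<lambda>x. S (S x)) * (g b u * g b v)"
proof -
  let ?L = "\<lambda>u v. g b u *\<^sub>R A v - g b v *\<^sub>R S u + g (S u) v *\<^sub>R b"
  note l = linear_add[OF lin(1)] linear_add[OF lin(2)] linear_diff[OF lin(1)] linear_diff[OF lin(2)]
    linear_cmul[OF lin(1)] linear_cmul[OF lin(2)] linear_0[OF lin(1)] linear_0[OF lin(2)]
  have bA: "g b (A x) = 0" and bS: "g b (S x) = 0" for x
    using A[of b x] S[of b x] b by auto
  have c: "g (S x) b = 0" "g (A x) b = 0" for x
    using bA bS g_sym by metis+
  have pt: "g (curvature_op ?L u e v) e =
     - g b u * g b v * (g (S (A e)) e + g (S (S e)) e) + g b u * g b v * g (A (S e)) e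
     + g b v * (g b e * g (S (A u + S u)) e)
     + g b u * (g b e * g (S (A e + S e)) v) - g (S (A u + S u)) v * (g b e * g b e)
     - g b u * (g b e * g (A (A v)) e) + g (S v) e * g (S u) e
     - (g b e * g b e) * g (S u) (A v) + g b v * (g b e * g (S (S u)) e)
     + g b e * g (A (?L u v)) e - g (S u) v * g (S e) e + g b e * g (S e) (?L u v)" for e
  proof -
    have s: "g e b = g b e" "g e (S v) = g (S v) e" "g e (S u) = g (S u) e" "g (S e) v = g (S v) e"
      "g (S e) (S u) = g (S (S u)) e" "g (S u) (S e) = g (S (S u)) e" "g (S e) u = g (S u) e"
      using g_sym S by metis+
    show ?thesis
      unfolding curvature_op_def
      by (simp add: l b bA bS c s) (simp add: algebra_simps s)
  qed
  have lg: "linear (\<lambda>e. g (S (A e + S e)) w)" "linear (\<lambda>e. g (S e) w)" for w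
    by (rule linearI; simp add: l algebra_simps)+
  have sw: "(\<Sum>e\<in>E. g b e * g x e) = g x b" "(\<Sum>e\<in>E. g b e * g (S (A e + S e)) w) = g (S (A b + S b)) w"
    "(\<Sum>e\<in>E. g (S v) e * g (S u) e) = g (S u) (S v)" "(\<Sum>e\<in>E. g b e * g (S e) w) = g (S b) w"
    for x w
    by (intro orthonormal_basis_sum_mult[OF E] lg linear_right)+
  have z: "(\<Sum>e\<in>E. g (A (S e)) e) = 0" "(\<Sum>e\<in>E. g (S (A e)) e) = 0"
    using trace_in_skew_sym[OF E lin A S] unfolding trace_in_def by auto
  have "ricci_form E ?L u v = - g b u * g b v * trace_in E (\<lambda>x. S (S x)) - g (S (A u + S u)) v
     + g (S u) (S v) - g (S u) (A v) - g (S u) v * trace_in E S"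
    unfolding ricci_form_def pt sum.distrib sum_subtractf sum_distrib_left[symmetric] sum_distrib_right[symmetric] sw z
      trace_in_def
    by (simp add: b c l)
  also have "g (S u) (S v) = g (S (S u)) v" using S[of "S u" v] by simp
  also have "g (S u) (A v) = - g (A (S u)) v" using A by simp
  finally show ?thesis by (simp add: l algebra_simps)
qed

end

section \<open>The Weyl-Einstein equation on an almost abelian Lie algebra\<close>

text \<open>The equations are homogeneous, so one may divide by powers of \<open>\<tau>\<close>. With \<open>u = s / \<tau>\<close> the first two
place \<open>m\<close> strictly between \<open>u - 1\<close> and \<open>u\<close>, whereas the third gives \<open>(u - 2)\<^sup>2 < m (u - 4)\<close>; for
\<open>m = u - \<delta>\<close> with \<open>0 < \<delta> < 1\<close> this says \<open>4 - 4 \<delta> + \<delta> u < 0\<close>.\<close>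

lemma trace_inequalities_incompatible:
  fixes m s \<tau> T X :: real
  assumes "1 \<le> m" "\<tau> \<noteq> 0" "0 < X" and T: "T = \<tau> * s - 2 * X"
    and tr: "(m * \<tau> - s) * s + m * X = (m + 1) * (m * \<tau>\<^sup>2 - T)"
    and CS: "(s - 2 * \<tau>)\<^sup>2 \<le> m * (T - 4 * \<tau>\<^sup>2)"
  shows False
proof -
  define u where "u = s / \<tau>"
  have s: "s = u * \<tau>" unfolding u_def using assms by simp
  define Y where "Y = X / \<tau>\<^sup>2"
  have X: "X = Y * \<tau>\<^sup>2" and "0 < Y" unfolding Y_def using assms by auto
  have t2: "0 < \<tau>\<^sup>2" using assms by simp
  have "\<tau>\<^sup>2 * ((m - u) * u + m * Y) = \<tau>\<^sup>2 * ((m + 1) * (m - u + 2 * Y))"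
    using tr unfolding T s X by (simp add: algebra_simps power2_eq_square)
  then have 1: "(m - u) * u + m * Y = (m + 1) * (m - u + 2 * Y)" using t2 by simp
  have "\<tau>\<^sup>2 * (u - 2)\<^sup>2 \<le> \<tau>\<^sup>2 * (m * (u - 2 * Y - 4))"
    using CS unfolding T s X by (simp add: algebra_simps power2_eq_square)
  then have 2: "(u - 2)\<^sup>2 \<le> m * (u - 2 * Y - 4)" using t2 by simp
  define \<delta> where "\<delta> = u - m"
  have u: "u = m + \<delta>" unfolding \<delta>_def by simp
  have 3: "\<delta> * (1 - \<delta>) = (m + 2) * Y" using 1 unfolding u by (simp add: algebra_simps)
  then have "0 < \<delta> * (1 - \<delta>)" using \<open>0 < Y\<close> assms by simp
  then have \<delta>: "0 < \<delta>" "\<delta> < 1" by (auto simp: zero_less_mult_iff)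
  have "0 < m * Y" using assms \<open>0 < Y\<close> by simp
  then have "(u - 2)\<^sup>2 < m * (u - 4)" using 2 by (simp add: algebra_simps)
  then have "4 - 4 * \<delta> + \<delta> * u < 0" unfolding u by (simp add: algebra_simps power2_eq_square)
  moreover have "0 \<le> \<delta> * u" unfolding u using \<delta> assms by simp
  ultimately show False using \<delta> by linarith
qed

text \<open>The almost abelian Lie algebra with ideal the orthogonal complement of \<open>b\<close>, encoded by the parts \<open>A\<close> and \<open>S\<close> of \<open>ad b\<close> extended by
zero to \<open>b\<close>; \<open>m\<close> is \<open>n - 2\<close>.\<close>

locale almost_abelian_data = inner_product_space g for g :: "'e::euclidean_space \<Rightarrow> 'e \<Rightarrow> real" +
  fixes E :: "'e set" and A S :: "'e \<Rightarrow> 'e" and b :: 'e and m :: real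
  assumes m: "1 \<le> m" and dim: "m = real DIM('e) - 2" and E: "orthonormal_basis UNIV E"
    and linA: "linear A" and linS: "linear S"
    and A: "g (A x) y = - g x (A y)" and S: "g (S x) y = g x (S y)"
    and b: "g b b = 1" and Ab: "A b = 0" and Sb: "S b = 0"
begin

abbreviation "s \<equiv> trace_in E S"
abbreviation "T \<equiv> trace_in E (\<lambda>x. S (S x))"
abbreviation "C x \<equiv> A (S x) - S (A x)"

lemma sum_norm: "(\<Sum>e\<in>E. g e e) = m + 2"
  using orthonormal_basis_sum_norm[OF E] dim by simp

lemmas lin_simps = linear_add[OF linA] linear_add[OF linS] linear_diff[OF linA] linear_diff[OF linS]
    linear_cmul[OF linA] linear_cmul[OF linS] linear_0[OF linA] linear_0[OF linS]

lemma bA: "g b (A x) = 0" "g (A x) b = 0" and bS: "g b (S x) = 0" "g (S x) b = 0"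
  using A[of b x] A[of x b] S[of b x] S[of x b] Ab Sb by auto

lemma skew_diag: "g (A x) x = 0"
  using A[of x x] g_sym[of x "A x"] by simp

lemma linear_C: "linear C"
  by (rule linearI) (simp_all add: lin_simps algebra_simps)

lemma trace_C: "(\<Sum>e\<in>E. g (C e) e) = 0"
  using trace_in_skew_sym[OF E linA linS A S] unfolding trace_in_def by (simp add: sum_subtractf)

lemma trace_CS: "(\<Sum>e\<in>E. g (C e) (S e)) = 0"
proof -
  let ?S2 = "\<lambda>x. S (S x)"
  have lin2: "linear ?S2" and sym2: "g (?S2 x) y = g x (?S2 y)" for x y
    using linear_compose[OF linS linS] by (simp_all add: o_def S)
  have lin3: "linear (\<lambda>x. A (S x))" using linear_compose[OF linS linA] by (simp add: o_def)
  have "(\<Sum>e\<in>E. g (C e) (S e)) = trace_in E (\<lambda>x. S (A (S x))) - trace_in E (\<lambda>x. ?S2 (A x))"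
    unfolding trace_in_def by (simp add: S sum_subtractf)
  moreover have "trace_in E (\<lambda>x. S (A (S x))) = trace_in E (\<lambda>x. A (?S2 x))"
    using trace_in_comm[OF E linS lin3] .
  ultimately show ?thesis using trace_in_skew_sym[OF E linA lin2 A sym2] by simp
qed

text \<open>The squared norm of \<open>S\<close> minus a combination of the projections to the complement of \<open>b\<close> and to the
line of \<open>\<xi>\<close> is nonnegative. For \<open>c = 0\<close> this is the Cauchy-Schwarz inequality between the trace of
\<open>S\<close> and that of its square; in general it also takes into account a prescribed diagonal entry of \<open>S\<close> at \<open>\<xi>\<close>.\<close>

lemma norm_deviation:
  assumes "g b \<xi> = 0"
  shows "0 \<le> T + a\<^sup>2 * (m + 1) + c\<^sup>2 * (g \<xi> \<xi>)\<^sup>2 - 2 * a * s - 2 * c * g (S \<xi>) \<xi> + 2 * a * c * g \<xi> \<xi>"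
proof -
  let ?D = "\<lambda>e. S e - a *\<^sub>R (e - g b e *\<^sub>R b) - (c * g \<xi> e) *\<^sub>R \<xi>"
  have \<xi>b: "g \<xi> b = 0" using assms g_sym by metis
  have pt: "g (?D e) (?D e) = g (S (S e)) e + a\<^sup>2 * (g e e - g b e * g b e) + c\<^sup>2 * g \<xi> \<xi> * (g \<xi> e * g \<xi> e)
      - 2 * a * g (S e) e - 2 * c * (g \<xi> e * g (S \<xi>) e) + 2 * a * c * (g \<xi> e * g \<xi> e)" for e
  proof -
    have r: "g e (S e) = g (S e) e" "g (S e) (S e) = g (S (S e)) e" "g e b = g b e" "g e \<xi> = g \<xi> e"
      "g \<xi> (S e) = g (S \<xi>) e" "g (S e) \<xi> = g (S \<xi>) e"
      using g_sym S by metis+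
    show ?thesis
      by (simp add: r bS b assms \<xi>b) (simp add: algebra_simps power2_eq_square)
  qed
  have sw: "(\<Sum>e\<in>E. g x e * g y e) = g y x" for x y
    by (intro orthonormal_basis_sum_mult[OF E] linear_right)
  have "0 \<le> (\<Sum>e\<in>E. g (?D e) (?D e))" by (intro sum_nonneg g_nonneg)
  also have "\<dots> = T + a\<^sup>2 * (m + 2 - 1) + c\<^sup>2 * g \<xi> \<xi> * g \<xi> \<xi> - 2 * a * s - 2 * c * g (S \<xi>) \<xi> + 2 * a * c * g \<xi> \<xi>"
    unfolding pt sum.distrib sum_subtractf sum_distrib_left[symmetric] sw trace_in_def
      sum_norm b by simp
  finally show ?thesis by (simp add: power2_eq_square algebra_simps)
qed

text \<open>The symmetrised Ricci form of the Weyl connection with Lee vector \<open>t\<close>, up to a multiple of \<open>g\<close>.\<close>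

definition weyl_ricci :: "'e \<Rightarrow> 'e \<Rightarrow> 'e \<Rightarrow> real" where
  "weyl_ricci t u v = g (C u) v - s * g (S u) v - T * (g b u * g b v)
     + m * (g t u * g t v + (g b u * g t (A v - S v) + g b v * g t (A u - S u)) / 2 + g b t * g (S u) v)"

definition scalar_solution :: "'e \<Rightarrow> bool" where
  "scalar_solution t \<longleftrightarrow> (\<exists>k. (\<forall>x. g b x = 0 \<longrightarrow> S x = k *\<^sub>R x) \<and> (t = 0 \<or> t = k *\<^sub>R b))"

definition commuting_solution :: "'e \<Rightarrow> bool" where
  "commuting_solution t \<longleftrightarrow> (\<exists>x. S x \<noteq> 0) \<and> s\<^sup>2 = m * T \<and> (\<forall>x. C x = 0) \<and> t = (s / m) *\<^sub>R b"

lemma scalar_case: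
  assumes "\<forall>x. g b x = 0 \<longrightarrow> S x = k *\<^sub>R x"
  shows "S u = k *\<^sub>R (u - g b u *\<^sub>R b)" "s = k * (m + 1)" "T = k\<^sup>2 * (m + 1)" "C u = 0"
proof -
  show Su: "S u = k *\<^sub>R (u - g b u *\<^sub>R b)" for u
    using assms[rule_format, of "u - g b u *\<^sub>R b"] by (simp add: b lin_simps Sb)
  have sw: "(\<Sum>e\<in>E. g b e * g b e) = 1"
    using orthonormal_basis_sum_mult(1)[OF E linear_right, of b b] b by simp
  show s: "s = k * (m + 1)"
    unfolding trace_in_def Su
    by (simp add: sum_distrib_left[symmetric] sum_subtractf sum_norm sw)
  have "T = k * s"
    unfolding trace_in_def Su[of "S e" for e] by (simp add: bS sum_distrib_left)
  then show "T = k\<^sup>2 * (m + 1)" using s by (simp add: power2_eq_square)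
  show "C u = 0" unfolding Su by (simp add: lin_simps Ab bA)
qed

lemma weyl_ricci_conformal_if:
  assumes "scalar_solution t \<or> commuting_solution t"
  shows "\<exists>l. \<forall>u v. weyl_ricci t u v = l * g u v"
  using assms
proof
  assume "scalar_solution t"
  then obtain k where k: "\<forall>x. g b x = 0 \<longrightarrow> S x = k *\<^sub>R x" and t: "t = 0 \<or> t = k *\<^sub>R b"
    unfolding scalar_solution_def by blast
  note h = scalar_case[OF k]
  from t show ?thesis
  proof
    assume t: "t = 0"
    have "weyl_ricci t u v = - (k\<^sup>2 * (m + 1)) * g u v" for u v
      unfolding weyl_ricci_def h(4) unfolding h(2,3) h(1)[of u] t by (simp add: algebra_simps power2_eq_square)
    then show ?thesis by blast
  next
    assume t: "t = k *\<^sub>R b"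
    have "weyl_ricci t u v = - k\<^sup>2 * g u v" for u v
      unfolding weyl_ricci_def h(4) unfolding h(2,3) h(1)[of u] t
      by (simp add: bA bS b) (simp add: algebra_simps power2_eq_square)
    then show ?thesis by blast
  qed
next
  assume e2: "commuting_solution t"
  then have t: "t = (s / m) *\<^sub>R b" and C: "C x = 0" and T: "s\<^sup>2 = m * T" for x
    unfolding commuting_solution_def by auto
  have ms: "m * (s / m) = s" and mT: "m * ((s / m) * (s / m)) = T"
    using m T by (simp_all add: field_simps power2_eq_square)
  have "weyl_ricci t u v = 0 * g u v" for u v
  proof -
    have "weyl_ricci t u v = (m * ((s / m) * (s / m)) - T) * (g b u * g b v) + (m * (s / m) - s) * g (S u) v"
      unfolding weyl_ricci_def C t by (simp only: g_simps bA bS b) (simp add: algebra_simps)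
    then show ?thesis unfolding ms mT by simp
  qed
  then show ?thesis by blast
qed

text \<open>Decompose \<open>t = \<tau> b + \<xi>\<close>. The entries at \<open>(b, b)\<close> and \<open>(b, v)\<close> determine the factor \<open>l\<close> and give
\<open>A \<xi> + S \<xi> = 2 \<tau> \<xi>\<close>; what remains is the equation \<open>main\<close> of symmetric endomorphisms of the complement of
\<open>b\<close>. Its trace and the trace of its product with \<open>S\<close> contradict the Cauchy-Schwarz type inequality
\<open>norm_deviation\<close> unless \<open>\<xi> = 0\<close>. Then the trace of its product with the commutator \<open>C\<close> is the squared norm
of \<open>C\<close>, so \<open>A\<close> and \<open>S\<close> commute and \<open>(m \<tau> - s) S\<close> is a multiple of the identity. For
\<open>S \<noteq> 0\<close> the two solutions correspond to \<open>m \<tau> - s\<close> being different from zero or zero.\<close>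

lemma weyl_ricci_conformal_only_if:
  assumes Q: "\<And>u v. weyl_ricci t u v = l * g u v"
  shows "scalar_solution t \<or> commuting_solution t"
proof -
  define \<tau> where "\<tau> = g b t"
  define \<xi> where "\<xi> = t - \<tau> *\<^sub>R b"
  have t: "t = \<tau> *\<^sub>R b + \<xi>" unfolding \<xi>_def by simp
  have b\<xi>: "g b \<xi> = 0" unfolding \<xi>_def \<tau>_def by (simp add: b)
  have \<xi>b: "g \<xi> b = 0" using b\<xi> g_sym by metis
  have l: "l = m * \<tau>\<^sup>2 - T"
    using Q[of b b] unfolding weyl_ricci_def by (simp add: Sb Ab lin_simps b t \<xi>b b\<xi> power2_eq_square)
  have \<xi>AS: "g \<xi> (A v - S v) = - 2 * \<tau> * g \<xi> v" for v
  proof -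
    have "m * g \<xi> (A v) + \<tau> * (m * (2 * g \<xi> v)) = m * g \<xi> (S v)"
      using Q[of b v] unfolding weyl_ricci_def l
      by (simp add: Sb Ab lin_simps b t \<xi>b b\<xi> bA bS power2_eq_square) (simp add: field_simps)
    moreover have "m * (g \<xi> (A v) + 2 * \<tau> * g \<xi> v - g \<xi> (S v))
        = m * g \<xi> (A v) + \<tau> * (m * (2 * g \<xi> v)) - m * g \<xi> (S v)"
      by (simp add: algebra_simps)
    ultimately have "m * (g \<xi> (A v) + 2 * \<tau> * g \<xi> v - g \<xi> (S v)) = 0" by simp
    then show ?thesis using m by simp
  qed
  have main: "g (C u) v + (m * \<tau> - s) * g (S u) v + m * (g \<xi> u * g \<xi> v) = l * (g u v - g b u * g b v)" for u v
  proof -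
    have "g b (A w - S w) = 0" for w by (simp add: bA bS)
    then have "g t (A v - S v) = - 2 * \<tau> * g \<xi> v" "g t (A u - S u) = - 2 * \<tau> * g \<xi> u"
      using \<xi>AS unfolding t by (simp_all del: g_simps(4))
    then have "weyl_ricci t u v = g (C u) v - s * g (S u) v - T * (g b u * g b v)
     + m * ((\<tau> * g b u + g \<xi> u) * (\<tau> * g b v + g \<xi> v)
        + (g b u * (- 2 * \<tau> * g \<xi> v) + g b v * (- 2 * \<tau> * g \<xi> u)) / 2 + \<tau> * g (S u) v)"
      unfolding weyl_ricci_def by (simp only: \<tau>_def[symmetric]) (simp add: t)
    with Q[of u v] show ?thesis unfolding l by (simp add: field_simps power2_eq_square)
  qed
  have sw: "(\<Sum>e\<in>E. g x e * g y e) = g y x" for x y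
    by (intro orthonormal_basis_sum_mult[OF E] linear_right)
  have tr: "(m * \<tau> - s) * s + m * g \<xi> \<xi> = l * (m + 1)"
  proof -
    have "(\<Sum>e\<in>E. g (C e) e + (m * \<tau> - s) * g (S e) e + m * (g \<xi> e * g \<xi> e))
        = (\<Sum>e\<in>E. l * (g e e - g b e * g b e))"
      unfolding main ..
    then show ?thesis
      unfolding sum.distrib sum_subtractf sum_distrib_left[symmetric] trace_C sw
        sum_norm b trace_in_def by simp
  qed
  have "g (A \<xi>) \<xi> + g (S \<xi>) \<xi> = 2 * \<tau> * g \<xi> \<xi>"
    using \<xi>AS[of \<xi>] A[of \<xi> \<xi>] S[of \<xi> \<xi>] by simp
  then have S\<xi>: "g (S \<xi>) \<xi> = 2 * \<tau> * g \<xi> \<xi>" by (simp add: skew_diag)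
  have trS: "\<tau> * (T + 2 * g \<xi> \<xi> - \<tau> * s) = 0"
  proof -
    have "(\<Sum>e\<in>E. g (C e) (S e) + (m * \<tau> - s) * g (S e) (S e) + m * (g \<xi> e * g \<xi> (S e)))
        = (\<Sum>e\<in>E. l * (g e (S e) - g b e * g b (S e)))"
      unfolding main ..
    moreover have "g (S e) (S e) = g (S (S e)) e" "g \<xi> (S e) = g (S \<xi>) e" "g e (S e) = g (S e) e" for e
      using S g_sym by metis+
    ultimately have "(m * \<tau> - s) * T + m * (2 * \<tau> * g \<xi> \<xi>) = l * s"
      unfolding S\<xi>[symmetric] bS mult_zero_right diff_0_right trace_in_def
      by (simp only: sum.distrib sum_distrib_left[symmetric] trace_CS sw)
    then have "m * (\<tau> * (T + 2 * g \<xi> \<xi> - \<tau> * s)) = 0"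
      unfolding l by (simp add: algebra_simps power2_eq_square)
    then show ?thesis using m by simp
  qed
  have "\<xi> = 0"
  proof (rule ccontr)
    assume "\<xi> \<noteq> 0"
    then have X: "0 < g \<xi> \<xi>" by (rule g_pos)
    show False
    proof (cases "\<tau> = 0")
      case True
      have "s\<^sup>2 = (m + 1) * T + m * g \<xi> \<xi>"
        using tr unfolding l True by (simp add: algebra_simps power2_eq_square)
      moreover have "s\<^sup>2 \<le> (m + 1) * T"
      proof -
        \<comment> \<open>The mean eigenvalue of \<open>S\<close> on the complement of \<open>b\<close>, which has dimension \<open>m + 1\<close>.\<close>
        define a where "a = s / (m + 1)"
        have a: "a * (m + 1) = s" unfolding a_def using m by simp
        have "0 \<le> (m + 1) * (T + a * (a * (m + 1)) - 2 * a * s)"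
          using norm_deviation[OF b\<xi>, of a 0] m by (simp add: power2_eq_square mult.assoc)
        also have "\<dots> = (m + 1) * T - (a * (m + 1)) * s"
          by (simp only: a) (simp add: algebra_simps flip: a)
        finally show ?thesis unfolding a by (simp add: power2_eq_square)
      qed
      ultimately show False using X m by (smt (verit) mult_pos_pos)
    next
      case False
      have T: "T = \<tau> * s - 2 * g \<xi> \<xi>" using trS False by simp
      \<comment> \<open>The minimisers of \<open>norm_deviation\<close>: then \<open>\<xi>\<close> gets the eigenvalue \<open>2 \<tau>\<close> and its complement the mean of the rest.\<close>
      define a where "a = (s - 2 * \<tau>) / m"
      define c where "c = (2 * \<tau> - a) / g \<xi> \<xi>"
      have am: "m * a = s - 2 * \<tau>" unfolding a_def using m by simp
      have cX: "c * g \<xi> \<xi> = 2 * \<tau> - a" unfolding c_def using \<open>\<xi> \<noteq> 0\<close> by simp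
      have "0 \<le> T + a\<^sup>2 * (m + 1) + (c * g \<xi> \<xi>)\<^sup>2 - 2 * a * s - 4 * \<tau> * (c * g \<xi> \<xi>) + 2 * a * (c * g \<xi> \<xi>)"
        using norm_deviation[OF b\<xi>, of a c] unfolding S\<xi> by (simp add: algebra_simps power_mult_distrib)
      also have "\<dots> = T - 4 * \<tau>\<^sup>2 + a * (m * a) - 2 * a * (s - 2 * \<tau>)"
        unfolding cX by (simp add: algebra_simps power2_eq_square)
      finally have "0 \<le> m * (T - 4 * \<tau>\<^sup>2 - a * (s - 2 * \<tau>))" using m unfolding am by simp
      also have "\<dots> = m * (T - 4 * \<tau>\<^sup>2) - (m * a) * (s - 2 * \<tau>)" by (simp add: algebra_simps)
      finally have "(s - 2 * \<tau>)\<^sup>2 \<le> m * (T - 4 * \<tau>\<^sup>2)" unfolding am by (simp add: power2_eq_square)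
      moreover have "(m * \<tau> - s) * s + m * g \<xi> \<xi> = (m + 1) * (m * \<tau>\<^sup>2 - T)"
        using tr unfolding l by (simp add: mult.commute)
      ultimately show False using trace_inequalities_incompatible[OF m False X T] by blast
    qed
  qed
  then have t\<tau>: "t = \<tau> *\<^sub>R b" using t by simp
  have main0: "g (C u) v + (m * \<tau> - s) * g (S u) v = l * (g u v - g b u * g b v)" for u v
    using main[of u v] \<open>\<xi> = 0\<close> by simp
  have C0: "C x = 0" for x
  proof -
    have "(\<Sum>e\<in>E. g (C e) (C e) + (m * \<tau> - s) * g (S e) (C e)) = (\<Sum>e\<in>E. l * (g e (C e) - g b e * g b (C e)))"
      unfolding main0 ..
    moreover have "g (S e) (C e) = g (C e) (S e)" "g e (C e) = g (C e) e" "g b (C e) = 0" for e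
      using g_sym bA bS by auto
    ultimately have "(\<Sum>e\<in>E. g (C e) (C e)) = 0"
      by (simp only: sum.distrib sum_distrib_left[symmetric] trace_CS trace_C mult_zero_right diff_0_right add_0_right)
    moreover have "finite E" using E unfolding orthonormal_basis_def by blast
    ultimately have "\<forall>e\<in>E. g (C e) (C e) = 0"
      using sum_nonneg_eq_0_iff[of E "\<lambda>e. g (C e) (C e)"] g_nonneg by blast
    then have "\<forall>e\<in>E. C e = 0" by (simp only: g_eq_0_iff)
    moreover have "(\<Sum>e\<in>E. g x e *\<^sub>R C e) = C x" by (rule orthonormal_basis_functional[OF E UNIV_I linear_C])
    ultimately show ?thesis by simp
  qed
  have vec: "(m * \<tau> - s) *\<^sub>R S u = l *\<^sub>R (u - g b u *\<^sub>R b)" for u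
    by (rule g_extensionality[OF subspace_UNIV]) (use main0[of u] C0 in \<open>auto simp: algebra_simps\<close>)
  show ?thesis
  proof (cases "m * \<tau> = s")
    case True
    then have "l = 0" using tr \<open>\<xi> = 0\<close> m by simp
    then have T: "T = m * \<tau>\<^sup>2" using l by simp
    have \<tau>: "\<tau> = s / m" using True m by (simp add: field_simps)
    show ?thesis
    proof (cases "\<exists>x. S x \<noteq> 0")
      case True
      then have "commuting_solution t"
        unfolding commuting_solution_def t\<tau> using C0 T \<tau> m by (auto simp: field_simps power2_eq_square)
      then show ?thesis ..
    next
      case False
      then have "s = 0" unfolding trace_in_def by simp
      then have "scalar_solution t" unfolding scalar_solution_def t\<tau> using False \<tau> by (intro exI[of _ 0]) simp
      then show ?thesis ..
    qed
  next
    case False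
    define k where "k = l / (m * \<tau> - s)"
    have "S x = k *\<^sub>R x" if "g b x = 0" for x
    proof -
      have "(m * \<tau> - s) *\<^sub>R S x = (m * \<tau> - s) *\<^sub>R (k *\<^sub>R x)"
        using vec[of x] that False unfolding k_def by simp
      then show ?thesis using False unfolding scaleR_cancel_left by simp
    qed
    then have k: "\<forall>x. g b x = 0 \<longrightarrow> S x = k *\<^sub>R x" by blast
    note h = scalar_case[OF k]
    have "l = k * (m * \<tau> - s)" unfolding k_def using False by simp
    then have "m * (\<tau> * (\<tau> - k)) = 0"
      unfolding l h(2,3) by (simp add: algebra_simps power2_eq_square)
    then have "\<tau> = 0 \<or> \<tau> = k" using m by simp
    then have "scalar_solution t" unfolding scalar_solution_def t\<tau> using k by (intro exI[of _ k]) auto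
    then show ?thesis ..
  qed
qed

lemma solutions_exclusive: "\<not> (scalar_solution t \<and> commuting_solution t)"
proof
  assume "scalar_solution t \<and> commuting_solution t"
  then obtain k where k: "\<forall>x. g b x = 0 \<longrightarrow> S x = k *\<^sub>R x" and e2: "commuting_solution t"
    unfolding scalar_solution_def by blast
  note h = scalar_case[OF k]
  have "(k * (m + 1))\<^sup>2 = m * (k\<^sup>2 * (m + 1))" using e2 h unfolding commuting_solution_def by metis
  then have "k\<^sup>2 * (m + 1) = 0" by (simp add: algebra_simps power2_eq_square)
  then have "k = 0" using m by simp
  then have "S x = 0" for x using h(1) by simp
  then show False using e2 unfolding commuting_solution_def by blast
qed

end

section \<open>Tensoriality of the curvature\<close>

locale torsion_free_connection = smooth_manifold \<A>
  for \<A> :: "('a::{t2_space, second_countable_topology}, 'e::euclidean_space) chart set" +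
  fixes D :: "('a, 'e) connection"
  assumes linear_connection: "linear_connection \<A> D" and torsion_free: "torsion_free \<A> D"
begin

lemma D_smooth: "smooth_field \<A> X \<Longrightarrow> smooth_field \<A> Y \<Longrightarrow> smooth_field \<A> (D X Y)"
  and D_add_left: "smooth_field \<A> X \<Longrightarrow> smooth_field \<A> X' \<Longrightarrow> smooth_field \<A> Y \<Longrightarrow>
    D (\<lambda>p. X p + X' p) Y = (\<lambda>p. D X Y p + D X' Y p)"
  and D_scale_left: "smooth_fun \<A> f \<Longrightarrow> smooth_field \<A> X \<Longrightarrow> smooth_field \<A> Y \<Longrightarrow>
    D (\<lambda>p. f p *\<^sub>R X p) Y = (\<lambda>p. f p *\<^sub>R D X Y p)"
  and D_add_right: "smooth_field \<A> X \<Longrightarrow> smooth_field \<A> Y \<Longrightarrow> smooth_field \<A> Y' \<Longrightarrow>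
    D X (\<lambda>p. Y p + Y' p) = (\<lambda>p. D X Y p + D X Y' p)"
  and D_scale_right: "smooth_fun \<A> f \<Longrightarrow> smooth_field \<A> X \<Longrightarrow> smooth_field \<A> Y \<Longrightarrow>
    D X (\<lambda>p. f p *\<^sub>R Y p) = (\<lambda>p. deriv_along \<A> X f p *\<^sub>R Y p + f p *\<^sub>R D X Y p)"
  using linear_connection unfolding linear_connection_def by blast+

lemma lie_bracket_eq:
  assumes "smooth_field \<A> X" "smooth_field \<A> Y"
  shows "lie_bracket \<A> X Y = (\<lambda>p. D X Y p + (- 1) *\<^sub>R D Y X p)"
  using torsion_free assms unfolding torsion_free_def by (auto simp: fun_eq_iff)

lemma smooth_lie_bracket:
  "smooth_field \<A> X \<Longrightarrow> smooth_field \<A> Y \<Longrightarrow> smooth_field \<A> (lie_bracket \<A> X Y)"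
  unfolding lie_bracket_eq
  by (intro smooth_field_add smooth_field_scale[OF smooth_fun_const] D_smooth)

lemma lie_bracket_antisym:
  assumes "smooth_field \<A> X" "smooth_field \<A> Y"
  shows "lie_bracket \<A> Y X = (\<lambda>p. (- 1) *\<^sub>R lie_bracket \<A> X Y p)"
  unfolding lie_bracket_eq[OF assms] lie_bracket_eq[OF assms(2,1)] by (simp add: fun_eq_iff)

lemma lie_bracket_add_left:
  assumes "smooth_field \<A> X" "smooth_field \<A> X'" "smooth_field \<A> Y"
  shows "lie_bracket \<A> (\<lambda>p. X p + X' p) Y = (\<lambda>p. lie_bracket \<A> X Y p + lie_bracket \<A> X' Y p)"
  using assms by (simp add: lie_bracket_eq smooth_field_add D_add_left D_add_right fun_eq_iff)

lemma lie_bracket_scale_left: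
  assumes "smooth_fun \<A> f" "smooth_field \<A> X" "smooth_field \<A> Y"
  shows "lie_bracket \<A> (\<lambda>p. f p *\<^sub>R X p) Y
    = (\<lambda>p. f p *\<^sub>R lie_bracket \<A> X Y p + ((- 1) * deriv_along \<A> Y f p) *\<^sub>R X p)"
  using assms
  by (simp add: lie_bracket_eq smooth_field_scale D_scale_left D_scale_right fun_eq_iff algebra_simps)

lemma smooth_fun_neg:
  assumes "smooth_fun \<A> f" shows "smooth_fun \<A> (\<lambda>p. (- 1) * f p)"
proof (rule smooth_funI)
  show "smooth_on (snd c ` fst c) (\<lambda>x. (- 1) *\<^sub>R (f \<circ> chart_inv c) x)" if "c \<in> \<A>" for c
    using assms that unfolding smooth_fun_def
    by (intro smooth_on_scaleR smooth_on_const chart_image_open) blast+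
qed (simp add: chart_inv_chart)

lemma curvature_add_left:
  assumes "smooth_field \<A> X" "smooth_field \<A> X'" "smooth_field \<A> Y" "smooth_field \<A> Z"
  shows "curvature \<A> D (\<lambda>p. X p + X' p) Y Z p = curvature \<A> D X Y Z p + curvature \<A> D X' Y Z p"
  unfolding curvature_def using assms
  by (simp add: lie_bracket_add_left D_add_left D_add_right smooth_lie_bracket D_smooth algebra_simps)

text \<open>The derivative of \<open>f\<close> along \<open>Y\<close> enters once through the bracket \<open>[f X, Y]\<close> and once through the
Leibniz rule for \<open>D Y (f D X Z)\<close>, with opposite signs.\<close>

lemma curvature_scale_left:
  assumes f: "smooth_fun \<A> f" and X: "smooth_field \<A> X" and Y: "smooth_field \<A> Y" and Z: "smooth_field \<A> Z"
  shows "curvature \<A> D (\<lambda>p. f p *\<^sub>R X p) Y Z p = f p *\<^sub>R curvature \<A> D X Y Z p"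
proof -
  note f' = smooth_fun_neg[OF smooth_fun_deriv_along[OF f Y]]
  have "D (lie_bracket \<A> (\<lambda>p. f p *\<^sub>R X p) Y) Z p
      = f p *\<^sub>R D (lie_bracket \<A> X Y) Z p + ((- 1) * deriv_along \<A> Y f p) *\<^sub>R D X Z p"
    unfolding lie_bracket_scale_left[OF f X Y]
      D_add_left[OF smooth_field_scale[OF f smooth_lie_bracket[OF X Y]] smooth_field_scale[OF f' X] Z]
      D_scale_left[OF f smooth_lie_bracket[OF X Y] Z] D_scale_left[OF f' X Z] ..
  then show ?thesis
    unfolding curvature_def D_scale_left[OF f X D_smooth[OF Y Z]] D_scale_left[OF f X Z]
      D_scale_right[OF f Y D_smooth[OF X Z]]
    by (simp add: algebra_simps)
qed

lemma curvature_antisym: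
  assumes "smooth_field \<A> X" "smooth_field \<A> Y" "smooth_field \<A> Z"
  shows "curvature \<A> D X Y Z p = - curvature \<A> D Y X Z p"
  unfolding curvature_def lie_bracket_antisym[OF assms(2,1)]
    D_scale_left[OF smooth_fun_const smooth_lie_bracket[OF assms(2,1)] assms(3)]
  by simp

lemma curvature_add_right:
  assumes "smooth_field \<A> X" "smooth_field \<A> Y" "smooth_field \<A> Z" "smooth_field \<A> Z'"
  shows "curvature \<A> D X Y (\<lambda>p. Z p + Z' p) p = curvature \<A> D X Y Z p + curvature \<A> D X Y Z' p"
  unfolding curvature_def using assms
  by (simp add: D_add_right smooth_lie_bracket D_smooth algebra_simps)

text \<open>The first derivatives of \<open>f\<close> cancel by antisymmetry in \<open>X\<close> and \<open>Y\<close>, the second ones by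
\<open>[X, Y] f = X (Y f) - Y (X f)\<close>.\<close>

lemma curvature_scale_right:
  assumes f: "smooth_fun \<A> f" and X: "smooth_field \<A> X" and Y: "smooth_field \<A> Y" and Z: "smooth_field \<A> Z"
  shows "curvature \<A> D X Y (\<lambda>p. f p *\<^sub>R Z p) p = f p *\<^sub>R curvature \<A> D X Y Z p"
proof -
  have DD: "D V (D W (\<lambda>p. f p *\<^sub>R Z p)) p
      = deriv_along \<A> V (deriv_along \<A> W f) p *\<^sub>R Z p + deriv_along \<A> W f p *\<^sub>R D V Z p
        + (deriv_along \<A> V f p *\<^sub>R D W Z p + f p *\<^sub>R D V (D W Z) p)"
    if V: "smooth_field \<A> V" and W: "smooth_field \<A> W" for V W
    unfolding D_scale_right[OF f W Z]
      D_add_right[OF V smooth_field_scale[OF smooth_fun_deriv_along[OF f W] Z] smooth_field_scale[OF f D_smooth[OF W Z]]]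
      D_scale_right[OF smooth_fun_deriv_along[OF f W] V Z] D_scale_right[OF f V D_smooth[OF W Z]] ..
  show ?thesis
    unfolding curvature_def DD[OF X Y] DD[OF Y X] D_scale_right[OF f smooth_lie_bracket[OF X Y] Z]
      deriv_along_lie_bracket[OF f X Y]
    by (simp add: algebra_simps)
qed

end

context lie_group
begin

lemma smooth_field_sum:
  assumes "\<And>i. i \<in> I \<Longrightarrow> smooth_field \<A> (X i)"
  shows "smooth_field \<A> (\<lambda>p. \<Sum>i\<in>I. X i p)"
  using assms
proof (induction I rule: infinite_finite_induct)
  case (insert i I)
  then show ?case by (simp add: smooth_field_add)
next
  case (infinite I)
  then show ?case using smooth_field_scale[OF smooth_fun_const[of 0] smooth_left_inv_field[of 0]] by simp
next
  case empty
  then show ?case using smooth_field_scale[OF smooth_fun_const[of 0] smooth_left_inv_field[of 0]] by simp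
qed

text \<open>Write \<open>X\<close> in the global left-invariant frame. Additivity and homogeneity over functions leave only
the values at \<open>p\<close> of the smooth coefficients, and these agree with the constant coefficients of the
left-invariant field through \<open>X p\<close>.\<close>

lemma tensorial_depends_on_value:
  fixes T :: "('a \<Rightarrow> 'e) \<Rightarrow> 'b::real_vector"
  assumes add: "\<And>X Y. smooth_field \<A> X \<Longrightarrow> smooth_field \<A> Y \<Longrightarrow> T (\<lambda>q. X q + Y q) = T X + T Y"
    and scale: "\<And>f X. smooth_fun \<A> f \<Longrightarrow> smooth_field \<A> X \<Longrightarrow> T (\<lambda>q. f q *\<^sub>R X q) = f p *\<^sub>R T X"
    and X: "smooth_field \<A> X"
  shows "T X = T (left_inv_field G \<A> (to_lie_algebra p (X p)))"
proof -
  let ?E = "left_inv_field G \<A>"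
  have zero: "T (\<lambda>q. 0) = 0"
    using scale[OF smooth_fun_const[of 0] smooth_left_inv_field[of 0]] by simp
  have sum: "T (\<lambda>q. \<Sum>i\<in>I. f i q *\<^sub>R ?E i q) = (\<Sum>i\<in>I. f i p *\<^sub>R T (?E i))"
    if "finite I" "\<And>i. smooth_fun \<A> (f i)" for f I
    using that(1)
  proof (induction I)
    case empty
    then show ?case by (simp add: zero)
  next
    case (insert i I)
    have s: "smooth_field \<A> (\<lambda>q. f j q *\<^sub>R ?E j q)" for j
      by (intro smooth_field_scale that(2) smooth_left_inv_field)
    have "T (\<lambda>q. f i q *\<^sub>R ?E i q + (\<Sum>j\<in>I. f j q *\<^sub>R ?E j q))
        = f i p *\<^sub>R T (?E i) + (\<Sum>j\<in>I. f j p *\<^sub>R T (?E j))"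
      by (simp only: add[OF s smooth_field_sum[OF s]] scale[OF that(2) smooth_left_inv_field] insert.IH)
    then show ?case using insert.hyps by simp
  qed
  have expand: "?E w q = (\<Sum>i\<in>Basis. (w \<bullet> i) *\<^sub>R ?E i q)" for w q
    by (rule linear_eq_sum_Basis[OF linear_left_inv_field])
  have "X = (\<lambda>q. \<Sum>i\<in>Basis. (to_lie_algebra q (X q) \<bullet> i) *\<^sub>R ?E i q)"
    unfolding expand[symmetric] by simp
  then have "T X = (\<Sum>i\<in>Basis. (to_lie_algebra p (X p) \<bullet> i) *\<^sub>R T (?E i))"
    using sum[of Basis "\<lambda>i q. to_lie_algebra q (X q) \<bullet> i"] smooth_to_lie_algebra_component[OF X] by simp
  moreover have "?E (to_lie_algebra p (X p)) = (\<lambda>q. \<Sum>i\<in>Basis. (to_lie_algebra p (X p) \<bullet> i) *\<^sub>R ?E i q)"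
    using expand by blast
  then have "T (?E (to_lie_algebra p (X p))) = (\<Sum>i\<in>Basis. (to_lie_algebra p (X p) \<bullet> i) *\<^sub>R T (?E i))"
    using sum[of Basis "\<lambda>i q. to_lie_algebra p (X p) \<bullet> i"] smooth_fun_const by simp
  ultimately show ?thesis by simp
qed

lemma extend_vector: "smooth_field \<A> (extend_vector \<A> p v)" "extend_vector \<A> p v p = v"
proof -
  have "smooth_field \<A> (extend_vector \<A> p v) \<and> extend_vector \<A> p v p = v"
    unfolding extend_vector_def
    by (rule someI[of _ "left_inv_field G \<A> (to_lie_algebra p v)"]) (simp add: smooth_left_inv_field)
  then show "smooth_field \<A> (extend_vector \<A> p v)" "extend_vector \<A> p v p = v" by auto
qed

end

locale lie_group_connection = lie_group G \<A> + torsion_free_connection \<A> D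
  for G :: "('a::{t2_space, second_countable_topology}, 'm) monoid_scheme" (structure)
    and \<A> :: "('a, 'e::euclidean_space) chart set" and D :: "('a, 'e) connection"
begin

abbreviation "\<E> \<equiv> left_inv_field G \<A>"

lemma curvature_left_inv:
  assumes "smooth_field \<A> X" "smooth_field \<A> Y" "smooth_field \<A> Z"
  shows "curvature \<A> D X Y Z p
    = curvature \<A> D (\<E> (to_lie_algebra p (X p))) (\<E> (to_lie_algebra p (Y p))) (\<E> (to_lie_algebra p (Z p))) p"
proof -
  let ?X = "\<E> (to_lie_algebra p (X p))" and ?Y = "\<E> (to_lie_algebra p (Y p))"
  note sm = smooth_left_inv_field
  have first: "curvature \<A> D V W U p = curvature \<A> D (\<E> (to_lie_algebra p (V p))) W U p"
    if "smooth_field \<A> V" "smooth_field \<A> W" "smooth_field \<A> U" for V W U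
    by (rule tensorial_depends_on_value[where T="\<lambda>V. curvature \<A> D V W U p"])
      (simp_all add: that curvature_add_left curvature_scale_left)
  have "curvature \<A> D X Y Z p = curvature \<A> D ?X Y Z p" by (rule first[OF assms])
  also have "\<dots> = - curvature \<A> D Y ?X Z p" by (rule curvature_antisym[OF sm assms(2,3)])
  also have "\<dots> = - curvature \<A> D ?Y ?X Z p" by (simp only: first[OF assms(2) sm assms(3), symmetric])
  also have "\<dots> = curvature \<A> D ?X ?Y Z p" by (rule curvature_antisym[OF sm sm assms(3), symmetric])
  also have "\<dots> = curvature \<A> D ?X ?Y (\<E> (to_lie_algebra p (Z p))) p"
    by (rule tensorial_depends_on_value[where T="\<lambda>Z. curvature \<A> D ?X ?Y Z p"])
      (simp_all add: assms sm curvature_add_right curvature_scale_right)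
  finally show ?thesis .
qed

lemma ricci_left_inv:
  "ricci \<A> D p u v = trace_on UNIV (\<lambda>z. curvature \<A> D (\<E> (to_lie_algebra p u))
     (\<E> (to_lie_algebra p z)) (\<E> (to_lie_algebra p v)) p)"
  unfolding ricci_def
  by (subst curvature_left_inv[OF extend_vector(1) extend_vector(1) extend_vector(1)]) (simp add: extend_vector(2))

lemma left_inv_field_add: "\<E> (u + v) = (\<lambda>p. \<E> u p + \<E> v p)"
  and left_inv_field_scale: "\<E> (k *\<^sub>R v) = (\<lambda>p. k *\<^sub>R \<E> v p)"
  by (simp_all add: fun_eq_iff linear_add[OF linear_left_inv_field] linear_cmul[OF linear_left_inv_field])

lemma lie_alg_bracket_antisym: "lie_alg_bracket G \<A> v u = - lie_alg_bracket G \<A> u v"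
  unfolding lie_alg_bracket_def lie_bracket_antisym[OF smooth_left_inv_field[of u] smooth_left_inv_field[of v]] by simp

lemma lie_alg_bracket_add_left: "lie_alg_bracket G \<A> (u + u') v = lie_alg_bracket G \<A> u v + lie_alg_bracket G \<A> u' v"
  unfolding lie_alg_bracket_def left_inv_field_add
  by (simp add: lie_bracket_add_left smooth_left_inv_field)

lemma lie_alg_bracket_scale_left: "lie_alg_bracket G \<A> (k *\<^sub>R u) v = k *\<^sub>R lie_alg_bracket G \<A> u v"
proof -
  have "deriv_along \<A> X (\<lambda>p. k) \<one> = 0" for X
    unfolding deriv_along_def by (simp add: comp_def)
  then show ?thesis
    unfolding lie_alg_bracket_def left_inv_field_scale
    by (simp add: lie_bracket_scale_left smooth_left_inv_field smooth_fun_const)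
qed

lemma bilinear_lie_alg_bracket: "bilinear (lie_alg_bracket G \<A>)"
proof -
  have lin: "linear (\<lambda>u. lie_alg_bracket G \<A> u v)" for v
    by (intro linearI lie_alg_bracket_add_left lie_alg_bracket_scale_left)
  have "linear (lie_alg_bracket G \<A> u)" for u
  proof -
    have eq: "lie_alg_bracket G \<A> u = (\<lambda>v. - lie_alg_bracket G \<A> v u)"
      by (rule ext) (rule lie_alg_bracket_antisym)
    show ?thesis by (subst eq) (rule linear_compose_neg[OF lin])
  qed
  with lin show ?thesis unfolding bilinear_def by blast
qed

end

section \<open>Weyl connections on left-invariant fields\<close>

text \<open>\<open>W\<close> is a candidate for the connection on left-invariant fields: it has the right torsion and
satisfies \<open>D g = - 2 \<theta> \<otimes> g\<close> at the level of the Lie algebra.\<close>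

locale left_inv_weyl_connection = lie_group_connection G \<A> D + inner_product_space g
  for G :: "('a::{t2_space, second_countable_topology}, 'm) monoid_scheme" (structure)
    and \<A> :: "('a, 'e::euclidean_space) chart set" and D :: "('a, 'e) connection"
    and g :: "'e \<Rightarrow> 'e \<Rightarrow> real" +
  fixes \<theta> :: "'a \<Rightarrow> 'e \<Rightarrow> real" and t :: 'e and W :: "'e \<Rightarrow> 'e \<Rightarrow> 'e"
  assumes lee: "lee_form \<A> D (metric_of G \<A> g) \<theta>" and \<theta>: "left_inv_form G \<A> \<theta>"
    and t: "\<theta> \<one> v = g t v"
    and W_bilinear: "bilinear W"
    and W_torsion: "W u v - W v u = lie_alg_bracket G \<A> u v"
    and W_metric: "g (W u v) w + g v (W u w) = 2 * g t u * g v w"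
begin

lemma metric_of_eq: "metric_of G \<A> g p u v = g (to_lie_algebra p u) (to_lie_algebra p v)"
  unfolding metric_of_def to_lie_algebra_def ..

text \<open>Uniqueness of the Weyl connection with a given Lee form, as for the Levi-Civita connection: the
difference \<open>K\<close> of the two products is symmetric in its arguments and skew with respect to \<open>g\<close>, and
using both symmetries in turn gives \<open>g (K u v) w = - g (K u v) w\<close>. Functions \<open>g (\<E> v) (\<E> w)\<close> are constant, so their
derivative does not contribute.\<close>

lemma connection_left_inv: "D (\<E> u) (\<E> v) = \<E> (W u v)"
proof
  fix p
  define N where "N u v = to_lie_algebra p (D (\<E> u) (\<E> v) p)" for u v
  note sm = smooth_left_inv_field
  have torsion: "N u v - N v u = lie_alg_bracket G \<A> u v" for u v
  proof -
    have "D (\<E> u) (\<E> v) p - D (\<E> v) (\<E> u) p = \<E> (lie_alg_bracket G \<A> u v) p"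
      using torsion_free sm lie_bracket_left_inv_field unfolding torsion_free_def by metis
    from arg_cong[OF this, of "to_lie_algebra p"] show ?thesis
      unfolding N_def by (simp add: linear_diff[OF linear_to_lie_algebra])
  qed
  have metric: "g (N u v) w + g v (N u w) = 2 * g t u * g v w" for u v w
  proof -
    have "deriv_along \<A> (\<E> u) (\<lambda>q. metric_of G \<A> g q (\<E> v q) (\<E> w q)) p = 0"
      unfolding metric_of_eq deriv_along_def by (simp add: comp_def)
    moreover have "\<theta> p (\<E> u p) = g t u"
      using \<theta> t unfolding left_inv_form_def left_inv_field_def by (metis mult_one)
    moreover have "deriv_along \<A> (\<E> u) (\<lambda>q. metric_of G \<A> g q (\<E> v q) (\<E> w q)) p
        - metric_of G \<A> g p (D (\<E> u) (\<E> v) p) (\<E> w p) - metric_of G \<A> g p (\<E> v p) (D (\<E> u) (\<E> w) p)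
        = - 2 * \<theta> p (\<E> u p) * metric_of G \<A> g p (\<E> v p) (\<E> w p)"
      using lee sm unfolding lee_form_def by blast
    ultimately show ?thesis unfolding metric_of_eq N_def by simp
  qed
  define K where "K u v = N u v - W u v" for u v
  have K_sym: "K u v = K v u" for u v
    using torsion[of u v] W_torsion[of u v] unfolding K_def by (simp add: algebra_simps)
  have K_skew: "g (K u v) w = - g v (K u w)" for u v w
    using metric[of u v w] W_metric[of u v w] unfolding K_def by simp
  have "g (K u v) w = - g (K u v) w" for u v w
  proof -
    have "g (K u v) w = - g (K w u) v" using K_skew[of u v w] K_sym[of u w] g_sym by metis
    also have "\<dots> = g (K w v) u" using K_skew[of w u v] g_sym[of u "K w v"] by simp
    also have "\<dots> = - g (K u v) w" using K_skew[of v w u] K_sym[of w v] K_sym[of v u] g_sym[of w "K u v"] by simp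
    finally show ?thesis .
  qed
  then have "g (K u v) w = 0" for u v w by (simp add: equal_neg_zero)
  then have "K u v = 0" for u v by (metis g_eq_0_iff)
  then have "to_lie_algebra p (D (\<E> u) (\<E> v) p) = W u v" unfolding K_def N_def by simp
  then show "D (\<E> u) (\<E> v) p = \<E> (W u v) p" by (metis left_inv_field_to_lie_algebra)
qed

lemma curvature_left_inv_field: "curvature \<A> D (\<E> u) (\<E> z) (\<E> v) p = \<E> (curvature_op W u z v) p"
proof -
  have "lie_bracket \<A> (\<E> u) (\<E> z) = \<E> (W u z - W z u)"
    using lie_bracket_left_inv_field unfolding W_torsion by blast
  then show ?thesis
    unfolding curvature_def curvature_op_def connection_left_inv
    by (simp add: connection_left_inv linear_add[OF linear_left_inv_field] linear_diff[OF linear_left_inv_field])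
qed

lemma inner_product_metric_of: "inner_product_space (metric_of G \<A> g p)"
proof
  note l = linear_add[OF linear_to_lie_algebra] linear_cmul[OF linear_to_lie_algebra]
  have nz: "to_lie_algebra p v \<noteq> 0" if "v \<noteq> 0" for v
    using that left_inv_field_to_lie_algebra[of p v] linear_0[OF linear_left_inv_field, of p] by metis
  show "inner_product (metric_of G \<A> g p)"
    unfolding inner_product_def bilinear_def metric_of_eq
    by (intro conjI allI impI linearI) (simp_all add: l g_pos nz, rule g_sym)
qed

lemma linear_curvature_op: "linear (\<lambda>z. curvature_op W u z v)"
proof -
  have "linear (\<lambda>x. W x y)" "linear (W y)" for y using W_bilinear unfolding bilinear_def by auto
  note l = linear_add[OF this(1)] linear_add[OF this(2)] linear_cmul[OF this(1)] linear_cmul[OF this(2)]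
    linear_diff[OF this(1)] linear_diff[OF this(2)]
  show ?thesis unfolding curvature_op_def by (rule linearI) (simp_all add: l algebra_simps)
qed

text \<open>The translates to \<open>p\<close> of an orthonormal basis of the Lie algebra are orthonormal for the metric at
\<open>p\<close>, so the trace may be computed with them.\<close>

lemma ricci_eq_ricci_form:
  assumes E: "orthonormal_basis UNIV E"
  shows "ricci \<A> D p (\<E> u p) (\<E> v p) = ricci_form E W u v"
proof -
  interpret p: inner_product_space "metric_of G \<A> g p" by (rule inner_product_metric_of)
  have inj: "inj_on (\<lambda>e. \<E> e p) E" by (rule inj_on_inverseI[of _ "to_lie_algebra p"]) simp
  have "span ((\<lambda>e. \<E> e p) ` E) = (\<lambda>e. \<E> e p) ` UNIV"
    using E linear_span_image[OF linear_left_inv_field] unfolding orthonormal_basis_def by metis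
  also have "\<dots> = UNIV" using left_inv_field_to_lie_algebra by (metis surj_def)
  finally have "p.orthonormal_basis UNIV ((\<lambda>e. \<E> e p) ` E)"
    using E unfolding p.orthonormal_basis_def orthonormal_basis_def metric_of_eq
    by (auto dest: arg_cong[of _ _ "to_lie_algebra p"])
  note tr = p.trace_on_orthonormal_basis[OF this subspace_UNIV UNIV_I]
  note l = linear_add[OF linear_to_lie_algebra] linear_cmul[OF linear_to_lie_algebra]
     linear_add[OF linear_left_inv_field] linear_cmul[OF linear_left_inv_field]
     linear_add[OF linear_curvature_op] linear_cmul[OF linear_curvature_op]
  have "ricci \<A> D p (\<E> u p) (\<E> v p) = trace_on UNIV (\<lambda>z. \<E> (curvature_op W u (to_lie_algebra p z) v) p)"
    unfolding ricci_left_inv curvature_left_inv_field by simp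
  also have "\<dots> = (\<Sum>e\<in>(\<lambda>e. \<E> e p) ` E. metric_of G \<A> g p (\<E> (curvature_op W u (to_lie_algebra p e) v) p) e)"
    by (rule tr) (simp_all add: l)
  also have "\<dots> = ricci_form E W u v"
    unfolding sum.reindex[OF inj] ricci_form_def metric_of_eq by simp
  finally show ?thesis .
qed

lemma sym_part_ricci:
  assumes E: "orthonormal_basis UNIV E"
  shows "sym_part (ricci \<A> D p) u v = sym_part (ricci_form E W) (to_lie_algebra p u) (to_lie_algebra p v)"
  using ricci_eq_ricci_form[OF E, of p "to_lie_algebra p u" "to_lie_algebra p v"]
    ricci_eq_ricci_form[OF E, of p "to_lie_algebra p v" "to_lie_algebra p u"]
  unfolding sym_part_def by simp

text \<open>Metrics of the conformal class differ by a positive factor, which can be absorbed in \<open>l\<close>. The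
condition at the identity already determines the condition at every point by left-invariance.\<close>

lemma weyl_einstein_iff:
  assumes E: "orthonormal_basis UNIV E"
    and c: "c = conformal_class \<A> (metric_of G \<A> g)" and weyl: "weyl_structure \<A> c D"
  shows "weyl_einstein \<A> c D \<longleftrightarrow> (\<exists>l. \<forall>u v. sym_part (ricci_form E W) u v = l * g u v)"
proof
  assume "weyl_einstein \<A> c D"
  then obtain h where "h \<in> c" and h: "\<forall>p u v. trace_free_part (h p) (sym_part (ricci \<A> D p)) u v = 0"
    unfolding weyl_einstein_def by blast
  then obtain f where hf: "h = (\<lambda>p u v. f p * metric_of G \<A> g p u v)" and f: "\<forall>p. 0 < f p"
    unfolding c conformal_class_def by blast
  have one: "to_lie_algebra \<one> v = v" for v
    using to_lie_algebra_left_inv_field[of \<one> v] by simp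
  have h1: "h \<one> = (\<lambda>u v. f \<one> * g u v)" unfolding hf metric_of_eq one ..
  have "inner_product (h \<one>)"
    unfolding h1 inner_product_def bilinear_def using f
    by (intro conjI allI impI linearI) (simp_all add: g_pos algebra_simps, metis g_sym)
  then interpret h: inner_product_space "h \<one>" by unfold_locales
  obtain l where "\<And>u v. sym_part (ricci \<A> D \<one>) u v = l * h \<one> u v"
    using h h.trace_free_part_eq_0_iff[of "sym_part (ricci \<A> D \<one>)"] by blast
  then have "sym_part (ricci_form E W) u v = (l * f \<one>) * g u v" for u v
    unfolding sym_part_ricci[OF E] h1 one by simp
  then show "\<exists>l. \<forall>u v. sym_part (ricci_form E W) u v = l * g u v" by blast
next
  assume "\<exists>l. \<forall>u v. sym_part (ricci_form E W) u v = l * g u v"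
  then obtain l where l: "\<And>u v. sym_part (ricci_form E W) u v = l * g u v" by blast
  have "trace_free_part (metric_of G \<A> g p) (sym_part (ricci \<A> D p)) u v = 0" for p u v
  proof -
    interpret p: inner_product_space "metric_of G \<A> g p" by (rule inner_product_metric_of)
    show ?thesis
      using p.trace_free_part_eq_0_iff[of "sym_part (ricci \<A> D p)"]
      unfolding sym_part_ricci[OF E] l metric_of_eq by blast
  qed
  moreover have "metric_of G \<A> g \<in> c"
    unfolding c conformal_class_def using smooth_fun_const[of 1] by force
  ultimately show "weyl_einstein \<A> c D" using weyl unfolding weyl_einstein_def by blast
qed

end

section \<open>From the ideal to the Lie algebra\<close>

context inner_product_space
begin

text \<open>A map with an adjoint is linear; thus \<open>A\<close> and \<open>S\<close> are separately linear on the ideal, although only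
their sum is given as a bracket.\<close>

lemma linear_on_subspace_if_adjoint:
  assumes H: "subspace H" and M: "\<And>x. x \<in> H \<Longrightarrow> M x \<in> H"
    and adj: "\<And>x y. x \<in> H \<Longrightarrow> y \<in> H \<Longrightarrow> g (M x) y = g x (N y)"
  shows "x \<in> H \<Longrightarrow> y \<in> H \<Longrightarrow> M (x + y) = M x + M y"
    and "x \<in> H \<Longrightarrow> M (c *\<^sub>R x) = c *\<^sub>R M x"
  by (rule g_extensionality[OF H];
      simp add: adj M subspace_add[OF H] subspace_scale[OF H])+

end

locale unit_normal = inner_product_space g for g :: "'e::euclidean_space \<Rightarrow> 'e \<Rightarrow> real" +
  fixes H :: "'e set" and b :: 'e
  assumes H: "subspace H" and dimH: "dim H + 1 = DIM('e)"
    and b: "g b b = 1" and bH: "x \<in> H \<Longrightarrow> g b x = 0"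
begin

lemma mem_iff: "x \<in> H \<longleftrightarrow> g b x = 0"
proof -
  have sub: "subspace {x. g b x = 0}" by (auto simp: subspace_def)
  \<comment> \<open>The complement of \<open>b\<close> contains \<open>H\<close> and is not everything, so the two hyperplanes coincide.\<close>
  have "dim {x. g b x = 0} \<noteq> DIM('e)"
  proof
    assume "dim {x. g b x = 0} = DIM('e)"
    then have "span {x. g b x = 0} = UNIV" by (simp add: dim_eq_full)
    moreover have "span {x. g b x = 0} = {x. g b x = 0}" using sub by simp
    ultimately have "b \<in> {x. g b x = 0}" by blast
    then show False using b by simp
  qed
  then have "dim {x. g b x = 0} \<le> dim H"
    using dim_subset_UNIV[of "{x. g b x = 0}"] dimH by linarith
  moreover have "H \<subseteq> {x. g b x = 0}" using bH by blast
  ultimately have "H = {x. g b x = 0}" using subspace_dim_equal[OF H sub] by blast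
  then show ?thesis by blast
qed

definition extend_by_zero :: "('e \<Rightarrow> 'e) \<Rightarrow> 'e \<Rightarrow> 'e" where
  "extend_by_zero M u = M (u - g b u *\<^sub>R b)"

lemma proj: "u - g b u *\<^sub>R b \<in> H"
  unfolding mem_iff by (simp add: b)

lemma extend_by_zero_eq: "x \<in> H \<Longrightarrow> extend_by_zero M x = M x"
  unfolding extend_by_zero_def by (simp add: bH)

lemma
  assumes M: "\<And>x. x \<in> H \<Longrightarrow> M x \<in> H" and N: "\<And>x. x \<in> H \<Longrightarrow> N x \<in> H"
    and adj: "\<And>x y. x \<in> H \<Longrightarrow> y \<in> H \<Longrightarrow> g (M x) y = g x (N y)"
  shows linear_extend_by_zero: "linear (extend_by_zero M)"
    and extend_by_zero_normal: "extend_by_zero M b = 0"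
    and extend_by_zero_adjoint: "g (extend_by_zero M x) y = g x (extend_by_zero N y)"
proof -
  note lin = linear_on_subspace_if_adjoint[OF H M adj]
  show "linear (extend_by_zero M)"
  proof (rule linearI)
    fix x y c
    show "extend_by_zero M (x + y) = extend_by_zero M x + extend_by_zero M y"
      unfolding extend_by_zero_def using lin(1)[OF _ _ _ proj proj, of x y] by (simp add: algebra_simps)
    show "extend_by_zero M (c *\<^sub>R x) = c *\<^sub>R extend_by_zero M x"
      unfolding extend_by_zero_def using lin(2)[OF _ _ _ proj, of c x] by (simp add: algebra_simps)
  qed
  then show "extend_by_zero M b = 0"
    unfolding extend_by_zero_def using lin(2)[of b 0] lin(2)[OF _ _ _ subspace_0[OF H], of 0] by (simp add: b)
  let ?x = "x - g b x *\<^sub>R b" and ?y = "y - g b y *\<^sub>R b"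
  have "g (M ?x) b = 0" "g b (N ?y) = 0"
    using bH[OF M[OF proj[of x]]] bH[OF N[OF proj[of y]]] g_sym[of "M ?x" b] by auto
  then show "g (extend_by_zero M x) y = g x (extend_by_zero N y)"
    unfolding extend_by_zero_def using adj[OF proj[of x] proj[of y]] by simp
qed

lemma orthonormal_basis_insert:
  assumes F: "orthonormal_basis H F"
  shows "orthonormal_basis UNIV (insert b F)" "b \<notin> F" "F \<subseteq> H"
proof -
  show FH: "F \<subseteq> H" using F span_superset unfolding orthonormal_basis_def by blast
  then show "b \<notin> F" using bH[of b] b by auto
  have "x \<in> span (insert b F)" for x
  proof -
    have "x - g b x *\<^sub>R b \<in> span F" using proj F unfolding orthonormal_basis_def by blast
    then show ?thesis unfolding span_breakdown_eq by blast
  qed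
  then have "span (insert b F) = UNIV" by blast
  moreover have "g b f = 0" "g f b = 0" if "f \<in> F" for f
    using bH[of f] FH that g_sym[of f b] by auto
  ultimately show "orthonormal_basis UNIV (insert b F)"
    using F b unfolding orthonormal_basis_def by auto
qed

lemma trace_on_extend_by_zero:
  assumes F: "orthonormal_basis H F" and M: "\<And>x. x \<in> H \<Longrightarrow> M x \<in> H"
    and lin: "linear (extend_by_zero M)" and zero: "extend_by_zero M b = 0"
  shows "trace_on H M = trace_in (insert b F) (extend_by_zero M)"
proof -
  have "trace_on H M = (\<Sum>e\<in>F. g (M e) e)"
  proof (rule trace_on_orthonormal_basis[OF F H M])
    fix x y c assume "x \<in> H"
    then show "M (c *\<^sub>R x) = c *\<^sub>R M x"
      using linear_cmul[OF lin, of c x] by (simp add: extend_by_zero_eq subspace_scale[OF H])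
    assume "y \<in> H"
    then show "M (x + y) = M x + M y"
      using \<open>x \<in> H\<close> linear_add[OF lin, of x y] by (simp add: extend_by_zero_eq subspace_add[OF H])
  qed auto
  also have "\<dots> = (\<Sum>e\<in>F. g (extend_by_zero M e) e)"
    using orthonormal_basis_insert(3)[OF F] by (intro sum.cong) (auto simp: extend_by_zero_eq)
  also have "\<dots> = trace_in (insert b F) (extend_by_zero M)"
    using F orthonormal_basis_insert(2)[OF F] zero unfolding trace_in_def orthonormal_basis_def by simp
  finally show ?thesis .
qed

end

context almost_abelian_data
begin

abbreviation levi_civita :: "'e \<Rightarrow> 'e \<Rightarrow> 'e" where
  "levi_civita u v \<equiv> g b u *\<^sub>R A v - g b v *\<^sub>R S u + g (S u) v *\<^sub>R b"

lemma bilinear_levi_civita: "bilinear levi_civita"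
  unfolding bilinear_def by (auto intro!: linearI simp: lin_simps algebra_simps)

lemma levi_civita_skew: "g (levi_civita u v) w = - g v (levi_civita u w)"
  using A[of v w] by (simp add: g_sym[of v "S u"] g_sym[of v b] algebra_simps)

text \<open>Symmetrisation removes the bracket term of \<open>ricci_form_weyl_op\<close>; the commutator \<open>C\<close> is already symmetric.\<close>

lemma weyl_op_einstein_iff:
  "(\<exists>l. \<forall>u v. sym_part (ricci_form E (weyl_op levi_civita t)) u v = l * g u v)
    \<longleftrightarrow> scalar_solution t \<or> commuting_solution t"
proof -
  obtain \<mu> where \<mu>: "ricci_form E (weyl_op levi_civita t) u v = ricci_form E levi_civita u v
      + m * (g t (levi_civita u v) + g t u * g t v) + g t (levi_civita u v - levi_civita v u) + \<mu> * g u v" for u v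
    using ricci_form_weyl_op[OF E bilinear_levi_civita levi_civita_skew, of t] unfolding dim by blast
  have sym: "sym_part (ricci_form E (weyl_op levi_civita t)) u v = weyl_ricci t u v + \<mu> * g u v" for u v
  proof -
    have r: "g (A (S v)) u = - g (S (A u)) v" "g (S (A v)) u = - g (A (S u)) v" "g (S v) u = g (S u) v" "g v u = g u v"
      "g t b = g b t"
      using A S g_sym by (metis minus_minus)+
    show ?thesis
      unfolding sym_part_def \<mu> ricci_form_almost_abelian[OF E linA linS A S b Ab Sb] weyl_ricci_def
      by (simp add: r field_simps)
  qed
  have "(\<exists>l. \<forall>u v. weyl_ricci t u v + \<mu> * g u v = l * g u v) \<longleftrightarrow> (\<exists>l. \<forall>u v. weyl_ricci t u v = l * g u v)"
  proof
    assume "\<exists>l. \<forall>u v. weyl_ricci t u v + \<mu> * g u v = l * g u v"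
    then obtain l where "\<forall>u v. weyl_ricci t u v + \<mu> * g u v = l * g u v" by blast
    then have "\<forall>u v. weyl_ricci t u v = (l - \<mu>) * g u v" by (simp add: algebra_simps eq_diff_eq)
    then show "\<exists>l. \<forall>u v. weyl_ricci t u v = l * g u v" by blast
  next
    assume "\<exists>l. \<forall>u v. weyl_ricci t u v = l * g u v"
    then obtain l where "\<forall>u v. weyl_ricci t u v = l * g u v" by blast
    then have "\<forall>u v. weyl_ricci t u v + \<mu> * g u v = (l + \<mu>) * g u v" by (simp add: algebra_simps)
    then show "\<exists>l. \<forall>u v. weyl_ricci t u v + \<mu> * g u v = l * g u v" by blast
  qed
  then show ?thesis unfolding sym using weyl_ricci_conformal_if weyl_ricci_conformal_only_if by blast
qed

lemma weyl_op_torsion_free: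
  "weyl_op levi_civita t u v - weyl_op levi_civita t v u
    = g b u *\<^sub>R (A v + S v) - g b v *\<^sub>R (A u + S u)"
  using S[of u v] g_sym[of u "S v"] unfolding weyl_op_def by (simp add: g_sym[of v u] algebra_simps)

lemma weyl_op_metric:
  "g (weyl_op levi_civita t u v) w + g v (weyl_op levi_civita t u w) = 2 * g t u * g v w"
  using levi_civita_skew[of u v w] unfolding weyl_op_def
  by (simp add: g_sym[of v u] g_sym[of v t] g_sym[of u w] algebra_simps)

lemma bilinear_weyl_op: "bilinear (weyl_op levi_civita t)"
  unfolding bilinear_def weyl_op_def by (auto intro!: linearI simp: lin_simps algebra_simps)

end

text \<open>The maps \<open>A\<close> and \<open>S\<close> are prescribed on \<open>H\<close> only. They are replaced by their extensions by zero, to which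
the algebraic classification applies; traces over \<open>H\<close> and over the whole algebra then agree.\<close>

theorem theorem6p2:
  fixes G :: "('a::{t2_space, second_countable_topology}, 'm) monoid_scheme"
    and \<A> :: "('a, 'e::euclidean_space) chart set"
    and n :: nat
    and H :: "'e set"
    and g :: "'e \<Rightarrow> 'e \<Rightarrow> real"
    and b t :: 'e
    and A S :: "'e \<Rightarrow> 'e"
    and c :: "('a \<Rightarrow> 'e \<Rightarrow> 'e \<Rightarrow> real) set"
    and D :: "('a, 'e) connection"
    and \<theta> :: "'a \<Rightarrow> 'e \<Rightarrow> real"
  assumes "lie_group G \<A>"
    and "connected (UNIV :: 'a set)"
    and "almost_abelian G \<A>"
    and "n = DIM('e)" and "n \<ge> 3"
    and "codim_one_abelian_ideal G \<A> H"
    and "inner_product g"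
    and "g b b = 1" and "\<And>x. x \<in> H \<Longrightarrow> g b x = 0"
    and "\<And>x. x \<in> H \<Longrightarrow> A x \<in> H" and "\<And>x. x \<in> H \<Longrightarrow> S x \<in> H"
    and "\<And>x. x \<in> H \<Longrightarrow> lie_alg_bracket G \<A> b x = A x + S x"
    and "\<And>x y. x \<in> H \<Longrightarrow> y \<in> H \<Longrightarrow> g (A x) y = - g x (A y)"
    and "\<And>x y. x \<in> H \<Longrightarrow> y \<in> H \<Longrightarrow> g (S x) y = g x (S y)"
    and "c = conformal_class \<A> (metric_of G \<A> g)"
    and "left_inv_weyl_structure G \<A> c D"
    and "lee_form \<A> D (metric_of G \<A> g) \<theta>"
    and "\<And>v. \<theta> \<one>\<^bsub>G\<^esub> v = g t v"
  defines "cond1 \<equiv> (\<exists>k::real. (\<forall>x\<in>H. S x = k *\<^sub>R x) \<and> (t = 0 \<or> t = k *\<^sub>R b))"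
    and "cond2 \<equiv> (\<exists>x\<in>H. S x \<noteq> 0) \<and>
           (trace_on H S)\<^sup>2 = (real n - 2) * trace_on H (S \<circ> S) \<and>
           (\<forall>x\<in>H. A (S x) = S (A x)) \<and>
           t = (trace_on H S / (real n - 2)) *\<^sub>R b"
  shows "(weyl_einstein \<A> c D \<longleftrightarrow> cond1 \<or> cond2) \<and> \<not> (cond1 \<and> cond2)"
proof -
  interpret lie_group G \<A> by fact
  have weyl: "weyl_structure \<A> c D" and \<theta>: "left_inv_form G \<A> \<theta>"
  proof -
    show weyl: "weyl_structure \<A> c D"
      using \<open>left_inv_weyl_structure G \<A> c D\<close> unfolding left_inv_weyl_structure_def by blast
    \<comment> \<open>The Lee form is left-invariant because the metric it refers to is.\<close>
    have "left_inv_metric G \<A> (metric_of G \<A> g)"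
      unfolding left_inv_metric_def
    proof (intro allI)
      fix a p u v
      have "left_transl G \<A> (inv\<^bsub>G\<^esub> (a \<otimes>\<^bsub>G\<^esub> p)) (a \<otimes>\<^bsub>G\<^esub> p) (left_transl G \<A> a p w) = left_transl G \<A> (inv\<^bsub>G\<^esub> p) p w" for w
      proof -
        have "inv\<^bsub>G\<^esub> (a \<otimes>\<^bsub>G\<^esub> p) \<otimes>\<^bsub>G\<^esub> a = inv\<^bsub>G\<^esub> p"
          by (simp add: inv_mult_group carrier_UNIV mult_assoc)
        then show ?thesis unfolding left_transl_comp by simp
      qed
      then show "metric_of G \<A> g (a \<otimes>\<^bsub>G\<^esub> p) (left_transl G \<A> a p u) (left_transl G \<A> a p v) = metric_of G \<A> g p u v"
        unfolding metric_of_def by simp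
    qed
    moreover have "metric_of G \<A> g \<in> c"
      unfolding \<open>c = _\<close> conformal_class_def using smooth_fun_const[of 1] by force
    ultimately show "left_inv_form G \<A> \<theta>"
      using \<open>left_inv_weyl_structure G \<A> c D\<close> \<open>lee_form \<A> D (metric_of G \<A> g) \<theta>\<close>
      unfolding left_inv_weyl_structure_def by blast
  qed
  interpret lie_group_connection G \<A> D
    using weyl unfolding weyl_structure_def by unfold_locales auto
  have ideal: "subspace H" "dim H + 1 = DIM('e)" "\<And>x y. x \<in> H \<Longrightarrow> y \<in> H \<Longrightarrow> lie_alg_bracket G \<A> x y = 0"
    using \<open>codim_one_abelian_ideal G \<A> H\<close> unfolding codim_one_abelian_ideal_def by auto
  interpret unit_normal g H b
    using ideal assms(7-9) by unfold_locales auto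
  obtain F where F: "orthonormal_basis H F" using orthonormal_basis_exists[OF ideal(1)] by blast
  let ?E = "insert b F"
  let ?A = "extend_by_zero A" and ?S = "extend_by_zero S"
  note E = orthonormal_basis_insert[OF F]
  have AN: "g (A x) y = g x (- A y)" "- A x \<in> H" if "x \<in> H" "y \<in> H" for x y
    using assms(10,13) that subspace_neg[OF ideal(1)] by auto
  have A: "linear ?A" "?A b = 0" "\<And>x y. g (?A x) y = g x (extend_by_zero (\<lambda>x. - A x) y)"
    using linear_extend_by_zero[of A "\<lambda>x. - A x"] extend_by_zero_normal[of A "\<lambda>x. - A x"]
      extend_by_zero_adjoint[of A "\<lambda>x. - A x"] assms(10) AN by auto
  have S: "linear ?S" "?S b = 0" "\<And>x y. g (?S x) y = g x (?S y)"
    using linear_extend_by_zero[of S S] extend_by_zero_normal[of S S]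
      extend_by_zero_adjoint[of S S] assms(11,14) by auto
  have n: "real n - 2 = real DIM('e) - 2" "1 \<le> real n - 2" using assms(4,5) by auto
  interpret alg: almost_abelian_data g ?E ?A ?S b "real n - 2"
  proof (intro almost_abelian_data.intro almost_abelian_data_axioms.intro)
    show "g (?A x) y = - g x (?A y)" for x y
      using A(3)[of x y] unfolding extend_by_zero_def by simp
  qed (rule inner_product_space_axioms n E(1) A(1,2) S assms(8))+
  have bracket: "lie_alg_bracket G \<A> u v = g b u *\<^sub>R (?A v + ?S v) - g b v *\<^sub>R (?A u + ?S u)" for u v
  proof -
    let ?B = "lie_alg_bracket G \<A>"
    let ?u = "u - g b u *\<^sub>R b" and ?v = "v - g b v *\<^sub>R b"
    have lin: "linear (\<lambda>x. ?B x y)" "linear (?B y)" for y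
      using bilinear_lie_alg_bracket unfolding bilinear_def by auto
    have "2 *\<^sub>R ?B b b = 0" unfolding scaleR_2 using lie_alg_bracket_antisym[of b b] by (simp only: eq_neg_iff_add_eq_0)
    then have bb: "?B b b = 0" by simp
    have bx: "?B b ?v = ?A v + ?S v" "?B ?u b = - (?A u + ?S u)"
      using assms(12)[OF proj] lie_alg_bracket_antisym[of ?u b] unfolding extend_by_zero_def by auto
    have "?B u v = ?B (g b u *\<^sub>R b + ?u) (g b v *\<^sub>R b + ?v)" by simp
    also have "\<dots> = g b u *\<^sub>R ?B b ?v + g b v *\<^sub>R ?B ?u b"
      by (simp only: linear_add[OF lin(1)] linear_add[OF lin(2)] linear_cmul[OF lin(1)] linear_cmul[OF lin(2)]
          bb ideal(3)[OF proj proj]) simp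
    finally show ?thesis unfolding bx by (simp add: algebra_simps)
  qed
  interpret left_inv_weyl_connection G \<A> D g \<theta> t "weyl_op alg.levi_civita t"
    using assms(17,18) \<theta> alg.bilinear_weyl_op alg.weyl_op_metric
    by unfold_locales (simp_all only: alg.weyl_op_torsion_free bracket)
  have "weyl_einstein \<A> c D \<longleftrightarrow> alg.scalar_solution t \<or> alg.commuting_solution t"
    unfolding weyl_einstein_iff[OF E(1) \<open>c = _\<close> weyl] by (rule alg.weyl_op_einstein_iff)
  moreover have "cond1 \<longleftrightarrow> alg.scalar_solution t"
    unfolding cond1_def alg.scalar_solution_def mem_iff[symmetric] by (auto simp: extend_by_zero_eq)
  moreover have "cond2 \<longleftrightarrow> alg.commuting_solution t"
  proof -
    have SS: "extend_by_zero (S \<circ> S) = (\<lambda>x. ?S (?S x))"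
      using assms(11) proj by (auto simp: fun_eq_iff extend_by_zero_eq extend_by_zero_def bH)
    have tr: "trace_on H S = trace_in ?E ?S"
      by (rule trace_on_extend_by_zero[OF F _ S(1,2)]) (rule assms(11))
    have trSS: "trace_on H (S \<circ> S) = trace_in ?E (\<lambda>x. ?S (?S x))"
      unfolding SS[symmetric]
    proof (rule trace_on_extend_by_zero[OF F])
      show "linear (extend_by_zero (S \<circ> S))" "extend_by_zero (S \<circ> S) b = 0"
        unfolding SS using linear_compose[OF S(1) S(1)] S(2) linear_0[OF S(1)] by (simp_all add: o_def)
    qed (use assms(11) in auto)
    have ex: "(\<exists>x\<in>H. S x \<noteq> 0) \<longleftrightarrow> (\<exists>x. ?S x \<noteq> 0)"
      using proj by (auto simp: extend_by_zero_def) (metis extend_by_zero_def extend_by_zero_eq)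
    have comm: "(\<forall>x\<in>H. A (S x) = S (A x)) \<longleftrightarrow> (\<forall>x. ?A (?S x) - ?S (?A x) = 0)"
    proof -
      have "?A (?S x) - ?S (?A x) = A (S (x - g b x *\<^sub>R b)) - S (A (x - g b x *\<^sub>R b))" for x
        using assms(10,11) proj by (auto simp: extend_by_zero_def bH)
      then show ?thesis using proj by (auto simp: bH) (metis bH diff_zero scale_zero_left)
    qed
    show ?thesis unfolding cond2_def alg.commuting_solution_def tr trSS ex comm ..
  qed
  ultimately show ?thesis using alg.solutions_exclusive by blast
qed

end
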